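(* For every finite $k$-step nilspace $N$ there is a $k$-step free nilspace $F=F(a_1,\dots,a_k)$ and a factor map $h:F\rightarrow N$ with the following property: for every $n$ and every morphism $\phi:\mathbb{Z}^n\rightarrow N$ there is a morphism $\phi':\mathbb{Z}^n\rightarrow F$ with $h\circ\phi'=\phi$.
   Context: A cube morphism $\{0,1\}^n\rightarrow\{0,1\}^m$ is a map extending to an affine homomorphism $\mathbb{Z}^n\rightarrow\mathbb{Z}^m$. A cubespace is a set $X$ with sets $C^n(X)\subseteq X^{\{0,1\}^n}$ closed under precomposition with cube morphisms; a morphism of cubespaces sends cubes to cubes; products carry the coordinatewise cube structure. A nilspace is a cubespace with $C^1(X)=X^{\{0,1\}}$ and the gluing property: a map on $\{0,1\}^n\setminus\{1^n\}$ whose restrictions to all $(n-1)$-faces containing $0^n$ are cubes extends to a cube on $\{0,1\}^n$; it is $k$-step if the extension is unique for $n=k+1$. An abelian group $G$ (such as $\mathbb{Z}^n$) carries its linear structure: cubes are the maps $\{0,1\}^m\rightarrow G$ extending to affine homomorphisms $\mathbb{Z}^m\rightarrow G$. For an abelian group $A$, $\mathcal{D}_k(A)$ is $A$ with cubes those $f:\{0,1\}^m\rightarrow A$ with $\sum_{v\in\{0,1\}^{k+1}}(-1)^{v_1+\dots+v_{k+1}}f(\psi(v))=0$ for every cube morphism $\psi:\{0,1\}^{k+1}\rightarrow\{0,1\}^m$. The free nilspace is $F(a_1,\dots,a_k)=\prod_{i=1}^k\mathcal{D}_i(\mathbb{Z}^{a_i})$ ($a_i$ natural numbers). For $x,y$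 in a nilspace $X$, $x\sim_i y$ means the map $c$ on $\{0,1\}^{i+1}$ with $c(0^{i+1})=x$ and $c(v)=y$ otherwise is a cube; this is an equivalence relation. A morphism $\phi:X\rightarrow Y$ of $k$-step nilspaces is a factor map if for every $1\leq i\leq k$ the image of every $\sim_i$-class of $X$ is a (whole) $\sim_i$-class of $Y$. *)

theory Defs
  imports Main "HOL-Library.FuncSet" "HOL-Library.Function_Algebras"
begin

text \<open>Vertices of the discrete cube {0,1}^n are boolean lists of length n
  (True = 1, False = 0).\<close>
definition vert :: "nat \<Rightarrow> bool list set" where
  "vert n = {v. length v = n}"

text \<open>Cube morphisms {0,1}^n -> {0,1}^m: maps that extend to an affine
  homomorphism Z^n -> Z^m, i.e. psi(v) = b + sum of a_i over i with v_i = 1.\<close>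
definition cube_morphism :: "nat \<Rightarrow> nat \<Rightarrow> (bool list \<Rightarrow> bool list) \<Rightarrow> bool" where
  "cube_morphism n m \<psi> \<longleftrightarrow>
     (\<exists>(b::nat \<Rightarrow> int) (a::nat \<Rightarrow> nat \<Rightarrow> int). \<forall>v\<in>vert n.
        length (\<psi> v) = m \<and>
        (\<forall>j<m. of_bool (\<psi> v ! j) = b j + (\<Sum>i\<in>{i. i < n \<and> v ! i}. a i j)))"

text \<open>A cubespace: a carrier set together with, for every n, a set of n-cubes,
  i.e. maps from vert n to the carrier (stored extensionally).\<close>
type_synonym 'a cubespace = "'a set \<times> (nat \<Rightarrow> (bool list \<Rightarrow> 'a) set)"

abbreviation carr :: "'a cubespace \<Rightarrow> 'a set" where "carr X \<equiv> fst X"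
abbreviation cubes :: "'a cubespace \<Rightarrow> nat \<Rightarrow> (bool list \<Rightarrow> 'a) set" where "cubes X \<equiv> snd X"

definition cmaps :: "'a set \<Rightarrow> nat \<Rightarrow> (bool list \<Rightarrow> 'a) set" where
  "cmaps S n = extensional (vert n) \<inter> (vert n \<rightarrow> S)"

definition is_cubespace :: "'a cubespace \<Rightarrow> bool" where
  "is_cubespace X \<longleftrightarrow>
     (\<forall>n. cubes X n \<subseteq> cmaps (carr X) n) \<and>
     (\<forall>n m \<psi> f. cube_morphism n m \<psi> \<longrightarrow> f \<in> cubes X m \<longrightarrow>
        restrict (f \<circ> \<psi>) (vert n) \<in> cubes X n)"

definition ones :: "nat \<Rightarrow> bool list" where "ones n = replicate n True"
definition zeros :: "nat \<Rightarrow> bool list" where "zeros n = replicate n False"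

definition ins0 :: "nat \<Rightarrow> bool list \<Rightarrow> bool list" where
  "ins0 i w = take i w @ False # drop i w"

definition corner :: "'a cubespace \<Rightarrow> nat \<Rightarrow> (bool list \<Rightarrow> 'a) \<Rightarrow> bool" where
  "corner X n g \<longleftrightarrow>
     (\<forall>i<n. restrict (g \<circ> ins0 i) (vert (n - 1)) \<in> cubes X (n - 1))"

definition is_nilspace :: "'a cubespace \<Rightarrow> bool" where
  "is_nilspace X \<longleftrightarrow> is_cubespace X \<and> carr X \<noteq> {} \<and>
     cubes X 1 = cmaps (carr X) 1 \<and>
     (\<forall>n\<ge>1. \<forall>g. corner X n g \<longrightarrow>
        (\<exists>c\<in>cubes X n. \<forall>v\<in>vert n - {ones n}. c v = g v))"

definition is_kstep_nilspace :: "nat \<Rightarrow> 'a cubespace \<Rightarrow> bool" where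
  "is_kstep_nilspace k X \<longleftrightarrow> is_nilspace X \<and>
     (\<forall>g. corner X (k + 1) g \<longrightarrow>
        (\<forall>c\<in>cubes X (k + 1). \<forall>c'\<in>cubes X (k + 1).
           (\<forall>v\<in>vert (k + 1) - {ones (k + 1)}. c v = g v \<and> c' v = g v) \<longrightarrow> c = c'))"

definition cs_morphism :: "'a cubespace \<Rightarrow> 'b cubespace \<Rightarrow> ('a \<Rightarrow> 'b) \<Rightarrow> bool" where
  "cs_morphism X Y f \<longleftrightarrow> f ` carr X \<subseteq> carr Y \<and>
     (\<forall>n. \<forall>c\<in>cubes X n. restrict (f \<circ> c) (vert n) \<in> cubes Y n)"

definition sim :: "'a cubespace \<Rightarrow> nat \<Rightarrow> 'a \<Rightarrow> 'a \<Rightarrow> bool" where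
  "sim X i x y \<longleftrightarrow>
     restrict (\<lambda>v. if v = zeros (i + 1) then x else y) (vert (i + 1)) \<in> cubes X (i + 1)"

definition factor_map :: "nat \<Rightarrow> 'a cubespace \<Rightarrow> 'b cubespace \<Rightarrow> ('a \<Rightarrow> 'b) \<Rightarrow> bool" where
  "factor_map k X Y f \<longleftrightarrow> cs_morphism X Y f \<and>
     (\<forall>i\<in>{1..k}. \<forall>x\<in>carr X.
        f ` {y\<in>carr X. sim X i x y} = {z\<in>carr Y. sim Y i (f x) z})"

text \<open>Linear (affine) cube structure on an abelian group, given as a subgroup
  carrier G of a type of class ab_group_add: cubes are restrictions of affine
  homomorphisms Z^m -> G, i.e. v |-> b + sum of g_i over i with v_i = 1.\<close>
definition lin_cs :: "'g::ab_group_add set \<Rightarrow> 'g cubespace" where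
  "lin_cs G = (G, \<lambda>m. {f\<in>cmaps G m. \<exists>b\<in>G. \<exists>g. (\<forall>i<m. g i \<in> G) \<and>
      (\<forall>v\<in>vert m. f v = b + (\<Sum>i\<in>{i. i < m \<and> v ! i}. g i))})"

definition Dk :: "nat \<Rightarrow> 'g::ab_group_add set \<Rightarrow> 'g cubespace" where
  "Dk k G = (G, \<lambda>m. {f\<in>cmaps G m. \<forall>\<psi>. cube_morphism (k + 1) m \<psi> \<longrightarrow>
      (\<Sum>v\<in>vert (k + 1). if even (length (filter id v)) then f (\<psi> v) else - f (\<psi> v)) = 0})"

definition Zvec :: "nat \<Rightarrow> (nat \<Rightarrow> int) set" where
  "Zvec a = {x. \<forall>j\<ge>a. x j = 0}"

abbreviation Zlin :: "nat \<Rightarrow> (nat \<Rightarrow> int) cubespace" where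
  "Zlin n \<equiv> lin_cs (Zvec n)"

definition prod_cs :: "nat \<Rightarrow> (nat \<Rightarrow> 'a cubespace) \<Rightarrow> (nat \<Rightarrow> 'a) cubespace" where
  "prod_cs k X = (PiE {1..k} (\<lambda>i. carr (X i)),
     \<lambda>n. {f\<in>cmaps (PiE {1..k} (\<lambda>i. carr (X i))) n.
           \<forall>i\<in>{1..k}. restrict (\<lambda>v. f v i) (vert n) \<in> cubes (X i) n})"

definition free_nilspace :: "nat \<Rightarrow> (nat \<Rightarrow> nat) \<Rightarrow> (nat \<Rightarrow> nat \<Rightarrow> int) cubespace" where
  "free_nilspace k a = prod_cs k (\<lambda>i. Dk i (Zvec (a i)))"

end

theory Submission
  imports Defs
begin

text \<open>Induct on the step. The fibres of a \<open>k\<close>-step nilspace \<open>N\<close> over its quotient \<open>Y\<close> by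
  \<open>\<sim>\<^bsub>k-1\<^esub>\<close> are torsors of a finite abelian group, i.e. of a quotient of some \<open>\<int>\<^sup>m\<close>, and a
  fibrewise shift of a \<open>(k+1)\<close>-cube of \<open>N\<close> is a cube iff the alternating sum of the shifts acts
  trivially. Hence the obstruction to lifting a morphism from a free nilspace \<open>F'\<close> to \<open>Y\<close> through
  \<open>N\<close> is a function on the \<open>(k+1)\<close>-cubes of \<open>F'\<close> that is additive under concatenation. Every
  such cocycle on a free nilspace is a coboundary: along a coordinate of degree \<open>d\<close> its values
  on cubes \<open>c + t v\<^sub>1 \<cdots> v\<^sub>d\<close> form a cocycle of dimension lower by \<open>d\<close>, whose primitive is the discrete
  derivative of the desired one. So \<open>F' \<rightarrow> Y\<close> lifts, and adding the action of
  \<open>\<int>\<^sup>m\<close> in degree \<open>k\<close> gives \<open>F \<rightarrow> N\<close>. The same lemma for cocycles with values in the stabiliser lets one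
  choose the last coordinate of a lift of \<open>\<int>\<^sup>n \<rightarrow> N\<close> polynomial of degree \<open>k\<close>.\<close>

section \<open>Cubes indexed by finite sets of directions\<close>

text \<open>The group acting on the fibres is only a quotient of \<open>\<int>^m\<close>, so the
  correction turning a lifted map into a cube is determined only up to the stabiliser. All
  identities for the obstruction are therefore congruences, and the coboundary statement allows
  values in a subgroup \<open>H1\<close> and identities modulo a subgroup \<open>H0\<close>. One use
  has \<open>H1 = Zvec m\<close> and the stabilising vectors as \<open>H0\<close>; the other has
  these vectors as \<open>H1\<close> and \<open>H0 = {0}\<close>. The second use is possible because
  affine cubes in \<open>\<int>^n\<close> are exactly the cubes of the degree 1 structure, so
  \<open>\<int>^n\<close> is itself free. Freeness matters since cubes may then be altered by one
  integer monomial in one coordinate at a time. Every degree is at least 1, so passing to a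
  coordinate really lowers the dimension. Finiteness of the nilspace bounds the number
  \<open>m\<close> of generators. Vertices are sets of directions: a monomial is then the condition
  \<open>S \<subseteq> V\<close>, a reflection is a symmetric difference, and a face restriction is
  an intersection or a union.\<close>

definition vset :: "bool list \<Rightarrow> nat set" where
  "vset v = {i. i < length v \<and> v ! i}"

definition vlist :: "nat \<Rightarrow> nat set \<Rightarrow> bool list" where
  "vlist n V = map (\<lambda>i. i \<in> V) [0..<n]"

lemma vset_vlist: "vset (vlist n V) = V \<inter> {..<n}"
  by (auto simp: vset_def vlist_def)

lemma vlist_vset: "length v = n \<Longrightarrow> vlist n (vset v) = v"
  by (rule nth_equalityI) (auto simp: vset_def vlist_def)

lemma vset_subset: "v \<in> vert n \<Longrightarrow> vset v \<subseteq> {..<n}"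
  by (auto simp: vset_def vert_def)

lemma vlist_vert [simp]: "vlist n V \<in> vert n"
  by (simp add: vlist_def vert_def)

lemma bij_vset: "bij_betw vset (vert n) (Pow {..<n})"
proof (rule bij_betw_byWitness[where f' = "vlist n"])
  show "vlist n ` Pow {..<n} \<subseteq> vert n" by (simp add: image_subset_iff)
  show "vset ` vert n \<subseteq> Pow {..<n}" using vset_subset by blast
  show "\<forall>v\<in>vert n. vlist n (vset v) = v" by (simp add: vlist_vset vert_def)
  show "\<forall>V\<in>Pow {..<n}. vset (vlist n V) = V" by (auto simp: vset_vlist)
qed

text \<open>Only the values of \<open>c\<close> on subsets of \<open>{..<n}\<close> matter.\<close>
definition cub :: "'a cubespace \<Rightarrow> nat \<Rightarrow> (nat set \<Rightarrow> 'a) \<Rightarrow> bool" where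
  "cub X n c \<longleftrightarrow> restrict (\<lambda>v. c (vset v)) (vert n) \<in> cubes X n"

lemma cub_cong:
  assumes "cub X n c" "\<And>V. V \<subseteq> {..<n} \<Longrightarrow> c V = c' V"
  shows "cub X n c'"
proof -
  have "restrict (\<lambda>v. c (vset v)) (vert n) = restrict (\<lambda>v. c' (vset v)) (vert n)"
    using assms(2) vset_subset by (intro restrict_ext) blast
  then show ?thesis using assms(1) by (simp add: cub_def)
qed

lemma cub_vlist:
  assumes "f \<in> extensional (vert n)"
  shows "cub X n (\<lambda>V. f (vlist n V)) \<longleftrightarrow> f \<in> cubes X n"
proof -
  have "restrict (\<lambda>v. f (vlist n (vset v))) (vert n) = f"
    using assms by (auto simp: fun_eq_iff vlist_vset vert_def extensional_def)
  then show ?thesis by (simp add: cub_def)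
qed

text \<open>An integer affine function that takes only the values 0 and 1 on the cube is constant,
  \<open>v_i\<close> or \<open>1 - v_i\<close>; in the second alternative \<open>b = False\<close>
  encodes \<open>1 - v_i\<close>.\<close>

definition coord :: "nat \<Rightarrow> (nat set \<Rightarrow> bool) \<Rightarrow> bool" where
  "coord n p \<longleftrightarrow> (\<exists>b. \<forall>V\<subseteq>{..<n}. p V = b) \<or> (\<exists>i<n. \<exists>b. \<forall>V\<subseteq>{..<n}. p V = ((i \<in> V) = b))"

definition smor :: "nat \<Rightarrow> nat \<Rightarrow> (nat set \<Rightarrow> nat set) \<Rightarrow> bool" where
  "smor n m M \<longleftrightarrow> (\<forall>V\<subseteq>{..<n}. M V \<subseteq> {..<m}) \<and> (\<forall>j<m. coord n (\<lambda>V. j \<in> M V))"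

lemma coordI_const:
  assumes "\<And>V. V \<subseteq> {..<n} \<Longrightarrow> p V = b"
  shows "coord n p"
proof -
  have "\<forall>V\<subseteq>{..<n}. p V = b" using assms by simp
  then show ?thesis unfolding coord_def by (intro disjI1 exI)
qed

lemma coordI_var:
  assumes "i < n" "\<And>V. V \<subseteq> {..<n} \<Longrightarrow> p V = ((i \<in> V) = b)"
  shows "coord n p"
proof -
  have "i < n \<and> (\<exists>b. \<forall>V\<subseteq>{..<n}. p V = ((i \<in> V) = b))"
    by (intro conjI exI[of _ b] allI impI assms)
  then show ?thesis unfolding coord_def by (intro disjI2 exI)
qed

lemma coordE:
  assumes "coord n p"
  obtains (const) b where "\<And>V. V \<subseteq> {..<n} \<Longrightarrow> p V = b"
    | (var) i b where "i < n" "\<And>V. V \<subseteq> {..<n} \<Longrightarrow> p V = ((i \<in> V) = b)"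
  using assms unfolding coord_def
proof (elim disjE exE conjE)
  fix b assume "\<forall>V\<subseteq>{..<n}. p V = b"
  then show thesis by (intro that(1)[of b]) simp
next
  fix i b assume "i < n" "\<forall>V\<subseteq>{..<n}. p V = ((i \<in> V) = b)"
  then show thesis by (intro that(2)[of i b]) simp_all
qed

lemma coord_const [simp]: "coord n (\<lambda>V. b)"
  by (rule coordI_const) (rule refl)

lemma coord_mem [simp]: "i < n \<Longrightarrow> coord n (\<lambda>V. i \<in> V)"
  by (rule coordI_var[of i _ _ True]) auto

lemma coord_nmem [simp]: "i < n \<Longrightarrow> coord n (\<lambda>V. i \<notin> V)"
  by (rule coordI_var[of i _ _ False]) auto

lemma coord_cong: "coord n p \<Longrightarrow> (\<And>V. V \<subseteq> {..<n} \<Longrightarrow> p V = q V) \<Longrightarrow> coord n q"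
  unfolding coord_def by simp

lemma coord_not:
  assumes "coord n p" shows "coord n (\<lambda>V. \<not> p V)"
  using assms
proof (cases rule: coordE)
  case (const b)
  then show ?thesis by (intro coordI_const[of _ _ "\<not> b"]) simp
next
  case (var i b)
  then show ?thesis by (intro coordI_var[of i _ _ "\<not> b"]) auto
qed

lemma coord_comp:
  assumes "smor n m M" "coord m p"
  shows "coord n (\<lambda>V. p (M V))"
proof -
  have sub: "M V \<subseteq> {..<m}" if "V \<subseteq> {..<n}" for V
    using assms(1) that by (auto simp: smor_def)
  from assms(2) show ?thesis
  proof (cases rule: coordE)
    case (const b)
    then show ?thesis using sub by (intro coordI_const[of _ _ b]) simp
  next
    case (var i b)
    then have "coord n (\<lambda>V. i \<in> M V)" using assms(1) by (simp add: smor_def)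
    then have "coord n (\<lambda>V. (i \<in> M V) = b)"
      by (cases b) (simp_all add: coord_not)
    then show ?thesis by (rule coord_cong) (use var sub in auto)
  qed
qed

lemma smor_comp:
  assumes "smor n m M" "smor m l L"
  shows "smor n l (\<lambda>V. L (M V))"
  unfolding smor_def
proof (intro conjI allI impI)
  fix j assume "j < l"
  then show "coord n (\<lambda>V. j \<in> L (M V))"
    using assms(2) by (intro coord_comp[OF assms(1), of "\<lambda>V. j \<in> L V"]) (simp add: smor_def)
qed (use assms in \<open>auto simp: smor_def\<close>)

lemma smorI:
  assumes "\<And>V. V \<subseteq> {..<n} \<Longrightarrow> M V \<subseteq> {..<m}" "\<And>j. j < m \<Longrightarrow> coord n (\<lambda>V. j \<in> M V)"
  shows "smor n m M"
  using assms by (auto simp: smor_def)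

lemma smor_Collect:
  "(\<And>j. j < m \<Longrightarrow> coord n (P j)) \<Longrightarrow> smor n m (\<lambda>V. {j. j < m \<and> P j V})"
  by (rule smorI) auto

lemma coord_if [simp]: "coord n p \<Longrightarrow> coord n q \<Longrightarrow> coord n (\<lambda>V. if b then p V else q V)"
  by (cases b) simp_all

lemma coord_disj [simp]: "coord n p \<Longrightarrow> coord n (\<lambda>V. p V \<or> b)"
  by (cases b) simp_all

lemma coord_conj [simp]: "coord n p \<Longrightarrow> coord n (\<lambda>V. p V \<and> b)"
  by (cases b) simp_all

lemma smor_Int: "smor n n (\<lambda>V. V \<inter> W)"
  by (rule smorI) auto

text \<open>Two maps at once: for \<open>n \<ge> m\<close> the projection to the first
  \<open>m\<close> coordinates, for \<open>n \<le> m\<close> the embedding as the face where the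
  remaining coordinates are 0.\<close>

lemma smor_proj: "smor n m (\<lambda>V. V \<inter> {..<min n m})"
proof (rule smorI)
  fix j
  show "coord n (\<lambda>V. j \<in> V \<inter> {..<min n m})"
    by (cases "j < n") auto
qed auto

lemma smor_Un: "S \<subseteq> {..<n} \<Longrightarrow> smor n n (\<lambda>V. V \<union> S)"
  by (rule smorI) auto

definition flip :: "'b set \<Rightarrow> 'b set \<Rightarrow> 'b set" where
  "flip W V = (V - W) \<union> (W - V)"

lemma flip_iff: "j \<in> flip W V \<longleftrightarrow> (if j \<in> W then j \<notin> V else j \<in> V)"
  by (auto simp: flip_def)

lemma flip_flip [simp]: "flip W (flip W V) = V"
  by (auto simp: flip_def)

lemma flip_subset: "W \<subseteq> A \<Longrightarrow> V \<subseteq> A \<Longrightarrow> flip W V \<subseteq> A"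
  by (auto simp: flip_def)

lemma smor_flip: "W \<subseteq> {..<n} \<Longrightarrow> smor n n (flip W)"
  by (rule smorI) (auto simp: flip_iff flip_subset)

text \<open>Parametrises a face: \<open>b\<close> names its directions and \<open>R\<close> the
  coordinates frozen at 1.\<close>

lemma smor_image:
  assumes "inj_on b {..<m}" "b ` {..<m} \<subseteq> {..<n}" "R \<subseteq> {..<n}"
  shows "smor m n (\<lambda>W. b ` W \<union> R)"
proof (rule smorI)
  fix V assume "V \<subseteq> {..<m}"
  then show "b ` V \<union> R \<subseteq> {..<n}" using assms by auto
next
  fix j assume "j < n"
  consider "j \<in> R" | "j \<notin> R" "j \<notin> b ` {..<m}" | i where "j \<notin> R" "i < m" "j = b i" by auto
  then show "coord m (\<lambda>V. j \<in> b ` V \<union> R)"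
  proof cases
    case 1
    then show ?thesis by (intro coordI_const[of _ _ True]) auto
  next
    case 2
    then show ?thesis by (intro coordI_const[of _ _ False]) auto
  next
    case 3
    then have "b i \<in> b ` V \<longleftrightarrow> i \<in> V" if "V \<subseteq> {..<m}" for V
      using assms(1) that inj_on_image_mem_iff[of b "{..<m}" i V] by auto
    then show ?thesis using 3 by (intro coordI_var[of i _ _ True]) auto
  qed
qed

lemma smor_imp_cube_morphism:
  assumes "smor n m M"
  shows "cube_morphism n m (\<lambda>v. vlist m (M (vset v)))"
proof -
  have "\<exists>b a. \<forall>v\<in>vert n. of_bool (j \<in> M (vset v)) =
          (b::int) + (\<Sum>i\<in>{i. i < n \<and> v ! i}. a i)" if j: "j < m" for j
  proof -
    from assms j have "coord n (\<lambda>V. j \<in> M V)" by (simp add: smor_def)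
    then show ?thesis
    proof (cases rule: coordE)
      case (const b)
      then have "\<forall>v\<in>vert n. of_bool (j \<in> M (vset v)) = of_bool b + (\<Sum>i\<in>{i. i < n \<and> v ! i}. 0 :: int)"
        using vset_subset by simp
      then show ?thesis by (intro exI)
    next
      case v: (var i b)
      have "of_bool (j \<in> M (vset w)) = of_bool (\<not> b) +
          (\<Sum>i'\<in>{i. i < n \<and> w ! i}. if i' = i then (if b then 1 else -1 :: int) else 0)"
        if w: "w \<in> vert n" for w
      proof -
        have "i \<in> vset w \<longleftrightarrow> w ! i" using w v(1) by (auto simp: vset_def vert_def)
        moreover have "(j \<in> M (vset w)) = ((i \<in> vset w) = b)"
          using v(2) vset_subset[OF w] by blast
        ultimately show ?thesis using v(1) by (subst sum.delta) auto
      qed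
      then show ?thesis by blast
    qed
  qed
  then obtain b a where *: "\<And>j v. j < m \<Longrightarrow> v \<in> vert n \<Longrightarrow> of_bool (j \<in> M (vset v)) =
          (b j::int) + (\<Sum>i\<in>{i. i < n \<and> v ! i}. a j i)" by metis
  show ?thesis unfolding cube_morphism_def
    by (rule exI[of _ b], rule exI[of _ "\<lambda>i j. a j i"]) (auto simp: vlist_def *)
qed

lemma cube_morphism_imp_smor:
  assumes "cube_morphism n m \<psi>"
  shows "smor n m (\<lambda>V. vset (\<psi> (vlist n V)))"
proof -
  from assms obtain b a where ab: "\<And>v. v \<in> vert n \<Longrightarrow> length (\<psi> v) = m"
    "\<And>v j. v \<in> vert n \<Longrightarrow> j < m \<Longrightarrow>
       of_bool (\<psi> v ! j) = b j + (\<Sum>i\<in>{i. i < n \<and> v ! i}. a i j :: int)"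
    unfolding cube_morphism_def by blast
  have val: "of_bool (j \<in> vset (\<psi> (vlist n V))) = b j + (\<Sum>i\<in>V. a i j)"
    if "j < m" "V \<subseteq> {..<n}" for j V
  proof -
    have "{i. i < n \<and> vlist n V ! i} = V" using that(2) by (auto simp: vlist_def)
    then show ?thesis using ab(1)[of "vlist n V"] ab(2)[of "vlist n V" j] that
      by (simp add: vset_def)
  qed
  have "coord n (\<lambda>V. j \<in> vset (\<psi> (vlist n V)))" if j: "j < m" for j
  proof (cases "\<forall>i<n. a i j = 0")
    case True
    have "(j \<in> vset (\<psi> (vlist n V))) \<longleftrightarrow> b j = 1" if "V \<subseteq> {..<n}" for V
    proof -
      have "(\<Sum>i\<in>V. a i j) = 0" using True that by (intro sum.neutral) auto
      then show ?thesis using val[OF j that] by (auto split: if_splits simp: of_bool_def)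
    qed
    then show ?thesis by (intro coordI_const)
  next
    case False
    then obtain i where i: "i < n" "a i j \<noteq> 0" by blast
    have 01: "b j + (\<Sum>i\<in>V. a i j) \<in> {0,1}" if "V \<subseteq> {..<n}" for V
      using val[OF j that] by (auto simp: of_bool_def split: if_splits)
    \<comment> \<open>Nonzero slopes have the sign forced by \<open>b j\<close>, so two of them
      would change the value by 2 between \<open>{}\<close> and \<open>{i,i'}\<close>.\<close>
    have other: "a i' j = 0" if "i' < n" "i' \<noteq> i" for i'
      using 01[of "{}"] 01[of "{i}"] 01[of "{i'}"] 01[of "{i,i'}"] i that by auto
    have "(j \<in> vset (\<psi> (vlist n V))) = ((i \<in> V) = (b j = 0))" if V: "V \<subseteq> {..<n}" for V
    proof -
      have "(\<Sum>i\<in>V. a i j) = (\<Sum>i'\<in>V. if i' = i then a i j else 0)"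
        using other V by (intro sum.cong) auto
      also have "\<dots> = (if i \<in> V then a i j else 0)"
        using finite_subset[OF V] by (simp add: sum.delta)
      finally show ?thesis using val[OF j V] 01[of "{}"] 01[of "{i}"] i
        by (auto simp: of_bool_def split: if_splits)
    qed
    then show ?thesis using i(1) by (intro coordI_var)
  qed
  moreover have "vset (\<psi> (vlist n V)) \<subseteq> {..<m}" for V
    using ab(1)[of "vlist n V"] by (auto simp: vset_def)
  ultimately show ?thesis by (auto simp: smor_def)
qed

lemma cub_smor:
  assumes "is_cubespace X" "smor n m M" "cub X m c"
  shows "cub X n (\<lambda>V. c (M V))"
proof -
  let ?f = "restrict (\<lambda>v. c (vset v)) (vert m)"
  have "restrict (?f \<circ> (\<lambda>v. vlist m (M (vset v)))) (vert n) \<in> cubes X n"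
    using assms smor_imp_cube_morphism[OF assms(2)] unfolding is_cubespace_def cub_def by blast
  moreover have "restrict (?f \<circ> (\<lambda>v. vlist m (M (vset v)))) (vert n)
      = restrict (\<lambda>v. c (M (vset v))) (vert n)"
  proof (rule restrict_ext)
    fix v assume "v \<in> vert n"
    then have "M (vset v) \<subseteq> {..<m}" using assms(2) vset_subset by (auto simp: smor_def)
    then show "(?f \<circ> (\<lambda>v. vlist m (M (vset v)))) v = c (M (vset v))"
      by (simp add: vset_vlist Int_absorb2)
  qed
  ultimately show ?thesis by (simp add: cub_def)
qed

lemma cub_carr:
  assumes "is_cubespace X" "cub X n c" "V \<subseteq> {..<n}"
  shows "c V \<in> carr X"
proof -
  have "restrict (\<lambda>v. c (vset v)) (vert n) \<in> cmaps (carr X) n"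
    using assms(1,2) unfolding is_cubespace_def cub_def by blast
  then have "restrict (\<lambda>v. c (vset v)) (vert n) (vlist n V) \<in> carr X"
    unfolding cmaps_def Pi_def by auto
  then show ?thesis using assms(3) by (simp add: vset_vlist Int_absorb2)
qed

lemma cs_morphism_cub:
  assumes "cs_morphism X Y f" "cub X n c"
  shows "cub Y n (\<lambda>V. f (c V))"
proof -
  have "restrict (f \<circ> restrict (\<lambda>v. c (vset v)) (vert n)) (vert n) \<in> cubes Y n"
    using assms unfolding cs_morphism_def cub_def by blast
  moreover have "restrict (f \<circ> restrict (\<lambda>v. c (vset v)) (vert n)) (vert n)
      = restrict (\<lambda>v. f (c (vset v))) (vert n)" by (auto simp: fun_eq_iff)
  ultimately show ?thesis by (simp add: cub_def)
qed

lemma cs_morphismI: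
  assumes "is_cubespace X" "f ` carr X \<subseteq> carr Y" "\<And>n c. cub X n c \<Longrightarrow> cub Y n (\<lambda>V. f (c V))"
  shows "cs_morphism X Y f"
  unfolding cs_morphism_def
proof (intro conjI allI ballI)
  fix n c assume c: "c \<in> cubes X n"
  then have e: "c \<in> extensional (vert n)" using assms(1) by (auto simp: is_cubespace_def cmaps_def)
  then have "cub X n (\<lambda>V. c (vlist n V))" using c by (simp add: cub_vlist)
  then have "cub Y n (\<lambda>V. f (c (vlist n V)))" by (rule assms(3))
  moreover have "restrict (\<lambda>v. f (c (vlist n (vset v)))) (vert n) = restrict (f \<circ> c) (vert n)"
    by (auto simp: fun_eq_iff vlist_vset vert_def)
  ultimately show "restrict (f \<circ> c) (vert n) \<in> cubes Y n" by (simp add: cub_def)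
qed (rule assms(2))

lemma sim_cub:
  "sim X i x y \<longleftrightarrow> cub X (i + 1) (\<lambda>V. if V = {} then x else y)"
proof -
  have "vset v = {} \<longleftrightarrow> v = zeros (i + 1)" if "v \<in> vert (i + 1)" for v
    using that by (auto simp: vset_def vert_def zeros_def list_eq_iff_nth_eq nth_replicate
        simp del: replicate_Suc)
  then have "restrict (\<lambda>v. if v = zeros (i + 1) then x else y) (vert (i + 1))
     = restrict (\<lambda>v. if vset v = {} then x else y) (vert (i + 1))"
    by (intro restrict_ext) auto
  then show ?thesis by (simp add: sim_def cub_def)
qed

section \<open>Corners and the nilspace axioms in set notation\<close>

definition face_in :: "nat \<Rightarrow> nat set \<Rightarrow> nat set" where
  "face_in i V = {j. (j < i \<and> j \<in> V) \<or> (i < j \<and> j - 1 \<in> V)}"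

definition face_out :: "nat \<Rightarrow> nat set \<Rightarrow> nat set" where
  "face_out i V = {j. if j < i then j \<in> V else Suc j \<in> V}"

lemma ins0_vlist:
  assumes "i < n"
  shows "ins0 i (vlist (n - 1) W) = vlist n (face_in i W)"
proof (rule nth_equalityI)
  fix j assume "j < length (ins0 i (vlist (n - 1) W))"
  then have "j < n" using assms by (auto simp: ins0_def vlist_def)
  then show "ins0 i (vlist (n - 1) W) ! j = vlist n (face_in i W) ! j"
    using assms by (auto simp: ins0_def vlist_def face_in_def nth_append nth_Cons' min_def)
qed (use assms in \<open>auto simp: ins0_def vlist_def\<close>)

lemma smor_face_in: "i < n \<Longrightarrow> smor (n - 1) n (face_in i)"
proof (rule smorI)
  fix j assume "i < n" "j < n"
  then show "coord (n - 1) (\<lambda>V. j \<in> face_in i V)"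
    by (cases i j rule: linorder_cases) (auto simp: face_in_def)
qed (auto simp: face_in_def)

lemma smor_face_out: "i < n \<Longrightarrow> smor n (n - 1) (face_out i)"
proof (rule smorI)
  fix j assume "i < n" "j < n - 1"
  then show "coord n (\<lambda>V. j \<in> face_out i V)"
    by (cases "j < i") (auto simp: face_out_def)
qed (fastforce simp: face_out_def split: if_splits)

lemma face_in_out: "face_in i (face_out i V) = V - {i}"
  by (auto simp: face_in_def face_out_def split: if_splits)

lemma face_in_minus [simp]: "face_in i V - {i} = face_in i V"
  by (auto simp: face_in_def)

text \<open>A face is a cube iff its pullback along the projection forgetting direction
  \<open>i\<close> is one. Corner conditions thus stay in dimension \<open>n\<close>, without
  shifting indices.\<close>

lemma corner_iff:
  assumes "is_cubespace X"
  shows "corner X n g \<longleftrightarrow> (\<forall>i<n. cub X n (\<lambda>V. g (vlist n (V - {i}))))"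
proof -
  have "restrict (g \<circ> ins0 i) (vert (n - 1)) \<in> cubes X (n - 1)
      \<longleftrightarrow> cub X n (\<lambda>V. g (vlist n (V - {i})))" (is "?L \<longleftrightarrow> ?R") if i: "i < n" for i
  proof -
    have "restrict (g \<circ> ins0 i) (vert (n - 1))
        = restrict (\<lambda>v. g (ins0 i (vlist (n - 1) (vset v)))) (vert (n - 1))"
      by (auto simp: fun_eq_iff vert_def vlist_vset)
    then have L: "?L \<longleftrightarrow> cub X (n - 1) (\<lambda>V. g (vlist n (face_in i V)))"
      using ins0_vlist[OF i] by (simp add: cub_def)
    show ?thesis
    proof
      assume ?L
      then have "cub X n (\<lambda>V. g (vlist n (face_in i (face_out i V))))"
        using L cub_smor[OF assms smor_face_out[OF i], of "\<lambda>V. g (vlist n (face_in i V))"] by simp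
      then show ?R by (simp add: face_in_out)
    next
      assume ?R
      then show ?L
        using L cub_smor[OF assms smor_face_in[OF i], of "\<lambda>V. g (vlist n (V - {i}))"] by simp
    qed
  qed
  then show ?thesis by (auto simp: corner_def)
qed

lemma vlist_ones_iff: "V \<subseteq> {..<n} \<Longrightarrow> vlist n V = ones n \<longleftrightarrow> V = {..<n}"
  by (auto simp: vlist_def ones_def list_eq_iff_nth_eq)

lemma cubes_conv_cub:
  assumes "is_cubespace X"
  shows "c \<in> cubes X n \<longleftrightarrow> c \<in> extensional (vert n) \<and> cub X n (\<lambda>V. c (vlist n V))"
  using assms cub_vlist[of c n X] by (auto simp: is_cubespace_def cmaps_def)

lemma nilspace_cub1:
  assumes "is_nilspace X" "\<And>V. V \<subseteq> {..<1} \<Longrightarrow> c V \<in> carr X"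
  shows "cub X 1 c"
proof -
  have "restrict (\<lambda>v. c (vset v)) (vert 1) \<in> cmaps (carr X) 1"
    unfolding cmaps_def using assms(2) vset_subset by auto
  then show ?thesis using assms(1) by (simp add: is_nilspace_def cub_def)
qed

lemma nilspace_corner:
  assumes "is_nilspace X" "n \<ge> 1" "\<And>i. i < n \<Longrightarrow> cub X n (\<lambda>V. g (V - {i}))"
  obtains c where "cub X n c" "\<And>V. V \<subset> {..<n} \<Longrightarrow> c V = g V"
proof -
  have X: "is_cubespace X" using assms(1) by (simp add: is_nilspace_def)
  have "cub X n (\<lambda>V. g (vset (vlist n (V - {i}))))" if "i < n" for i
    using assms(3)[OF that] by (rule cub_cong) (auto simp: vset_vlist intro!: arg_cong[of _ _ g])
  then have "corner X n (\<lambda>v. g (vset v))" using corner_iff[OF X] by simp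
  then obtain c where c: "c \<in> cubes X n" "\<And>v. v \<in> vert n - {ones n} \<Longrightarrow> c v = g (vset v)"
    using assms(1,2) unfolding is_nilspace_def by blast
  show thesis
  proof (rule that)
    show "cub X n (\<lambda>V. c (vlist n V))" using c(1) cubes_conv_cub[OF X] by simp
    fix V assume V: "V \<subset> {..<n}"
    then show "c (vlist n V) = g V"
      using c(2)[of "vlist n V"] vlist_ones_iff[of V n] by (auto simp: vset_vlist Int_absorb2)
  qed
qed

lemma is_nilspaceI:
  assumes X: "is_cubespace X" and "carr X \<noteq> {}"
    and one: "\<And>c. (\<And>V. V \<subseteq> {..<1} \<Longrightarrow> c V \<in> carr X) \<Longrightarrow> cub X 1 c"
    and corner: "\<And>n g. n \<ge> 1 \<Longrightarrow> (\<And>i. i < n \<Longrightarrow> cub X n (\<lambda>V. g (V - {i}))) \<Longrightarrow>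
       \<exists>c. cub X n c \<and> (\<forall>V. V \<subset> {..<n} \<longrightarrow> c V = g V)"
  shows "is_nilspace X"
  unfolding is_nilspace_def
proof (intro conjI allI impI)
  show "cubes X 1 = cmaps (carr X) 1"
  proof
    show "cubes X 1 \<subseteq> cmaps (carr X) 1" using X by (simp add: is_cubespace_def)
    show "cmaps (carr X) 1 \<subseteq> cubes X 1"
    proof
      fix c assume c: "c \<in> cmaps (carr X) 1"
      then have "cub X 1 (\<lambda>V. c (vlist 1 V))" by (intro one) (auto simp: cmaps_def)
      then show "c \<in> cubes X 1" using c cubes_conv_cub[OF X] by (simp add: cmaps_def)
    qed
  qed
next
  fix n :: nat and g assume "1 \<le> n" "corner X n g"
  then obtain c where c: "cub X n c" "\<And>V. V \<subset> {..<n} \<Longrightarrow> c V = g (vlist n V)"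
    using corner[of n "\<lambda>V. g (vlist n V)"] corner_iff[OF X] by auto
  show "\<exists>c\<in>cubes X n. \<forall>v\<in>vert n - {ones n}. c v = g v"
  proof (intro bexI ballI)
    show "restrict (\<lambda>v. c (vset v)) (vert n) \<in> cubes X n" using c(1) by (simp add: cub_def)
    fix v assume v: "v \<in> vert n - {ones n}"
    then have "vlist n (vset v) = v" by (simp add: vlist_vset vert_def)
    moreover from this have "vset v \<noteq> {..<n}" using v vlist_ones_iff[of "vset v" n] vset_subset by auto
    ultimately show "restrict (\<lambda>v. c (vset v)) (vert n) v = g v"
      using v c(2)[of "vset v"] vset_subset[of v n] by auto
  qed
qed (use assms in auto)

lemma kstep_unique:
  assumes "is_kstep_nilspace k X" "cub X (k + 1) c" "cub X (k + 1) c'"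
    "\<And>V. V \<subset> {..<k + 1} \<Longrightarrow> c V = c' V"
  shows "c {..<k + 1} = c' {..<k + 1}"
proof -
  let ?n = "k + 1"
  have X: "is_cubespace X" using assms(1) by (simp add: is_kstep_nilspace_def is_nilspace_def)
  let ?r = "\<lambda>c. restrict (\<lambda>v. c (vset v)) (vert ?n)"
  have "cub X ?n (\<lambda>V. c (vset (vlist ?n (V - {i}))))" for i
    by (rule cub_cong[OF cub_smor[OF X smor_Int[of _ "- {i}"] assms(2)]])
      (auto simp: vset_vlist intro!: arg_cong[of _ _ c])
  then have "corner X ?n (\<lambda>v. c (vset v))" using corner_iff[OF X] by simp
  moreover have "c (vset v) = c' (vset v)" if "v \<in> vert ?n - {ones ?n}" for v
  proof -
    have "vlist ?n (vset v) = v" using that by (simp add: vlist_vset vert_def)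
    then have "vset v \<noteq> {..<?n}" using that vlist_ones_iff[of "vset v" ?n] vset_subset by auto
    then show ?thesis using assms(4)[of "vset v"] vset_subset[of v ?n] that by auto
  qed
  moreover have "?r c \<in> cubes X ?n" "?r c' \<in> cubes X ?n" using assms(2,3) by (auto simp: cub_def)
  ultimately have "?r c = ?r c'"
    using assms(1) unfolding is_kstep_nilspace_def by simp
  then have "?r c (vlist ?n {..<?n}) = ?r c' (vlist ?n {..<?n})" by simp
  then show ?thesis by (simp add: vset_vlist)
qed

lemma is_kstep_nilspaceI:
  assumes "is_nilspace X"
    and uniq: "\<And>c c'. cub X (k + 1) c \<Longrightarrow> cub X (k + 1) c' \<Longrightarrow>
      (\<And>V. V \<subset> {..<k + 1} \<Longrightarrow> c V = c' V) \<Longrightarrow> c {..<k + 1} = c' {..<k + 1}"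
  shows "is_kstep_nilspace k X"
  unfolding is_kstep_nilspace_def
proof (intro conjI allI impI ballI)
  let ?n = "k + 1"
  have X: "is_cubespace X" using assms(1) by (simp add: is_nilspace_def)
  fix g c c' assume c: "c \<in> cubes X ?n" "c' \<in> cubes X ?n"
    and e: "\<forall>v\<in>vert ?n - {ones ?n}. c v = g v \<and> c' v = g v"
  have cv: "cub X ?n (\<lambda>V. c (vlist ?n V))" "cub X ?n (\<lambda>V. c' (vlist ?n V))"
    "c \<in> extensional (vert ?n)" "c' \<in> extensional (vert ?n)"
    using c cubes_conv_cub[OF X] by auto
  have ones: "vlist ?n {..<?n} = ones ?n" by (simp add: vlist_ones_iff)
  have "c (vlist ?n {..<?n}) = c' (vlist ?n {..<?n})"
  proof (rule uniq[OF cv(1,2)])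
    fix V assume "V \<subset> {..<?n}"
    then have "vlist ?n V \<noteq> ones ?n" using vlist_ones_iff[of V ?n] by auto
    then show "c (vlist ?n V) = c' (vlist ?n V)" using e by simp
  qed
  then have "c v = c' v" if "v \<in> vert ?n" for v using e that ones by (cases "v = ones ?n") auto
  then show "c = c'" using cv(3,4) by (auto intro: extensionalityI)
qed (rule assms(1))

section \<open>Filling and concatenation in nilspaces\<close>

locale nilspace =
  fixes N :: "'a cubespace"
  assumes nilspace: "is_nilspace N"
begin

lemma csp: "is_cubespace N"
  using nilspace by (simp add: is_nilspace_def)

lemmas smor = cub_smor[OF csp]

lemma carr_cub: "cub N n c \<Longrightarrow> V \<subseteq> {..<n} \<Longrightarrow> c V \<in> carr N"
  by (rule cub_carr[OF csp])

lemma cub_const: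
  assumes "x \<in> carr N"
  shows "cub N n (\<lambda>V. x)"
proof -
  have "cub N 1 (\<lambda>V. x)" by (rule nilspace_cub1[OF nilspace]) (rule assms)
  moreover have "smor n 1 (\<lambda>V. {})" by (rule smorI) auto
  ultimately show ?thesis using smor by blast
qed

lemma cub_edge:
  assumes "x \<in> carr N" "y \<in> carr N" "i < n"
  shows "cub N n (\<lambda>V. if i \<in> V then y else x)"
proof -
  have "cub N 1 (\<lambda>V. if 0 \<in> V then y else x)" using nilspace_cub1[OF nilspace] assms by simp
  moreover have "smor n 1 (\<lambda>V. {j. j < 1 \<and> i \<in> V})" using assms by (intro smor_Collect) simp
  ultimately have "cub N n (\<lambda>V. if 0 \<in> {j::nat. j < 1 \<and> i \<in> V} then y else x)" by (rule smor[rotated])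
  then show ?thesis by simp
qed

text \<open>A family of compatible cubes on a down-closed set of vertices extends, because
  the missing vertices can be filled by corner completion in increasing order.\<close>
lemma fill_downset:
  assumes "T \<subseteq> Pow {..<n}" "\<And>U V. V \<in> T \<Longrightarrow> U \<subseteq> V \<Longrightarrow> U \<in> T"
    and "\<And>V. V \<in> T \<Longrightarrow> cub N n (\<lambda>U. g (U \<inter> V))"
  shows "\<exists>c. cub N n c \<and> (\<forall>V\<in>T. c V = g V)"
  using assms
proof (induction "card (Pow {..<n} - T)" arbitrary: T g)
  case 0
  then have "Pow {..<n} \<subseteq> T" by auto
  then have "{..<n} \<in> T" by blast
  then have "cub N n (\<lambda>U. g (U \<inter> {..<n}))" by (rule 0(4))
  moreover have "V \<inter> {..<n} = V" if "V \<in> T" for V using that 0(2) by blast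
  ultimately show ?case by (intro exI[of _ "\<lambda>U. g (U \<inter> {..<n})"]) auto
next
  case (Suc r)
  \<comment> \<open>Minimal cardinality puts all proper subsets of \<open>V\<close> into
    \<open>T\<close>, so the face below \<open>V\<close> is a corner with only \<open>V\<close>
    missing.\<close>
  define V where "V = arg_min_on card (Pow {..<n} - T)"
  have ne: "Pow {..<n} - T \<noteq> {}"
  proof
    assume "Pow {..<n} - T = {}"
    with Suc(2) show False by (metis card.empty nat.distinct(1))
  qed
  have V: "V \<subseteq> {..<n}" "V \<notin> T" using arg_min_if_finite(1)[OF _ ne, of card] by (auto simp: V_def)
  have below: "U \<in> T" if "U \<subset> V" for U
  proof (rule ccontr)
    assume "U \<notin> T"
    then have "U \<in> Pow {..<n} - T" using that V by auto
    moreover have "card U < card V" using that V finite_subset psubset_card_mono by blast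
    ultimately show False using arg_min_if_finite(2)[OF _ ne, of card] by (auto simp: V_def)
  qed
  have fV: "finite V" using V(1) finite_subset by blast
  obtain b where b: "bij_betw b {..<card V} V"
    using ex_bij_betw_nat_finite[OF fV] by (auto simp: atLeast0LessThan)
  define m where "m = card V"
  have bV: "b i \<in> V" "b i < n" if "i < m" for i
    using b that V(1) by (auto simp: bij_betw_def m_def)
  have "\<exists>y. cub N n (\<lambda>U. (g(V := y)) (U \<inter> V))"
  proof (cases "m = 0")
    case True
    then have "V = {}" using fV m_def by simp
    obtain x where "x \<in> carr N" using nilspace unfolding is_nilspace_def by auto
    then show ?thesis using cub_const[of x n] \<open>V = {}\<close> by (intro exI[of _ x]) simp
  next
    case False
    have "cub N m (\<lambda>W. g (b ` (W - {i})))" if i: "i < m" for i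
    proof -
      have "V - {b i} \<in> T" using bV[OF i] by (intro below) auto
      then have "cub N n (\<lambda>U. g (U \<inter> (V - {b i})))" by (rule Suc)
      moreover have "smor m n (\<lambda>W. b ` W \<union> {})"
        using b V(1) by (intro smor_image) (auto simp: bij_betw_def m_def)
      ultimately have "cub N m (\<lambda>W. g ((b ` W \<union> {}) \<inter> (V - {b i})))" using smor by blast
      then show ?thesis
      proof (rule cub_cong)
        fix W assume W: "W \<subseteq> {..<m}"
        have "b ` (W - {i}) = b ` W - {b i}"
          using b W i inj_on_image_set_diff[of b "{..<m}" W "{i}"] by (auto simp: bij_betw_def m_def)
        moreover have "b ` W \<subseteq> V" using W bV by auto
        ultimately have "(b ` W \<union> {}) \<inter> (V - {b i}) = b ` (W - {i})" by auto
        then show "g ((b ` W \<union> {}) \<inter> (V - {b i})) = g (b ` (W - {i}))" by simp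
      qed
    qed
    then obtain c where c: "cub N m c" "\<And>W. W \<subset> {..<m} \<Longrightarrow> c W = g (b ` W)"
      using nilspace_corner[OF nilspace, of m "\<lambda>W. g (b ` W)"] False by auto
    have "smor n m (\<lambda>U. {j. j < m \<and> b j \<in> U})" using bV by (intro smor_Collect) simp
    \<comment> \<open>The filled face is pulled back along the projection to the directions of
      \<open>V\<close>, as the induction works with \<open>n\<close>-cubes throughout.\<close>
    then have "cub N n (\<lambda>U. c {j. j < m \<and> b j \<in> U})" using c(1) smor by blast
    then have "cub N n (\<lambda>U. (g(V := c {..<m})) (U \<inter> V))"
    proof (rule cub_cong)
      fix U assume "U \<subseteq> {..<n}"
      have im: "b ` {j. j < m \<and> b j \<in> U} = U \<inter> V"
        using b by (auto simp: bij_betw_def m_def image_iff)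
      show "c {j. j < m \<and> b j \<in> U} = (g(V := c {..<m})) (U \<inter> V)"
      proof (cases "V \<subseteq> U")
        case True
        then have "{j. j < m \<and> b j \<in> U} = {..<m}" "U \<inter> V = V" using bV by auto
        then show ?thesis by simp
      next
        case False
        then have ne: "U \<inter> V \<noteq> V" by auto
        have "{j. j < m \<and> b j \<in> U} \<noteq> {..<m}"
        proof
          assume "{j. j < m \<and> b j \<in> U} = {..<m}"
          then have "b ` {..<m} = U \<inter> V" using im by simp
          then show False using ne b by (simp add: bij_betw_def m_def)
        qed
        then have "c {j. j < m \<and> b j \<in> U} = g (U \<inter> V)" using c(2)[of "{j. j < m \<and> b j \<in> U}"] im by auto
        then show ?thesis using ne by simp
      qed
    qed
    then show ?thesis by blast
  qed
  then obtain y where y: "cub N n (\<lambda>U. (g(V := y)) (U \<inter> V))" by blast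
  have "Pow {..<n} - T = insert V (Pow {..<n} - insert V T)" using V by auto
  then have "card (Pow {..<n} - T) = Suc (card (Pow {..<n} - insert V T))"
    by (metis Diff_iff card_insert_disjoint finite_Diff finite_Pow_iff finite_lessThan insertI1)
  then have r: "r = card (Pow {..<n} - insert V T)" using Suc(2) by simp
  have "\<exists>c. cub N n c \<and> (\<forall>W\<in>insert V T. c W = (g(V := y)) W)"
  proof (rule Suc(1)[OF r])
    show "insert V T \<subseteq> Pow {..<n}" using V Suc(3) by auto
    show "U \<in> insert V T" if "W \<in> insert V T" "U \<subseteq> W" for U W
      using that below Suc(4) by (cases "W = V") auto
    show "cub N n (\<lambda>U. (g(V := y)) (U \<inter> W))" if W: "W \<in> insert V T" for W
    proof (cases "W = V")
      case True
      then show ?thesis using y by simp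
    next
      case False
      then have W': "W \<in> T" using W by simp
      then have "U \<inter> W \<noteq> V" for U using Suc(4)[OF W', of "U \<inter> W"] V(2) by auto
      then show ?thesis using Suc(5)[OF W'] by simp
    qed
  qed
  then obtain c where c: "cub N n c" "\<forall>W\<in>insert V T. c W = (g(V := y)) W" by blast
  show ?case
  proof (intro exI conjI ballI)
    fix W assume "W \<in> T"
    then show "c W = g W" using c(2) V(2) by auto
  qed (rule c(1))
qed

text \<open>Two cubes sharing a face are arranged in an L shape inside an \<open>(n+1)\<close>-cube;
  the concatenation is the diagonal of the filled cube.\<close>
lemma cub_concat:
  assumes c: "cub N n c" and c': "cub N n c'" and i: "i < n"
    and glue: "\<And>V. V \<subseteq> {..<n} \<Longrightarrow> c (insert i V) = c' (V - {i})"
  shows "cub N n (\<lambda>V. if i \<in> V then c' V else c V)"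
proof -
  \<comment> \<open>The shared face sits where both coordinates \<open>i\<close> and
    \<open>n\<close> are 0; \<open>c\<close> leaves it backwards along \<open>i\<close>, hence the
    reflection, and \<open>c'\<close> leaves it along \<open>n\<close>.\<close>
  define g where "g V = (if n \<in> V then c' (insert i (V - {n})) else c (flip {i} V))" for V
  define T where "T = {V. V \<subseteq> {..<n + 1} \<and> \<not> (i \<in> V \<and> n \<in> V)}"
  have "\<exists>e. cub N (n + 1) e \<and> (\<forall>V\<in>T. e V = g V)"
  proof (rule fill_downset)
    show "T \<subseteq> Pow {..<n + 1}" by (auto simp: T_def)
    show "U \<in> T" if "V \<in> T" "U \<subseteq> V" for U V using that by (auto simp: T_def)
    show "cub N (n + 1) (\<lambda>U. g (U \<inter> V))" if V: "V \<in> T" for V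
    proof (cases "n \<in> V")
      case False
      have "smor (n + 1) n (\<lambda>U. {j. j < n \<and> (if j = i then \<not> (j \<in> U \<and> j \<in> V) else j \<in> U \<and> j \<in> V)})"
      proof (rule smor_Collect)
        fix j assume "j < n"
        then show "coord (n + 1) (\<lambda>U. if j = i then \<not> (j \<in> U \<and> j \<in> V) else j \<in> U \<and> j \<in> V)"
          by (cases "j = i"; cases "j \<in> V") auto
      qed
      from smor[OF this c] show ?thesis
        by (rule cub_cong)
          (use V False i in \<open>auto simp: g_def flip_def T_def less_Suc_eq intro!: arg_cong[of _ _ c]\<close>)
    next
      case True
      then have iV: "i \<notin> V" using V by (auto simp: T_def)
      have "smor (n + 1) n (\<lambda>U. {j. j < n \<and> (if j = i then n \<in> U else j \<in> U \<and> j \<in> V)})"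
      proof (rule smor_Collect)
        fix j assume "j < n"
        then show "coord (n + 1) (\<lambda>U. if j = i then n \<in> U else j \<in> U \<and> j \<in> V)"
          by (cases "j = i"; cases "j \<in> V") auto
      qed
      from smor[OF this c'] show ?thesis
      proof (rule cub_cong)
        fix U assume U: "U \<subseteq> {..<n + 1}"
        show "c' {j. j < n \<and> (if j = i then n \<in> U else j \<in> U \<and> j \<in> V)} = g (U \<inter> V)"
        proof (cases "n \<in> U")
          case True
          then have "{j. j < n \<and> (if j = i then n \<in> U else j \<in> U \<and> j \<in> V)} = insert i (U \<inter> V - {n})"
            using V iV i by (auto simp: T_def less_Suc_eq)
          then show ?thesis using True \<open>n \<in> V\<close> by (simp add: g_def)
        next
          case False
          let ?W = "{j. j < n \<and> (if j = i then n \<in> U else j \<in> U \<and> j \<in> V)}"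
          have W: "?W - {i} = ?W" using False by auto
          have "flip {i} (U \<inter> V) = insert i ?W"
            using V iV i False by (auto simp: T_def flip_def less_Suc_eq)
          moreover have "c (insert i ?W) = c' (?W - {i})" by (rule glue) auto
          ultimately show ?thesis using W False by (simp add: g_def)
        qed
      qed
    qed
  qed
  then obtain e where e: "cub N (n + 1) e" "\<And>V. V \<in> T \<Longrightarrow> e V = g V" by blast
  \<comment> \<open>Exactly one of the coordinates \<open>i\<close> and \<open>n\<close> is 1 here,
    so the image stays in \<open>T\<close>, where \<open>e\<close> is known.\<close>
  have "smor n (n + 1) (\<lambda>V. {j. j < n + 1 \<and> (if j = i then i \<notin> V else if j = n then i \<in> V else j \<in> V)})"
  proof (rule smor_Collect)
    fix j assume "j < n + 1"
    then show "coord n (\<lambda>V. if j = i then i \<notin> V else if j = n then i \<in> V else j \<in> V)"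
      using i by (cases "j = i"; cases "j = n") auto
  qed
  from smor[OF this e(1)] show ?thesis
  proof (rule cub_cong)
    fix V assume V: "V \<subseteq> {..<n}"
    let ?W = "{j. j < n + 1 \<and> (if j = i then i \<notin> V else if j = n then i \<in> V else j \<in> V)}"
    have ni: "n \<noteq> i" using i by simp
    have "e ?W = g ?W" by (rule e(2)) (use V i in \<open>auto simp: T_def split: if_splits\<close>)
    also have "\<dots> = (if i \<in> V then c' V else c V)"
    proof (cases "i \<in> V")
      case True
      then have "insert i (?W - {n}) = V" "n \<in> ?W" using V ni by (auto split: if_splits)
      then show ?thesis using True ni by (simp add: g_def)
    next
      case False
      then have "flip {i} ?W = V" "n \<notin> ?W" using V i ni by (auto simp: flip_def split: if_splits)
      then show ?thesis using False by (simp add: g_def)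
    qed
    finally show "e ?W = (if i \<in> V then c' V else c V)" .
  qed
qed

text \<open>Iterated concatenation: the case distinction is introduced one direction of \<open>S\<close> at a time.\<close>
lemma cub_telescope:
  assumes c: "cub N n c" and S: "S \<subseteq> {..<n}"
    and top: "cub N n (\<lambda>V. if S \<subseteq> V then c' V else c (V \<union> S))"
  shows "cub N n (\<lambda>V. if S \<subseteq> V then c' V else c V)"
proof -
  \<comment> \<open>\<open>R\<close> collects the directions of \<open>S\<close> in which
    \<open>c\<close> is no longer frozen at 1; \<open>R = {}\<close> is the hypothesis and
    \<open>R = S\<close> the goal.\<close>
  have "cub N n (\<lambda>V. if S \<subseteq> V then c' V else c (V \<union> (S - R)))" if "finite R" "R \<subseteq> S" for R
    using that
  proof (induction R)
    case empty
    then show ?case using top by (simp only: Diff_empty)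
  next
    case (insert s R)
    let ?Q = "S - insert s R"
    let ?e = "\<lambda>V. if S \<subseteq> V then c' V else c (V \<union> (S - R))"
    have Q: "S - R = insert s ?Q" using insert by auto
    have s: "s \<in> S" "s < n" using insert S by auto
    have "cub N n (\<lambda>V. if s \<in> V then ?e V else c (V \<union> ?Q))"
    proof (rule cub_concat)
      show "cub N n (\<lambda>V. c (V \<union> ?Q))" by (rule smor[OF smor_Un c]) (use S in auto)
      show "cub N n ?e" using insert by simp
      show "c (insert s V \<union> ?Q) = ?e (V - {s})" for V
      proof -
        have "insert s V \<union> ?Q = (V - {s}) \<union> (S - R)" using Q by auto
        then show ?thesis using s by auto
      qed
    qed (rule s)
    then show ?case
    proof (rule cub_cong)
      fix V
      have "V \<union> (S - R) = V \<union> ?Q" if "s \<in> V" using that Q by auto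
      then show "(if s \<in> V then ?e V else c (V \<union> ?Q)) = (if S \<subseteq> V then c' V else c (V \<union> ?Q))"
        using s by auto
    qed
  qed
  from this[OF finite_subset[OF S finite_lessThan] order_refl] show ?thesis
    by (simp only: Diff_cancel Un_empty_right)
qed

end

section \<open>Alternating sums over the cube\<close>

text \<open>A case distinction instead of a power of -1, because the values lie in a bare abelian
  group.\<close>

definition sg :: "nat set \<Rightarrow> 'b::ab_group_add \<Rightarrow> 'b" where
  "sg V x = (if even (card V) then x else - x)"

definition alt :: "nat \<Rightarrow> (nat set \<Rightarrow> 'b::ab_group_add) \<Rightarrow> 'b" where
  "alt K f = (\<Sum>V\<in>Pow {..<K}. sg V (f V))"

lemma sg_add: "sg V (x + y) = sg V x + sg V y"
  and sg_diff: "sg V (x - y) = sg V x - sg V y"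
  and sg_minus: "sg V (- x) = - sg V x"
  and sg_zero [simp]: "sg V 0 = 0"
  and sg_sg [simp]: "sg V (sg V x) = x"
  by (auto simp: sg_def)

lemma alt_cong: "(\<And>V. V \<subseteq> {..<K} \<Longrightarrow> f V = g V) \<Longrightarrow> alt K f = alt K g"
  unfolding alt_def by (intro sum.cong) auto

lemma alt_add: "alt K (\<lambda>V. f V + g V) = alt K f + alt K g"
  by (simp add: alt_def sg_add sum.distrib)

lemma alt_diff: "alt K (\<lambda>V. f V - g V) = alt K f - alt K g"
  by (simp add: alt_def sg_diff sum_subtractf)

lemma alt_minus: "alt K (\<lambda>V. - f V) = - alt K f"
  by (simp add: alt_def sg_minus sum_negf)

lemma alt_zero [simp]: "alt K (\<lambda>V. 0) = 0"
  by (simp add: alt_def)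

lemma alt_single:
  assumes "U \<subseteq> {..<K}"
  shows "alt K (\<lambda>V. if V = U then s else 0) = sg U s"
proof -
  have "alt K (\<lambda>V. if V = U then s else 0) = (\<Sum>V\<in>Pow {..<K}. if V = U then sg U s else 0)"
    unfolding alt_def by (intro sum.cong) auto
  then show ?thesis using assms by (simp add: sum.delta)
qed

text \<open>Vertices are paired along direction \<open>i\<close>, where the sign changes. The rules
  for degenerate, glued and reflected cubes all follow from this pairing.\<close>

lemma alt_split:
  assumes "i < K"
  shows "alt K f = (\<Sum>V\<in>Pow ({..<K} - {i}). sg V (f V - f (insert i V)))"
proof -
  let ?A = "{..<K} - {i}"
  have K: "Pow {..<K} = Pow ?A \<union> insert i ` Pow ?A"
    using assms by (subst Pow_insert[symmetric]) (simp add: insert_absorb)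
  have "alt K f = (\<Sum>V\<in>Pow ?A. sg V (f V)) + (\<Sum>V\<in>insert i ` Pow ?A. sg V (f V))"
    unfolding alt_def K by (rule sum.union_disjoint) auto
  also have "(\<Sum>V\<in>insert i ` Pow ?A. sg V (f V)) = (\<Sum>V\<in>Pow ?A. sg (insert i V) (f (insert i V)))"
    by (subst sum.reindex) (auto simp: inj_on_def)
  also have "\<dots> = (\<Sum>V\<in>Pow ?A. - sg V (f (insert i V)))"
  proof (rule sum.cong)
    fix V assume "V \<in> Pow ?A"
    then have "finite V" "i \<notin> V" using finite_subset[of V "{..<K}"] by auto
    then show "sg (insert i V) (f (insert i V)) = - sg V (f (insert i V))" by (simp add: sg_def)
  qed simp
  finally show ?thesis by (simp add: sg_diff sum_subtractf sum_negf)
qed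

lemma alt_indep:
  assumes "i < K" "\<And>V. V \<subseteq> {..<K} - {i} \<Longrightarrow> f (insert i V) = f V"
  shows "alt K f = 0"
  unfolding alt_split[OF assms(1)] using assms(2) by (intro sum.neutral) auto

lemma alt_concat:
  assumes "i < K" "\<And>V. V \<subseteq> {..<K} - {i} \<Longrightarrow> f (insert i V) = g V"
  shows "alt K (\<lambda>V. if i \<in> V then g V else f V) = alt K f + alt K g"
  unfolding alt_split[OF assms(1)] sum.distrib[symmetric] using assms(2)
  by (intro sum.cong) (auto simp: sg_add[symmetric])

lemma alt_flip:
  assumes "i < K"
  shows "alt K (\<lambda>V. f (flip {i} V)) = - alt K f"
  unfolding alt_split[OF assms] sum_negf[symmetric]
proof (rule sum.cong)
  fix V assume "V \<in> Pow ({..<K} - {i})"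
  then have "flip {i} V = insert i V" "flip {i} (insert i V) = V" by (auto simp: flip_def)
  then show "sg V (f (flip {i} V) - f (flip {i} (insert i V))) = - sg V (f V - f (insert i V))"
    by (simp add: sg_minus[symmetric])
qed simp

lemma alt_bij:
  assumes "bij_betw \<sigma> {..<K} {..<K}"
  shows "alt K (\<lambda>V. f (\<sigma> ` V)) = alt K f"
proof -
  have "card (\<sigma> ` V) = card V" if "V \<subseteq> {..<K}" for V
    using assms that by (intro card_image) (auto simp: bij_betw_def intro: inj_on_subset)
  then have "alt K (\<lambda>V. f (\<sigma> ` V)) = (\<Sum>V\<in>Pow {..<K}. sg (\<sigma> ` V) (f (\<sigma> ` V)))"
    unfolding alt_def by (intro sum.cong) (auto simp: sg_def)
  also have "\<dots> = alt K f"
    unfolding alt_def by (rule sum.reindex_bij_betw[OF bij_betw_Pow[OF assms]])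
  finally show ?thesis .
qed

section \<open>The top structure group of a nilspace\<close>

lemma flip_eq_top:
  "V \<subseteq> A \<Longrightarrow> V0 \<subseteq> A \<Longrightarrow> flip (A - V0) V = A \<longleftrightarrow> V = V0"
  by (auto simp: flip_def)

lemma flip_top: "V0 \<subseteq> A \<Longrightarrow> flip (A - V0) A = V0"
  by (auto simp: flip_def)

locale kstep = nilspace N for N :: "'a cubespace" +
  fixes k :: nat
  assumes kstep: "is_kstep_nilspace k N" and k1: "1 \<le> k"
begin

text \<open>A reflection carries \<open>V0\<close> to the top vertex, so the uniqueness of corner
  completion holds at every vertex.\<close>

lemma uniq:
  assumes "cub N (Suc k) c" "cub N (Suc k) c'" "V0 \<subseteq> {..<Suc k}"
    "\<And>V. V \<subseteq> {..<Suc k} \<Longrightarrow> V \<noteq> V0 \<Longrightarrow> c V = c' V"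
  shows "c V0 = c' V0"
proof -
  let ?W = "{..<Suc k} - V0"
  have W: "smor (Suc k) (Suc k) (flip ?W)" by (rule smor_flip) auto
  have "c (flip ?W {..<k + 1}) = c' (flip ?W {..<k + 1})"
  proof (rule kstep_unique[OF kstep])
    show "cub N (k + 1) (\<lambda>V. c (flip ?W V))" "cub N (k + 1) (\<lambda>V. c' (flip ?W V))"
      using smor[OF W] assms(1,2) by simp_all
    fix V assume V: "V \<subset> {..<k + 1}"
    have "flip ?W V0 = {..<Suc k}" using flip_flip[of ?W "{..<Suc k}"] flip_top[OF assms(3)] by simp
    moreover have "flip ?W V0 = V" if "flip ?W V = V0" using flip_flip[of ?W V] that by simp
    ultimately have "flip ?W V \<noteq> V0" using V by auto
    then show "c (flip ?W V) = c' (flip ?W V)"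
      using V by (intro assms(4) flip_subset) auto
  qed
  then show ?thesis using flip_top[OF assms(3)] by simp
qed

text \<open>The relation \<open>\<sim>\<^bsub>k-1\<^esub>\<close>, with the exceptional vertex moved from the bottom to the top.\<close>
definition rel :: "'a \<Rightarrow> 'a \<Rightarrow> bool" where
  "rel x y \<longleftrightarrow> cub N k (\<lambda>V. if {..<k} \<subseteq> V then y else x)"

lemma rel_carr: "rel x y \<Longrightarrow> x \<in> carr N \<and> y \<in> carr N"
  using carr_cub[of k "\<lambda>V. if {..<k} \<subseteq> V then y else x" "{..<k}"]
    carr_cub[of k "\<lambda>V. if {..<k} \<subseteq> V then y else x" "{}"] k1
  by (auto simp: rel_def lessThan_empty_iff)

lemma rel_refl: "x \<in> carr N \<Longrightarrow> rel x x"
  using cub_const[of x k] by (simp add: rel_def)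

text \<open>Telescoping over all \<open>k\<close> directions reduces a change of the top vertex to
  the cube constant off its top, which is \<open>rel\<close>; a reflection treats other
  vertices.\<close>

lemma change_vertex:
  assumes "cub N k c" "V0 \<subseteq> {..<k}" "rel (c V0) y"
  shows "cub N k (c(V0 := y))"
proof -
  let ?W = "{..<k} - V0"
  have W: "smor k k (flip ?W)" by (rule smor_flip) auto
  have "cub N k (\<lambda>V. if {..<k} \<subseteq> V then y else c (flip ?W V))"
  proof (rule cub_telescope)
    show "cub N k (\<lambda>V. c (flip ?W V))" by (rule smor[OF W assms(1)])
    show "cub N k (\<lambda>V. if {..<k} \<subseteq> V then y else c (flip ?W (V \<union> {..<k})))"
      using assms(3) unfolding rel_def
      by (rule cub_cong) (auto simp: Un_absorb1 flip_top[OF assms(2)])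
  qed simp
  from smor[OF W this] show ?thesis
  proof (rule cub_cong)
    fix V assume V: "V \<subseteq> {..<k}"
    then have "flip ?W V \<subseteq> {..<k}" by (intro flip_subset) auto
    then have "{..<k} \<subseteq> flip ?W V \<longleftrightarrow> V = V0" using flip_eq_top[OF V assms(2)] by blast
    then show "(if {..<k} \<subseteq> flip ?W V then y else c (flip ?W (flip ?W V))) = (c(V0 := y)) V" by simp
  qed
qed

text \<open>Vertices are replaced one by one. A cube of dimension below \<open>k\<close> is first
  padded with dummy directions and finally restricted again. So up to dimension \<open>k\<close>,
  being a cube depends only on the classes of the vertices.\<close>

lemma rel_cubes:
  assumes "cub N n c" "n \<le> k" "\<And>V. V \<subseteq> {..<n} \<Longrightarrow> rel (c V) (c' V)"
  shows "cub N n c'"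
proof -
  have min: "min k n = n" "min n k = n" using assms(2) by auto
  let ?c = "\<lambda>V. c (V \<inter> {..<n})" and ?c' = "\<lambda>V. c' (V \<inter> {..<n})"
  have "cub N k (\<lambda>V. if V \<in> \<V> then ?c' V else ?c V)" if "finite \<V>" "\<V> \<subseteq> Pow {..<k}" for \<V>
    using that
  proof (induction \<V>)
    case empty
    then show ?case using smor[OF smor_proj assms(1), of k] min by simp
  next
    case (insert U \<V>)
    let ?d = "\<lambda>V. if V \<in> \<V> then ?c' V else ?c V"
    have "cub N k (?d(U := ?c' U))"
      using insert assms(3)[of "U \<inter> {..<n}"] by (intro change_vertex) auto
    then show ?case by (rule cub_cong) auto
  qed
  from this[of "Pow {..<k}"] have "cub N k (\<lambda>V. if V \<in> Pow {..<k} then ?c' V else ?c V)" by simp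
  from smor[OF smor_proj this, of n] show ?thesis
    by (rule cub_cong) (use assms(2) min in \<open>auto intro!: arg_cong[of _ _ c']\<close>)
qed

lemma rel_sym:
  assumes "rel x y"
  shows "rel y x"
proof -
  \<comment> \<open>Start from the constant cube \<open>x\<close> and move every vertex except the
    top to \<open>y\<close>.\<close>
  have "cub N k (\<lambda>V. if {..<k} \<subseteq> V then x else y)"
    by (rule rel_cubes[OF cub_const[of x] order_refl])
      (use assms rel_carr rel_refl in auto)
  then show ?thesis by (simp add: rel_def)
qed

lemma rel_trans:
  assumes "rel x y" "rel y z"
  shows "rel x z"
proof -
  have "cub N k ((\<lambda>V. if {..<k} \<subseteq> V then y else x)({..<k} := z))"
    using assms by (intro change_vertex) (auto simp: rel_def)
  then show ?thesis unfolding rel_def by (rule cub_cong) auto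
qed

text \<open>Gluing on a reflected copy of \<open>c\<close> along the face where direction
  \<open>s\<close> is 0 replaces the values there by those at 1. After all directions have been
  treated, \<open>c {..<k}\<close> stands everywhere except at the top, which carries
  \<open>c' {..<k}\<close>.\<close>

lemma rel_top:
  assumes c: "cub N k c" and c': "cub N k c'" and eq: "\<And>V. V \<subset> {..<k} \<Longrightarrow> c V = c' V"
  shows "rel (c {..<k}) (c' {..<k})"
proof -
  let ?e = "\<lambda>R V. if {..<k} \<subseteq> V then c' {..<k} else c (V \<union> R)"
  have "cub N k (?e R)" if "finite R" "R \<subseteq> {..<k}" for R
    using that
  proof (induction R)
    case empty
    from c' show ?case by (rule cub_cong) (use eq in auto)
  next
    case (insert s R)
    have s: "s < k" and R: "R \<subseteq> {..<k}" using insert by auto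
    have "cub N k (\<lambda>V. if s \<in> V then ?e R V else c (flip {s} V \<union> R))"
    proof (rule cub_concat)
      show "cub N k (\<lambda>V. c (flip {s} V \<union> R))"
        using smor[OF smor_flip smor[OF smor_Un[OF R] c], of "{s}"] s by simp
      show "cub N k (?e R)" using insert by simp
      fix V
      have "flip {s} (insert s V) = V - {s}" by (auto simp: flip_def)
      moreover have "\<not> {..<k} \<subseteq> V - {s}" using s by auto
      ultimately show "c (flip {s} (insert s V) \<union> R) = ?e R (V - {s})" by simp
    qed (rule s)
    then show ?case
    proof (rule cub_cong)
      fix V
      have "flip {s} V \<union> R = V \<union> insert s R" if "s \<notin> V" using that by (auto simp: flip_def)
      moreover have "V \<union> R = V \<union> insert s R" if "s \<in> V" using that by auto
      ultimately show "(if s \<in> V then ?e R V else c (flip {s} V \<union> R)) = ?e (insert s R) V"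
        using s by auto
    qed
  qed
  from this[of "{..<k}"] show ?thesis
    unfolding rel_def by (rule cub_cong[rotated 2]) (auto simp: Un_absorb1)
qed

text \<open>A prism in direction \<open>k\<close>: its edge over the top of the other directions
  runs from \<open>y\<close> to \<open>y'\<close>, all others from \<open>x\<close> to
  \<open>x'\<close>. It says that \<open>y'\<close> arises from \<open>x'\<close> by the same
  structure-group element as \<open>y\<close> from \<open>x\<close>.\<close>

definition pcub :: "'a \<Rightarrow> 'a \<Rightarrow> 'a \<Rightarrow> 'a \<Rightarrow> bool" where
  "pcub x y x' y' \<longleftrightarrow> cub N (Suc k) (\<lambda>V. if {..<k} \<subseteq> V then (if k \<in> V then y' else y)
     else (if k \<in> V then x' else x))"

text \<open>The translations of height \<open>k\<close>, an isomorphic copy of the top structure group.\<close>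
definition Tr :: "('a \<Rightarrow> 'a) set" where
  "Tr = {\<alpha>. (\<forall>x\<in>carr N. \<forall>x'\<in>carr N. pcub x (\<alpha> x) x' (\<alpha> x')) \<and> (\<forall>x. x \<notin> carr N \<longrightarrow> \<alpha> x = x)}"

lemma pcub_triv: "x \<in> carr N \<Longrightarrow> x' \<in> carr N \<Longrightarrow> pcub x x x' x'"
  using cub_edge[of x x' k "Suc k"] by (simp add: pcub_def)

lemma pcub_unique:
  assumes "pcub x y x' y'" "pcub x y x' y''"
  shows "y' = y''"
proof -
  let ?q = "\<lambda>y' V. if {..<k} \<subseteq> V then (if k \<in> V then y' else y) else (if k \<in> V then x' else x)"
  have "?q y' {..<Suc k} = ?q y'' {..<Suc k}"
  proof (rule uniq[OF assms[unfolded pcub_def]])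
    fix V assume "V \<subseteq> {..<Suc k}" "V \<noteq> {..<Suc k}"
    then have "\<not> ({..<k} \<subseteq> V \<and> k \<in> V)" by (auto simp: lessThan_Suc)
    then show "?q y' V = ?q y'' V" by auto
  qed simp
  then show ?thesis by (simp add: lessThan_Suc subset_insertI)
qed

lemma pcub_self:
  assumes "rel x y" shows "pcub x y x y"
proof -
  have "cub N (Suc k) (\<lambda>V. if {..<k} \<subseteq> V \<inter> {..<min (Suc k) k} then y else x)"
    by (rule smor[OF smor_proj assms[unfolded rel_def]])
  then show ?thesis unfolding pcub_def by (rule cub_cong) auto
qed

text \<open>The first prism is reflected in direction \<open>k\<close> and glued to the second along
  their common end, the pair of \<open>x\<close> and \<open>y\<close>.\<close>

lemma pcub_trans:
  assumes "pcub x y x' y'" "pcub x y x'' y''"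
  shows "pcub x' y' x'' y''"
proof -
  let ?q = "\<lambda>x y x' y' V. if {..<k} \<subseteq> V then (if k \<in> V then y' else y) else (if k \<in> V then x' else x)"
  have W: "smor (Suc k) (Suc k) (flip {k})" by (rule smor_flip) auto
  have top: "{..<k} \<subseteq> flip {k} V \<longleftrightarrow> {..<k} \<subseteq> V" "{..<k} \<subseteq> insert k V \<longleftrightarrow> {..<k} \<subseteq> V"
    "{..<k} \<subseteq> V - {k} \<longleftrightarrow> {..<k} \<subseteq> V" "k \<in> flip {k} V \<longleftrightarrow> k \<notin> V" for V
    by (auto simp: flip_def)
  have "cub N (Suc k) (\<lambda>V. if k \<in> V then ?q x y x'' y'' V else ?q x y x' y' (flip {k} V))"
  proof (rule cub_concat)
    show "cub N (Suc k) (\<lambda>V. ?q x y x' y' (flip {k} V))"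
      by (rule smor[OF W assms(1)[unfolded pcub_def]])
    show "cub N (Suc k) (?q x y x'' y'')" using assms(2) by (simp add: pcub_def)
    show "?q x y x' y' (flip {k} (insert k V)) = ?q x y x'' y'' (V - {k})" for V
      unfolding top by simp
  qed simp
  then show ?thesis unfolding pcub_def
    by (rule cub_cong) (simp add: top)
qed

text \<open>Corner completion at the vertex of \<open>y'\<close>. The face without direction
  \<open>k\<close> is the cube of \<open>rel x y\<close>; the faces without another direction avoid
  the exceptional edge and are pulled back from an edge.\<close>

lemma pcub_exists:
  assumes "rel x y" "x' \<in> carr N"
  shows "\<exists>y'. pcub x y x' y'"
proof -
  have x: "x \<in> carr N" using assms(1) rel_carr by blast
  let ?g = "\<lambda>V. if {..<k} \<subseteq> V \<and> k \<notin> V then y else if k \<in> V then x' else x"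
  have "cub N (Suc k) (\<lambda>V. ?g (V - {i}))" if "i < Suc k" for i
  proof (cases "i = k")
    case True
    have "cub N (Suc k) (\<lambda>V. if {..<k} \<subseteq> V \<inter> {..<min (Suc k) k} then y else x)"
      by (rule smor[OF smor_proj assms(1)[unfolded rel_def]])
    then show ?thesis by (rule cub_cong) (use True in auto)
  next
    case False
    have "cub N (Suc k) (\<lambda>V. if k \<in> V then x' else x)" using cub_edge[OF x assms(2)] by simp
    moreover have "\<not> {..<k} \<subseteq> V - {i}" for V
    proof -
      have "i \<in> {..<k}" using that False by auto
      then show ?thesis by blast
    qed
    ultimately show ?thesis by (auto intro: cub_cong simp: False[symmetric])
  qed
  then obtain c where c: "cub N (Suc k) c" "\<And>V. V \<subset> {..<Suc k} \<Longrightarrow> c V = ?g V"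
    using nilspace_corner[OF nilspace, of "Suc k" ?g] by auto
  have "pcub x y x' (c {..<Suc k})" unfolding pcub_def using c(1)
  proof (rule cub_cong)
    fix V assume V: "V \<subseteq> {..<Suc k}"
    have "V = {..<Suc k} \<longleftrightarrow> {..<k} \<subseteq> V \<and> k \<in> V" using V by (auto simp: lessThan_Suc)
    then show "c V = (if {..<k} \<subseteq> V then (if k \<in> V then c {..<Suc k} else y) else (if k \<in> V then x' else x))"
      using c(2)[of V] V by (cases "V = {..<Suc k}") (simp_all add: psubset_eq)
  qed
  then show ?thesis by blast
qed

text \<open>Transporting the pair \<open>x\<close>, \<open>y\<close> along prisms to every other
  point gives the translation; any two transported pairs are compatible by
  \<open>pcub_trans\<close>.\<close>

lemma Tr_transitive:
  assumes "rel x y"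
  shows "\<exists>\<alpha>\<in>Tr. \<alpha> x = y"
proof -
  have x: "x \<in> carr N" using assms rel_carr by blast
  obtain \<beta> where \<beta>: "\<And>x'. x' \<in> carr N \<Longrightarrow> pcub x y x' (\<beta> x')"
  proof
    fix x' assume "x' \<in> carr N"
    then have "\<exists>y'. pcub x y x' y'" by (rule pcub_exists[OF assms])
    then show "pcub x y x' (SOME y'. pcub x y x' y')" by (rule someI_ex)
  qed
  define \<alpha> where "\<alpha> = (\<lambda>z. if z \<in> carr N then \<beta> z else z)"
  have "pcub x' (\<beta> x') x'' (\<beta> x'')" if "x' \<in> carr N" "x'' \<in> carr N" for x' x''
    by (rule pcub_trans[OF \<beta>[OF that(1)] \<beta>[OF that(2)]])
  then have "\<alpha> \<in> Tr" by (simp add: Tr_def \<alpha>_def)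
  moreover have "\<alpha> x = y" using pcub_unique[OF \<beta>[OF x] pcub_self[OF assms]] x by (simp add: \<alpha>_def)
  ultimately show ?thesis by blast
qed

lemma Tr_pcub: "\<alpha> \<in> Tr \<Longrightarrow> x \<in> carr N \<Longrightarrow> x' \<in> carr N \<Longrightarrow> pcub x (\<alpha> x) x' (\<alpha> x')"
  by (simp add: Tr_def)

lemma Tr_rel:
  assumes "\<alpha> \<in> Tr" "x \<in> carr N"
  shows "rel x (\<alpha> x)"
proof -
  from smor[OF smor_proj Tr_pcub[OF assms assms(2), unfolded pcub_def], of k]
  show ?thesis unfolding rel_def by (rule cub_cong) (auto simp: min_def)
qed

lemma Tr_carr: "\<alpha> \<in> Tr \<Longrightarrow> x \<in> carr N \<Longrightarrow> \<alpha> x \<in> carr N"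
  using Tr_rel rel_carr by blast

text \<open>The condition \<open>V - {i} = U - {i}\<close> singles out the edge through
  \<open>U\<close> in direction \<open>i\<close>. At the upper edge, telescoping over the other
  \<open>k\<close> directions leaves exactly a prism of \<open>\<alpha>\<close>; a reflection moves
  this edge to the given one.\<close>

lemma Tr_edge:
  assumes \<alpha>: "\<alpha> \<in> Tr" and c: "cub N (Suc k) c" and i: "i < Suc k" and U: "U \<subseteq> {..<Suc k}"
  shows "cub N (Suc k) (\<lambda>V. if V - {i} = U - {i} then \<alpha> (c V) else c V)"
proof -
  let ?T = "{..<Suc k}"
  let ?S = "?T - {i}"
  have upper: "cub N (Suc k) (\<lambda>V. if ?S \<subseteq> V then \<alpha> (c V) else c V)" if c: "cub N (Suc k) c" for c
  proof (rule cub_telescope[OF c])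
    \<comment> \<open>Exchanges directions \<open>i\<close> and \<open>k\<close>, since prisms are
      written with \<open>k\<close> as their long direction.\<close>
    let ?M = "\<lambda>V. {j. j < Suc k \<and> (if j = k then i else if j = i then k else j) \<in> V}"
    have M: "smor (Suc k) (Suc k) ?M" using i by (intro smor_Collect) auto
    have "pcub (c ?S) (\<alpha> (c ?S)) (c ?T) (\<alpha> (c ?T))"
      using \<alpha> by (intro Tr_pcub carr_cub[OF c]) auto
    from smor[OF M this[unfolded pcub_def]]
    show "cub N (Suc k) (\<lambda>V. if ?S \<subseteq> V then \<alpha> (c V) else c (V \<union> ?S))"
    proof (rule cub_cong)
      fix V assume V: "V \<subseteq> ?T"
      have 1: "{..<k} \<subseteq> ?M V \<longleftrightarrow> ?S \<subseteq> V"
      proof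
        assume L: "{..<k} \<subseteq> ?M V"
        show "?S \<subseteq> V"
        proof
          fix j assume j: "j \<in> ?S"
          show "j \<in> V"
          proof (cases "j = k")
            case True
            then have "i \<in> {..<k}" using j i by auto
            then have "i \<in> ?M V" using L by blast
            then show ?thesis using True j by (auto split: if_splits)
          next
            case False
            then have "j \<in> {..<k}" using j by auto
            then have "j \<in> ?M V" using L by blast
            then show ?thesis using False j by auto
          qed
        qed
      qed (use i in \<open>auto split: if_splits\<close>)
      have 2: "k \<in> ?M V \<longleftrightarrow> i \<in> V" by simp
      have 3: "V \<union> ?S = (if i \<in> V then ?T else ?S)" using V i by auto
      have 4: "?S \<subseteq> V \<Longrightarrow> V = (if i \<in> V then ?T else ?S)" using V i by auto
      show "(if {..<k} \<subseteq> ?M V then if k \<in> ?M V then \<alpha> (c ?T) else \<alpha> (c ?S)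
            else if k \<in> ?M V then c ?T else c ?S) = (if ?S \<subseteq> V then \<alpha> (c V) else c (V \<union> ?S))"
        unfolding 1 2 3 using 4 by (auto split: if_splits)
    qed
  qed auto
  let ?W = "?S - U"
  have W: "smor (Suc k) (Suc k) (flip ?W)" by (rule smor_flip) auto
  from smor[OF W upper[OF smor[OF W c]]] show ?thesis
  proof (rule cub_cong)
    fix V assume V: "V \<subseteq> ?T"
    have "?S \<subseteq> flip ?W V \<longleftrightarrow> V - {i} = U - {i}" using V U i by (auto simp: flip_def)
    then show "(if ?S \<subseteq> flip ?W V then \<alpha> (c (flip ?W (flip ?W V))) else c (flip ?W (flip ?W V)))
      = (if V - {i} = U - {i} then \<alpha> (c V) else c V)" by simp
  qed
qed

lemma Tr_id: "id \<in> Tr"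
  using pcub_triv by (auto simp: Tr_def)

text \<open>Applying \<open>\<alpha>\<close> along the exceptional edge of a prism of
  \<open>\<beta>\<close> turns it into a prism of the composite.\<close>

lemma Tr_comp:
  assumes "\<alpha> \<in> Tr" "\<beta> \<in> Tr"
  shows "\<alpha> \<circ> \<beta> \<in> Tr"
proof -
  have "pcub x (\<alpha> (\<beta> x)) x' (\<alpha> (\<beta> x'))" if "x \<in> carr N" "x' \<in> carr N" for x x'
  proof -
    have "pcub x (\<beta> x) x' (\<beta> x')" using assms(2) that by (rule Tr_pcub)
    then have "cub N (Suc k) (\<lambda>V. if V - {k} = {..<k} - {k} then
        \<alpha> (if {..<k} \<subseteq> V then if k \<in> V then \<beta> x' else \<beta> x else if k \<in> V then x' else x)
        else if {..<k} \<subseteq> V then if k \<in> V then \<beta> x' else \<beta> x else if k \<in> V then x' else x)"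
      unfolding pcub_def by (rule Tr_edge[OF assms(1)]) auto
    then show ?thesis unfolding pcub_def
    proof (rule cub_cong)
      fix V assume "V \<subseteq> {..<Suc k}"
      then have "V - {k} = {..<k} - {k} \<longleftrightarrow> {..<k} \<subseteq> V" by (auto simp: lessThan_Suc)
      then show "(if V - {k} = {..<k} - {k} then \<alpha> (if {..<k} \<subseteq> V then if k \<in> V then \<beta> x' else \<beta> x
                   else if k \<in> V then x' else x) else if {..<k} \<subseteq> V then if k \<in> V then \<beta> x' else \<beta> x
                   else if k \<in> V then x' else x)
        = (if {..<k} \<subseteq> V then if k \<in> V then \<alpha> (\<beta> x') else \<alpha> (\<beta> x) else if k \<in> V then x' else x)"
        by auto
    qed
  qed
  then show ?thesis using assms by (auto simp: Tr_def)
qed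

text \<open>The action is free: the value at one point determines, through the unique prism, the
  value at every other point.\<close>

lemma Tr_fix:
  assumes "\<alpha> \<in> Tr" "x \<in> carr N" "\<alpha> x = x"
  shows "\<alpha> = id"
proof
  fix x'
  show "\<alpha> x' = id x'"
  proof (cases "x' \<in> carr N")
    case True
    then show ?thesis
      using pcub_unique[of x x x' "\<alpha> x'" x'] Tr_pcub[OF assms(1,2) True] pcub_triv assms by simp
  next
    case False
    then show ?thesis using assms(1) by (simp add: Tr_def)
  qed
qed

text \<open>Eckmann--Hilton: the two orders of applying \<open>\<alpha>\<close> and \<open>\<beta>\<close> to adjacent edges of a constant
  cube agree except at the common vertex, where they give \<open>\<beta> (\<alpha> x)\<close> and \<open>\<alpha> (\<beta> x)\<close>.\<close>
lemma Tr_commute: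
  assumes "\<alpha> \<in> Tr" "\<beta> \<in> Tr"
  shows "\<alpha> \<circ> \<beta> = \<beta> \<circ> \<alpha>"
proof
  fix x
  show "(\<alpha> \<circ> \<beta>) x = (\<beta> \<circ> \<alpha>) x"
  proof (cases "x \<in> carr N")
    case True
    let ?e = "\<lambda>i \<alpha> c V. if V - {i::nat} = {} - {i} then \<alpha> (c V) else c V"
    have *: "cub N (Suc k) (?e i \<alpha> (?e j \<beta> (\<lambda>V. x)))"
      if "\<alpha> \<in> Tr" "\<beta> \<in> Tr" "i < Suc k" "j < Suc k" for \<alpha> \<beta> i j
      by (intro Tr_edge that cub_const True) auto
    have "?e 0 \<alpha> (?e 1 \<beta> (\<lambda>V. x)) {} = ?e 1 \<beta> (?e 0 \<alpha> (\<lambda>V. x)) {}"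
    proof (rule uniq[OF *[OF assms] *[OF assms(2,1)]])
      fix V :: "nat set" assume "V \<noteq> {}"
      then have "\<not> (V - {0} = {} \<and> V - {1} = {})" by auto
      then show "?e 0 \<alpha> (?e 1 \<beta> (\<lambda>V. x)) V = ?e 1 \<beta> (?e 0 \<alpha> (\<lambda>V. x)) V" by auto
    qed (use k1 in auto)
    then show ?thesis by simp
  next
    case False
    then show ?thesis using assms by (simp add: Tr_def)
  qed
qed

lemma Tr_inverse:
  assumes "\<alpha> \<in> Tr"
  obtains \<beta> where "\<beta> \<in> Tr" "\<beta> \<circ> \<alpha> = id" "\<alpha> \<circ> \<beta> = id"
proof -
  obtain x where x: "x \<in> carr N" using nilspace unfolding is_nilspace_def by auto
  have "rel (\<alpha> x) x" using Tr_rel[OF assms x] by (rule rel_sym)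
  then obtain \<beta> where b: "\<beta> \<in> Tr" "\<beta> (\<alpha> x) = x" using Tr_transitive by blast
  have "\<beta> \<circ> \<alpha> = id" using b assms by (intro Tr_fix[OF Tr_comp x]) auto
  then show thesis using that b Tr_commute[OF assms b(1)] by simp
qed

end

section \<open>The action of a free abelian group on a finite nilspace\<close>

definition ipow :: "('b \<Rightarrow> 'b) \<Rightarrow> int \<Rightarrow> 'b \<Rightarrow> 'b" where
  "ipow f z = (if z \<ge> 0 then f ^^ nat z else inv f ^^ nat (- z))"

lemma ipow_succ:
  assumes "bij f"
  shows "ipow f (z + 1) = f \<circ> ipow f z"
proof (cases "z \<ge> 0")
  case True
  then have "nat (z + 1) = Suc (nat z)" by simp
  then show ?thesis using True by (simp add: ipow_def)
next
  case False
  then have "nat (- z) = Suc (nat (- (z + 1)))" by simp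
  then have "f \<circ> ipow f z = (f \<circ> inv f) \<circ> inv f ^^ nat (- (z + 1))"
    using False by (simp add: ipow_def fun_eq_iff)
  then show ?thesis using False assms
    by (simp add: ipow_def surj_iff[THEN iffD1, OF bij_is_surj])
qed

lemma ipow_add:
  assumes "bij f"
  shows "ipow f (z + w) = ipow f z \<circ> ipow f w"
proof (induction z rule: int_induct[where k = 0])
  case base
  then show ?case by (simp add: ipow_def)
next
  case (step1 i)
  have "ipow f (i + 1 + w) = f \<circ> ipow f (i + w)" using ipow_succ[OF assms, of "i + w"] by (simp add: ac_simps)
  then show ?case using step1 by (simp add: ipow_succ[OF assms] comp_assoc)
next
  case (step2 i)
  have pred: "ipow f (z - 1) = inv f \<circ> ipow f z" for z
  proof -
    have "inv f \<circ> ipow f z = (inv f \<circ> f) \<circ> ipow f (z - 1)"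
      using ipow_succ[OF assms, of "z - 1"] by (simp add: comp_assoc)
    then show ?thesis using assms by (simp add: inj_iff[THEN iffD1, OF bij_is_inj])
  qed
  have "ipow f (i - 1 + w) = inv f \<circ> ipow f (i + w)" using pred[of "i + w"] by (simp add: algebra_simps)
  then show ?case using step2 by (simp add: pred comp_assoc)
qed

primrec iprod :: "(nat \<Rightarrow> 'b \<Rightarrow> 'b) \<Rightarrow> nat \<Rightarrow> (nat \<Rightarrow> int) \<Rightarrow> 'b \<Rightarrow> 'b" where
  "iprod f 0 t = id"
| "iprod f (Suc m) t = ipow (f m) (t m) \<circ> iprod f m t"

lemma iprod_unit:
  assumes "\<forall>j<m. t j = (if j = i then 1 else 0)"
  shows "iprod f m t = (if i < m then f i else id)"
  using assms by (induction m) (auto simp: ipow_def less_Suc_eq)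

context kstep
begin

lemma Tr_bij: "\<alpha> \<in> Tr \<Longrightarrow> bij \<alpha>"
  by (rule Tr_inverse) (auto simp: o_bij)

lemma Tr_inv:
  assumes "\<alpha> \<in> Tr"
  shows "inv \<alpha> \<in> Tr"
proof -
  obtain \<beta> where "\<beta> \<in> Tr" "\<beta> \<circ> \<alpha> = id" "\<alpha> \<circ> \<beta> = id" using Tr_inverse[OF assms] .
  then show ?thesis using inv_unique_comp[of \<alpha> \<beta>] by simp
qed

lemma Tr_ipow: "\<alpha> \<in> Tr \<Longrightarrow> ipow \<alpha> z \<in> Tr"
proof -
  have "\<beta> ^^ n \<in> Tr" if "\<beta> \<in> Tr" for \<beta> and n :: nat
    using that by (induction n) (simp_all add: Tr_id Tr_comp)
  then show "\<alpha> \<in> Tr \<Longrightarrow> ipow \<alpha> z \<in> Tr" by (simp add: ipow_def Tr_inv)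
qed

lemma Tr_iprod: "(\<And>j. j < m \<Longrightarrow> f j \<in> Tr) \<Longrightarrow> iprod f m t \<in> Tr"
  by (induction m) (auto simp: Tr_id intro!: Tr_comp Tr_ipow)

lemma iprod_add:
  assumes "\<And>j. j < m \<Longrightarrow> f j \<in> Tr"
  shows "iprod f m (s + t) = iprod f m s \<circ> iprod f m t"
  using assms
proof (induction m)
  case (Suc m)
  have f: "f m \<in> Tr" using Suc.prems by simp
  have "iprod f (Suc m) (s + t)
      = ipow (f m) (s m) \<circ> ((ipow (f m) (t m) \<circ> iprod f m s) \<circ> iprod f m t)"
  proof -
    have "iprod f m (s + t) = iprod f m s \<circ> iprod f m t"
      by (rule Suc.IH) (simp add: Suc.prems)
    then show ?thesis by (simp only: iprod.simps plus_fun_apply ipow_add[OF Tr_bij[OF f]] comp_assoc)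
  qed
  also have "ipow (f m) (t m) \<circ> iprod f m s = iprod f m s \<circ> ipow (f m) (t m)"
    using Suc.prems by (intro Tr_commute Tr_ipow Tr_iprod) auto
  finally show ?case by (simp add: comp_assoc)
qed simp

text \<open>Freeness and transitivity identify a translation with its value at a base point
  \<open>e\<close>. One generator for each point of the class of \<open>e\<close> is enough, so
  \<open>m\<close> is the size of that class, and unit vectors already realise every
  translation.\<close>

lemma action_exists:
  assumes "finite (carr N)"
  obtains act m where "\<And>t::nat \<Rightarrow> int. act t \<in> Tr" "\<And>s t. act (s + t) = act s \<circ> act t"
    "\<And>x y. rel x y \<Longrightarrow> \<exists>t\<in>Zvec m. act t x = y"
proof -
  obtain e where e: "e \<in> carr N" using nilspace unfolding is_nilspace_def by auto
  define E where "E = {y. rel e y}"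
  have "finite E" using assms rel_carr by (auto simp: E_def intro: finite_subset)
  then obtain h where h: "bij_betw h {0..<card E} E" using ex_bij_betw_nat_finite by blast
  define m where "m = card E"
  have "\<forall>j. \<exists>\<alpha>. j < m \<longrightarrow> \<alpha> \<in> Tr \<and> \<alpha> e = h j"
  proof
    fix j
    show "\<exists>\<alpha>. j < m \<longrightarrow> \<alpha> \<in> Tr \<and> \<alpha> e = h j"
    proof (cases "j < m")
      case True
      then have "rel e (h j)" using h by (auto simp: bij_betw_def m_def E_def)
      then show ?thesis using Tr_transitive by blast
    qed blast
  qed
  then obtain f where f: "\<And>j. j < m \<Longrightarrow> f j \<in> Tr" "\<And>j. j < m \<Longrightarrow> f j e = h j" by metis
  show thesis
  proof (rule that[of "iprod f m" m])
    show "iprod f m t \<in> Tr" for t using f(1) by (rule Tr_iprod)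
    show "iprod f m (s + t) = iprod f m s \<circ> iprod f m t" for s t using f(1) by (rule iprod_add)
    fix x y assume xy: "rel x y"
    then obtain \<alpha> where \<alpha>: "\<alpha> \<in> Tr" "\<alpha> x = y" using Tr_transitive by blast
    then have "\<alpha> e \<in> E" using Tr_rel e by (simp add: E_def)
    then have "\<alpha> e \<in> h ` {0..<m}" using h by (simp add: bij_betw_def m_def)
    then obtain i where i: "i < m" "h i = \<alpha> e" by auto
    obtain \<beta> where \<beta>: "\<beta> \<in> Tr" "\<beta> \<circ> \<alpha> = id" "\<alpha> \<circ> \<beta> = id" using Tr_inverse[OF \<alpha>(1)] .
    have "\<beta> \<circ> f i = id"
      using Tr_comp[OF \<beta>(1) f(1)[OF i(1)]] e
      by (rule Tr_fix) (use \<beta> f(2)[OF i(1)] i(2) in \<open>auto simp: fun_eq_iff\<close>)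
    then have "f i = \<alpha>" using \<beta>(3) by (metis comp_assoc comp_id id_comp)
    moreover have "iprod f m (\<lambda>j. if j = i then 1 else 0) = f i" using i iprod_unit[of m _ i f] by simp
    moreover have "(\<lambda>j. if j = i then 1 else 0) \<in> Zvec m" using i by (auto simp: Zvec_def)
    ultimately show "\<exists>t\<in>Zvec m. iprod f m t x = y" using \<alpha>(2) by metis
  qed
qed

end

locale kaction = kstep N k for N :: "'a cubespace" and k +
  fixes act :: "(nat \<Rightarrow> int) \<Rightarrow> 'a \<Rightarrow> 'a" and m :: nat
  assumes act_Tr: "act t \<in> Tr"
    and act_add: "act (s + t) = act s \<circ> act t"
    and act_trans: "rel x y \<Longrightarrow> \<exists>t\<in>Zvec m. act t x = y"
begin

lemma act_0 [simp]: "act 0 = id"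
proof -
  obtain \<beta> where \<beta>: "\<beta> \<circ> act 0 = id" using Tr_inverse[OF act_Tr[of 0]] by blast
  have "act 0 = (\<beta> \<circ> act 0) \<circ> act 0" using \<beta> by simp
  also have "\<dots> = \<beta> \<circ> act (0 + 0)" by (simp only: act_add comp_assoc)
  finally show ?thesis using \<beta> by simp
qed

lemma act_act: "act s (act t x) = act (s + t) x"
  by (simp add: act_add)

text \<open>The kernel of the action, which by freeness is also the stabiliser of each single point.
  It may contain vectors outside \<open>Zvec m\<close>, hence the later intersections.\<close>

definition stab :: "(nat \<Rightarrow> int) set" where
  "stab = {t. act t = id}"

lemma stabI: "x \<in> carr N \<Longrightarrow> act t x = x \<Longrightarrow> t \<in> stab"
  using Tr_fix[OF act_Tr] by (simp add: stab_def)

lemma stab_add: "s \<in> stab \<Longrightarrow> t \<in> stab \<Longrightarrow> s + t \<in> stab"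
  by (simp add: stab_def act_add)

lemma stab_0: "0 \<in> stab"
  by (simp add: stab_def)

lemma stab_minus:
  assumes "t \<in> stab" shows "- t \<in> stab"
proof -
  have "act (- t + t) = act (- t) \<circ> act t" by (rule act_add)
  then show ?thesis using assms by (simp add: stab_def)
qed

lemma act_eq_iff: "x \<in> carr N \<Longrightarrow> act s x = act t x \<longleftrightarrow> s - t \<in> stab"
proof
  assume x: "x \<in> carr N" "act s x = act t x"
  have "act (s - t) x = act (- t) (act s x)" by (simp add: act_act)
  also have "\<dots> = x" by (simp add: x(2) act_act)
  finally show "s - t \<in> stab" using x(1) stabI by blast
next
  assume "s - t \<in> stab"
  then have "act (t + (s - t)) = act t" by (simp only: act_add stab_def) simp
  then show "act s x = act t x" by simp
qed

text \<open>Quantifying over all cubes, and not fixing one, makes these families closed under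
  addition.\<close>

definition shifts :: "(nat set \<Rightarrow> nat \<Rightarrow> int) set" where
  "shifts = {t. \<forall>c. cub N (Suc k) c \<longrightarrow> cub N (Suc k) (\<lambda>V. act (t V) (c V))}"

lemma shifts_0: "(\<lambda>V. 0) \<in> shifts"
  by (simp add: shifts_def)

lemma shifts_add: 
  assumes "s \<in> shifts" "t \<in> shifts" shows "(\<lambda>V. s V + t V) \<in> shifts"
  using assms by (auto simp: shifts_def act_act[symmetric])

lemma shifts_edge:
  assumes "i < Suc k" "U \<subseteq> {..<Suc k}"
  shows "(\<lambda>V. if V - {i} = U - {i} then s else 0) \<in> shifts"
  unfolding shifts_def
proof (intro CollectI allI impI)
  fix c assume "cub N (Suc k) c"
  from Tr_edge[OF act_Tr this assms, of s]
  show "cub N (Suc k) (\<lambda>V. act (if V - {i} = U - {i} then s else 0) (c V))"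
    by (rule cub_cong) auto
qed

lemma shifts_cong:
  assumes "s \<in> shifts" "\<And>V. V \<subseteq> {..<Suc k} \<Longrightarrow> s V = t V" shows "t \<in> shifts"
  unfolding shifts_def
proof (intro CollectI allI impI)
  fix c assume "cub N (Suc k) c"
  then have "cub N (Suc k) (\<lambda>V. act (s V) (c V))" using assms(1) by (simp add: shifts_def)
  then show "cub N (Suc k) (\<lambda>V. act (t V) (c V))" by (rule cub_cong) (simp add: assms(2))
qed

text \<open>Edges generate all shifts of vanishing alternating sum: the values of \<open>t\<close> can be moved
  along edges to the top vertex.\<close>
lemma shifts_move:
  "(\<lambda>V. t V - (if V = {..<Suc k} then sg {..<Suc k} (alt (Suc k) t) else 0)) \<in> shifts"
proof -
  let ?T = "{..<Suc k}"
  let ?d = "\<lambda>t V. t V - (if V = ?T then sg ?T (alt (Suc k) t) else 0)"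
  have add: "?d (\<lambda>V. s V + t V) \<in> shifts" if "?d s \<in> shifts" "?d t \<in> shifts" for s t
    using shifts_add[OF that] by (rule shifts_cong) (simp add: alt_add sg_add)
  have single: "?d (\<lambda>V. if V = U then s else 0) \<in> shifts" if "U \<subseteq> ?T" for U s
    using that
  proof (induction "card (?T - U)" arbitrary: U s)
    case 0
    then have "U = ?T" by auto
    then show ?case using alt_single[of ?T "Suc k" s]
      by (intro shifts_cong[OF shifts_0]) (simp add: zero_fun_def)
  next
    case (Suc r)
    then have "?T - U \<noteq> {}" by (metis card.empty nat.distinct(1))
    then obtain i where i: "i < Suc k" "i \<notin> U" by blast
    have "?T - U = insert i (?T - insert i U)" using i by auto
    then have "card (?T - U) = Suc (card (?T - insert i U))"
      by (metis DiffD2 card_insert_disjoint finite_Diff finite_lessThan insertI1)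
    \<comment> \<open>A shift by \<open>s\<close> at \<open>U\<close> is the edge shift by
      \<open>s\<close> in direction \<open>i\<close> plus a shift by \<open>- s\<close> at the next
      vertex up, which has fewer missing directions.\<close>
    then have IH: "?d (\<lambda>V. if V = insert i U then - s else 0) \<in> shifts"
      using Suc i by (intro Suc(1)) auto
    have "alt (Suc k) (\<lambda>V. if V - {i} = U - {i} then s else 0) = 0"
      using i by (intro alt_indep[of i]) auto
    then have "?d (\<lambda>V. if V - {i} = U - {i} then s else 0) \<in> shifts"
      by (intro shifts_cong[OF shifts_edge[OF i(1) Suc(3), of s]]) simp
    from add[OF this IH] show ?case
    proof (rule shifts_cong)
      have "V - {i} = U - {i} \<longleftrightarrow> V = U \<or> V = insert i U" for V using i by auto
      moreover have "U \<noteq> insert i U" using i by auto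
      ultimately have e: "(\<lambda>V. (if V - {i} = U - {i} then s else 0) + (if V = insert i U then - s else 0))
          = (\<lambda>V. if V = U then s else 0)" by (auto simp: fun_eq_iff)
      show "?d (\<lambda>V. (if V - {i} = U - {i} then s else 0) + (if V = insert i U then - s else 0)) V
          = ?d (\<lambda>V. if V = U then s else 0) V" for V
        by (rule arg_cong[OF e, of "\<lambda>t. ?d t V"])
    qed
  qed
  define P where "P t \<longleftrightarrow> ?d t \<in> shifts" for t
  have addP: "P (\<lambda>V. s V + t V)" if "P s" "P t" for s t
    using that unfolding P_def by (rule add)
  have sum: "P (\<lambda>V. \<Sum>U\<in>\<U>. if V = U then t U else 0)" if "finite \<U>" "\<U> \<subseteq> Pow ?T" for \<U>
    using that
  proof (induction \<U>)
    case empty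
    show ?case unfolding P_def by (intro shifts_cong[OF shifts_0]) (simp add: fun_eq_iff alt_def)
  next
    case (insert U \<U>)
    have "P (\<lambda>V. (if V = U then t U else 0) + (\<Sum>U\<in>\<U>. if V = U then t U else 0))"
    proof (rule addP)
      show "P (\<lambda>V. if V = U then t U else 0)"
        unfolding P_def by (rule single) (use insert.prems in simp)
      show "P (\<lambda>V. \<Sum>U\<in>\<U>. if V = U then t U else 0)"
        by (rule insert.IH) (use insert.prems in simp)
    qed
    then show ?case by (simp only: sum.insert[OF insert(1,2)])
  qed
  have *: "?d (\<lambda>V. \<Sum>U\<in>Pow ?T. if V = U then t U else 0) \<in> shifts"
    using sum[of "Pow ?T"] unfolding P_def by simp
  have e: "(\<Sum>U\<in>Pow ?T. if V = U then t U else 0) = t V" if "V \<subseteq> ?T" for V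
    using that by (simp add: sum.delta')
  have a: "alt (Suc k) (\<lambda>V. \<Sum>U\<in>Pow ?T. if V = U then t U else 0) = alt (Suc k) t"
    by (rule alt_cong[OF e])
  from * show ?thesis
    by (rule shifts_cong) (simp only: e a)
qed

text \<open>By \<open>shifts_move\<close> the shift becomes admissible once the signed alternating
  sum is subtracted at the top vertex. By uniqueness there, the original shift gives a cube iff that
  surplus fixes the top point.\<close>

lemma act_cub_iff:
  assumes c: "cub N (Suc k) c"
  shows "cub N (Suc k) (\<lambda>V. act (t V) (c V)) \<longleftrightarrow> alt (Suc k) t \<in> stab"
proof -
  let ?T = "{..<Suc k}"
  let ?d = "\<lambda>V. t V - (if V = ?T then sg ?T (alt (Suc k) t) else 0)"
  have d: "cub N (Suc k) (\<lambda>V. act (?d V) (c V))" using shifts_move c by (simp add: shifts_def)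
  have x: "c V \<in> carr N" if "V \<subseteq> ?T" for V using carr_cub[OF c] that by simp
  have sg_iff: "sg ?T a \<in> stab \<longleftrightarrow> a \<in> stab" for a
    using stab_minus[of a] stab_minus[of "- a"] by (auto simp: sg_def)
  show ?thesis
  proof
    assume "cub N (Suc k) (\<lambda>V. act (t V) (c V))"
    from uniq[OF this d, of ?T] have "act (t ?T) (c ?T) = act (?d ?T) (c ?T)" by simp
    then have "t ?T - ?d ?T \<in> stab" using act_eq_iff[OF x] by simp
    then show "alt (Suc k) t \<in> stab" using sg_iff by simp
  next
    assume "alt (Suc k) t \<in> stab"
    from d show "cub N (Suc k) (\<lambda>V. act (t V) (c V))"
    proof (rule cub_cong)
      fix V assume "V \<subseteq> ?T"
      then have "act (t V) (c V) = act (?d V) (c V) \<longleftrightarrow> t V - ?d V \<in> stab"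
        by (intro act_eq_iff x)
      moreover have "t V - ?d V \<in> stab" using sg_iff \<open>alt (Suc k) t \<in> stab\<close> stab_0 by simp
      ultimately show "act (?d V) (c V) = act (t V) (c V)" by simp
    qed
  qed
qed

end

section \<open>The quotient of step \<open>k - 1\<close>\<close>

context kstep
begin

text \<open>The quotient is realised on a set of representatives, so that it has the same type.\<close>
definition rep :: "'a \<Rightarrow> 'a" where
  "rep x = (SOME y. rel x y)"

definition quot :: "'a cubespace" where
  "quot = (rep ` carr N, \<lambda>n. (\<lambda>c. restrict (rep \<circ> c) (vert n)) ` cubes N n)"

lemma rel_rep: "x \<in> carr N \<Longrightarrow> rel x (rep x)"
  unfolding rep_def using rel_refl by (rule someI)

lemma rep_eq:
  assumes "rel x y" shows "rep x = rep y"
proof -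
  have "rel x = rel y" using assms rel_sym rel_trans by blast
  then show ?thesis by (simp add: rep_def)
qed

lemma rep_carr: "x \<in> carr N \<Longrightarrow> rep x \<in> carr N"
  using rel_rep rel_carr by blast

lemma rep_rep: "x \<in> carr N \<Longrightarrow> rep (rep x) = rep x"
  using rep_eq[OF rel_rep] by simp

lemma carr_quot: "carr quot = rep ` carr N"
  by (simp add: quot_def)

lemma quot_carr: "x \<in> carr quot \<Longrightarrow> x \<in> carr N \<and> rep x = x"
  using rep_carr rep_rep by (auto simp: carr_quot)

lemma cub_quot: "cub quot n c \<longleftrightarrow> (\<exists>d. cub N n d \<and> (\<forall>V\<subseteq>{..<n}. c V = rep (d V)))"
proof
  assume "cub quot n c"
  then obtain f where f: "f \<in> cubes N n"
    "restrict (\<lambda>v. c (vset v)) (vert n) = restrict (rep \<circ> f) (vert n)"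
    by (auto simp: cub_def quot_def)
  show "\<exists>d. cub N n d \<and> (\<forall>V\<subseteq>{..<n}. c V = rep (d V))"
  proof (intro exI conjI allI impI)
    show "cub N n (\<lambda>V. f (vlist n V))" using f(1) cubes_conv_cub[OF csp] by simp
    fix V assume "V \<subseteq> {..<n}"
    then show "c V = rep (f (vlist n V))"
      using fun_cong[OF f(2), of "vlist n V"] by (simp add: vset_vlist Int_absorb2)
  qed
next
  assume "\<exists>d. cub N n d \<and> (\<forall>V\<subseteq>{..<n}. c V = rep (d V))"
  then obtain d where d: "cub N n d" "\<forall>V\<subseteq>{..<n}. c V = rep (d V)" by blast
  have "restrict (\<lambda>v. c (vset v)) (vert n)
      = restrict (rep \<circ> restrict (\<lambda>v. d (vset v)) (vert n)) (vert n)"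
    using d(2) vset_subset by (auto simp: fun_eq_iff)
  then show "cub quot n c" using d(1) by (auto simp: cub_def quot_def)
qed

lemma cub_rep: "cub N n c \<Longrightarrow> cub quot n (\<lambda>V. rep (c V))"
  using cub_quot by blast

lemma cubespace_quot: "is_cubespace quot"
  unfolding is_cubespace_def
proof (intro conjI allI impI)
  fix n show "cubes quot n \<subseteq> cmaps (carr quot) n"
    using csp by (fastforce simp: quot_def is_cubespace_def cmaps_def)
next
  fix n l \<psi> f assume p: "cube_morphism n l \<psi>" and "f \<in> cubes quot l"
  then obtain g where g: "g \<in> cubes N l" "f = restrict (rep \<circ> g) (vert l)" by (auto simp: quot_def)
  have "restrict (g \<circ> \<psi>) (vert n) \<in> cubes N n" using csp p g(1) by (auto simp: is_cubespace_def)
  moreover have "restrict (f \<circ> \<psi>) (vert n) = restrict (rep \<circ> restrict (g \<circ> \<psi>) (vert n)) (vert n)"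
    using p by (auto simp: fun_eq_iff g(2) cube_morphism_def vert_def)
  ultimately show "restrict (f \<circ> \<psi>) (vert n) \<in> cubes quot n" by (auto simp: quot_def)
qed

lemma quot_cub_carr: "cub quot n c \<Longrightarrow> V \<subseteq> {..<n} \<Longrightarrow> c V \<in> carr quot"
  by (rule cub_carr[OF cubespace_quot])

text \<open>By \<open>rel_cubes\<close> the vertices may be moved to the representatives, so a
  low-dimensional quotient cube is a cube of \<open>N\<close> without being lifted.\<close>

lemma quot_cub_low:
  assumes "cub quot n c" "n \<le> k"
  shows "cub N n c"
proof -
  obtain d where d: "cub N n d" "\<And>V. V \<subseteq> {..<n} \<Longrightarrow> c V = rep (d V)"
    using assms(1) cub_quot by blast
  show ?thesis
    by (rule rel_cubes[OF d(1) assms(2)]) (simp add: d(2) rel_rep carr_cub[OF d(1)])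
qed

lemma quot_uniq:
  assumes "cub quot k c" "cub quot k c'" "\<And>V. V \<subset> {..<k} \<Longrightarrow> c V = c' V"
  shows "c {..<k} = c' {..<k}"
proof -
  have "rel (c {..<k}) (c' {..<k})"
    by (rule rel_top) (use assms quot_cub_low in auto)
  then have "rep (c {..<k}) = rep (c' {..<k})" by (rule rep_eq)
  moreover have "c {..<k} \<in> carr quot" "c' {..<k} \<in> carr quot"
    using assms quot_cub_carr by auto
  ultimately show ?thesis using quot_carr by simp
qed

text \<open>Faces of \<open>g\<close> of dimension at most \<open>k\<close> are cubes of
  \<open>N\<close>, so \<open>g\<close> can be filled in \<open>N\<close> over the vertices of
  cardinality at most \<open>k\<close>. At larger vertices the projected filling has no choice but
  to agree with \<open>g\<close>, by uniqueness in dimension \<open>k\<close>.\<close>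

lemma quot_corner:
  assumes n: "n \<ge> 1" and g: "\<And>i. i < n \<Longrightarrow> cub quot n (\<lambda>V. g (V - {i}))"
  shows "\<exists>c. cub quot n c \<and> (\<forall>V. V \<subset> {..<n} \<longrightarrow> c V = g V)"
proof -
  define T where "T = {V. V \<subset> {..<n} \<and> card V \<le> k}"
  have face: "cub quot n (\<lambda>U. g (U \<inter> V))" if V: "V \<subset> {..<n}" for V
  proof -
    obtain i where i: "i < n" "i \<notin> V" using psubset_imp_ex_mem[OF V] by auto
    from cub_smor[OF cubespace_quot smor_Int[of n V] g[OF i(1)]]
    show ?thesis by (rule cub_cong) (use i in \<open>auto intro!: arg_cong[of _ _ g]\<close>)
  qed
  have gq: "g V \<in> carr quot" if "V \<subset> {..<n}" for V
    using quot_cub_carr[OF face[OF that], of V] that by auto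
  have "\<exists>c. cub N n c \<and> (\<forall>V\<in>T. c V = g V)"
  proof (rule fill_downset)
    show "T \<subseteq> Pow {..<n}" by (auto simp: T_def)
    show "U \<in> T" if "V \<in> T" "U \<subseteq> V" for U V
    proof -
      have "finite V" using that(1) finite_subset[of V "{..<n}"] by (auto simp: T_def)
      then have "card U \<le> card V" using that(2) by (rule card_mono)
      then show ?thesis using that by (auto simp: T_def)
    qed
    show "cub N n (\<lambda>U. g (U \<inter> V))" if V: "V \<in> T" for V
    proof -
      have fV: "finite V" "V \<subset> {..<n}" "card V \<le> k"
        using V finite_subset[of V "{..<n}"] by (auto simp: T_def)
      obtain b where b: "bij_betw b {..<card V} V"
        using ex_bij_betw_nat_finite[OF fV(1)] by (auto simp: atLeast0LessThan)
      have "smor (card V) n (\<lambda>W. b ` W \<union> {})"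
        using b fV(2) by (intro smor_image) (auto simp: bij_betw_def)
      from cub_smor[OF cubespace_quot this face[OF fV(2)]]
      have "cub N (card V) (\<lambda>W. g ((b ` W \<union> {}) \<inter> V))" by (rule quot_cub_low) (rule fV(3))
      moreover have "smor n (card V) (\<lambda>U. {j. j < card V \<and> b j \<in> U})"
        using b fV(2) by (intro smor_Collect coord_mem) (auto simp: bij_betw_def)
      ultimately have "cub N n (\<lambda>U. g ((b ` {j. j < card V \<and> b j \<in> U} \<union> {}) \<inter> V))"
        using smor by blast
      moreover have "b ` {j. j < card V \<and> b j \<in> U} = U \<inter> V" for U
        using b by (auto simp: bij_betw_def image_iff)
      ultimately show ?thesis by simp
    qed
  qed
  then obtain c where c: "cub N n c" "\<And>V. V \<in> T \<Longrightarrow> c V = g V" by blast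
  have "rep (c V) = g V" if "V \<subset> {..<n}" for V
    using that
  proof (induction "card V" arbitrary: V rule: less_induct)
    case less
    show ?case
    proof (cases "card V \<le> k")
      case True
      then show ?thesis using c(2)[of V] less(2) gq[OF less(2)] quot_carr by (auto simp: T_def)
    next
      case False
      have fV: "finite V" using less(2) finite_subset[of V "{..<n}"] by auto
      obtain S where S: "S \<subseteq> V" "card S = k" "finite S"
        using obtain_subset_with_card_n[of k V] False by auto
      obtain b where b: "bij_betw b {..<k} S"
        using ex_bij_betw_nat_finite[OF S(3)] S(2) by (auto simp: atLeast0LessThan)
      \<comment> \<open>A \<open>k\<close>-dimensional face whose top is \<open>V\<close>; all its
        other vertices are smaller, so the induction hypothesis covers them.\<close>
      let ?M = "\<lambda>W. b ` W \<union> (V - S)"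
      have M: "smor k n ?M"
        using b S less(2) by (intro smor_image) (auto simp: bij_betw_def)
      have MV: "?M {..<k} = V" using b S by (auto simp: bij_betw_def)
      have MT: "?M W \<subset> V" if W: "W \<subset> {..<k}" for W
      proof -
        obtain j where j: "j \<in> {..<k}" "j \<notin> W" using psubset_imp_ex_mem[OF W] by auto
        have "b j \<notin> b ` W"
          using b W j inj_on_image_mem_iff[of b "{..<k}" j W] by (auto simp: bij_betw_def)
        moreover have "b j \<in> S" "b ` W \<subseteq> S" using b W j by (auto simp: bij_betw_def)
        ultimately show ?thesis using S by blast
      qed
      have "(\<lambda>W. rep (c (?M W))) {..<k} = (\<lambda>W. g (?M W \<inter> V)) {..<k}"
      proof (rule quot_uniq)
        show "cub quot k (\<lambda>W. rep (c (?M W)))" by (rule cub_rep[OF smor[OF M c(1)]])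
        show "cub quot k (\<lambda>W. g (?M W \<inter> V))"
          by (rule cub_smor[OF cubespace_quot M face[OF less(2)]])
        fix W assume W: "W \<subset> {..<k}"
        have "card (?M W) < card V" using MT[OF W] fV by (rule psubset_card_mono[rotated])
        moreover have "?M W \<inter> V = ?M W" using MT[OF W] by auto
        ultimately show "rep (c (?M W)) = g (?M W \<inter> V)"
          using less(1)[of "?M W"] MT[OF W] less(2) by auto
      qed
      then show ?thesis using MV by simp
    qed
  qed
  then show ?thesis using cub_rep[OF c(1)] by (intro exI[of _ "\<lambda>V. rep (c V)"]) simp
qed

lemma kstep_quot: "is_kstep_nilspace (k - 1) quot"
proof (rule is_kstep_nilspaceI)
  show "is_nilspace quot"
  proof (rule is_nilspaceI[OF cubespace_quot])
    show "carr quot \<noteq> {}" using nilspace by (auto simp: is_nilspace_def carr_quot)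
    show "cub quot 1 c" if "\<And>V. V \<subseteq> {..<1} \<Longrightarrow> c V \<in> carr quot" for c
    proof -
      have "cub N 1 c" using that quot_carr by (intro nilspace_cub1[OF nilspace]) blast
      from cub_rep[OF this] show ?thesis by (rule cub_cong) (use that quot_carr in blast)
    qed
  qed (rule quot_corner)
  show "c {..<k - 1 + 1} = c' {..<k - 1 + 1}"
    if "cub quot (k - 1 + 1) c" "cub quot (k - 1 + 1) c'"
      "\<And>V. V \<subset> {..<k - 1 + 1} \<Longrightarrow> c V = c' V" for c c'
    using quot_uniq[of c c'] that k1 by simp
qed

lemma finite_quot: "finite (carr N) \<Longrightarrow> finite (carr quot)"
  by (simp add: carr_quot)

lemma rep_morphism: "cs_morphism N quot rep"
  by (rule cs_morphismI[OF csp]) (auto simp: carr_quot cub_rep)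

text \<open>By induction all lower facets are cubes; they form a corner, whose filling must agree
  with \<open>c\<close> at the top by uniqueness on a face of dimension
  \<open>k + 1\<close>.\<close>

lemma cub_of_faces:
  assumes "n \<ge> Suc k" "\<And>M. smor (Suc k) n M \<Longrightarrow> cub N (Suc k) (\<lambda>V. c (M V))"
  shows "cub N n c"
  using assms
proof (induction n arbitrary: c rule: less_induct)
  case (less n)
  show ?case
  proof (cases "n = Suc k")
    case True
    have "smor (Suc k) n (\<lambda>V. V \<inter> {..<n})" using True by (auto intro: smor_Int)
    from less(3)[OF this] show ?thesis unfolding True by (rule cub_cong) (simp add: Int_absorb2)
  next
    case False
    then have n: "n \<ge> Suc (Suc k)" using less(2) by simp
    have "cub N n (\<lambda>V. c (V - {i}))" if i: "i < n" for i
    proof -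
      have "cub N (n - 1) (\<lambda>V. c (face_in i V))"
      proof (rule less(1))
        fix M assume "smor (Suc k) (n - 1) M"
        then show "cub N (Suc k) (\<lambda>V. c (face_in i (M V)))"
          by (intro less(3) smor_comp[OF _ smor_face_in[OF i]])
      qed (use n in auto)
      from smor[OF smor_face_out[OF i] this] show ?thesis by (simp add: face_in_out)
    qed
    then obtain d where d: "cub N n d" "\<And>V. V \<subset> {..<n} \<Longrightarrow> d V = c V"
      using nilspace_corner[OF nilspace, of n c] n by auto
    \<comment> \<open>The first \<open>k + 1\<close> directions vary and the others are frozen at 1,
      so this face contains the top vertex.\<close>
    let ?M = "\<lambda>V. id ` V \<union> {Suc k..<n}"
    have M: "smor (Suc k) n ?M" using n by (intro smor_image) auto
    have "d (?M {..<Suc k}) = c (?M {..<Suc k})"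
    proof (rule uniq[OF smor[OF M d(1)] less(3)[OF M]])
      fix V assume V: "V \<subseteq> {..<Suc k}" "V \<noteq> {..<Suc k}"
      then obtain j where "j < Suc k" "j \<notin> V" by blast
      then have "j < n" "j \<notin> ?M V" using n by auto
      moreover have "?M V \<subseteq> {..<n}" using V n by auto
      ultimately show "d (?M V) = c (?M V)" by (intro d(2)) auto
    qed simp
    moreover have "?M {..<Suc k} = {..<n}" using n by auto
    ultimately have "d V = c V" if "V \<subseteq> {..<n}" for V using d(2)[of V] that by auto
    then show ?thesis using d(1) by (rule cub_cong[rotated])
  qed
qed

text \<open>Dimension \<open>k + 1\<close> decides: lower cubes are padded with dummy directions,
  higher ones are handled by \<open>cub_of_faces\<close>.\<close>

lemma morphism_of_top_cubes:
  assumes X: "is_cubespace X" and "f ` carr X \<subseteq> carr N"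
    and top: "\<And>c. cub X (Suc k) c \<Longrightarrow> cub N (Suc k) (\<lambda>V. f (c V))"
  shows "cs_morphism X N f"
proof (rule cs_morphismI[OF X assms(2)])
  fix n c assume c: "cub X n c"
  have *: "cub N (Suc k) (\<lambda>V. f (c (M V)))" if "smor (Suc k) n M" for M
    by (rule top[OF cub_smor[OF X that c]])
  show "cub N n (\<lambda>V. f (c V))"
  proof (cases "n \<ge> Suc k")
    case True
    then show ?thesis using * by (rule cub_of_faces)
  next
    case False
    from smor[OF smor_proj *[OF smor_proj], of n] show ?thesis
      by (rule cub_cong) (use False in \<open>auto simp: Int_absorb2 min_def\<close>)
  qed
qed

end

section \<open>Polynomial maps on the cube\<close>

text \<open>The cube condition of the degree \<open>d\<close> structure; it means that
  \<open>p\<close> is a polynomial of degree at most \<open>d\<close> in the vertex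
  coordinates.\<close>

definition polyd :: "nat \<Rightarrow> nat \<Rightarrow> (nat set \<Rightarrow> 'b::ab_group_add) \<Rightarrow> bool" where
  "polyd d K p \<longleftrightarrow> (\<forall>M. smor (Suc d) K M \<longrightarrow> alt (Suc d) (\<lambda>V. p (M V)) = 0)"

lemma polyd_smor:
  assumes "polyd d m p" "smor n m M" shows "polyd d n (\<lambda>V. p (M V))"
  unfolding polyd_def
proof (intro allI impI)
  fix L assume "smor (Suc d) n L"
  from smor_comp[OF this assms(2)] show "alt (Suc d) (\<lambda>V. p (M (L V))) = 0"
    using assms(1) unfolding polyd_def by blast
qed

lemma polyd_cong:
  assumes "polyd d K p" "\<And>V. V \<subseteq> {..<K} \<Longrightarrow> p V = q V"
  shows "polyd d K q"
  unfolding polyd_def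
proof (intro allI impI)
  fix M assume M: "smor (Suc d) K M"
  have "alt (Suc d) (\<lambda>V. q (M V)) = alt (Suc d) (\<lambda>V. p (M V))"
    by (rule alt_cong) (use M assms(2) in \<open>auto simp: smor_def\<close>)
  then show "alt (Suc d) (\<lambda>V. q (M V)) = 0" using assms(1) M by (simp add: polyd_def)
qed

lemma polyd_add: "polyd d K p \<Longrightarrow> polyd d K q \<Longrightarrow> polyd d K (\<lambda>V. p V + q V)"
  by (simp add: polyd_def alt_add)

lemma polyd_zero: "polyd d K (\<lambda>V. 0)"
  by (simp add: polyd_def)

lemma coord_dep:
  assumes "coord n p"
  shows "\<exists>i. \<forall>i'<n. i' \<noteq> i \<longrightarrow> (\<forall>V\<subseteq>{..<n}. p (insert i' V) = p V)"
  using assms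
proof (cases rule: coordE)
  case (const b)
  then show ?thesis by auto
next
  case (var i b)
  then show ?thesis by (intro exI[of _ i]) auto
qed

text \<open>Pigeonhole: each target coordinate depends on at most one source direction, so fewer
  than \<open>n\<close> of them leave some direction idle.\<close>

lemma smor_indep:
  assumes M: "smor n K M" and S: "S \<subseteq> {..<K}" "card S < n"
  obtains i where "i < n" "\<And>j V. j \<in> S \<Longrightarrow> V \<subseteq> {..<n} \<Longrightarrow> j \<in> M (insert i V) \<longleftrightarrow> j \<in> M V"
proof -
  have "\<forall>j. \<exists>i. j \<in> S \<longrightarrow> (\<forall>i'<n. i' \<noteq> i \<longrightarrow> (\<forall>V\<subseteq>{..<n}. (j \<in> M (insert i' V)) = (j \<in> M V)))"
  proof
    fix j
    show "\<exists>i. j \<in> S \<longrightarrow> (\<forall>i'<n. i' \<noteq> i \<longrightarrow> (\<forall>V\<subseteq>{..<n}. (j \<in> M (insert i' V)) = (j \<in> M V)))"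
    proof (cases "j \<in> S")
      case True
      then have "coord n (\<lambda>V. j \<in> M V)" using M S by (auto simp: smor_def)
      then show ?thesis using coord_dep by blast
    qed blast
  qed
  then obtain dep where dep: "\<And>j i' V. j \<in> S \<Longrightarrow> i' < n \<Longrightarrow> i' \<noteq> dep j \<Longrightarrow> V \<subseteq> {..<n} \<Longrightarrow>
      (j \<in> M (insert i' V)) = (j \<in> M V)" by metis
  have fS: "finite S" using S finite_subset by blast
  have "card (dep ` S) < card {..<n}" using card_image_le[OF fS, of dep] S(2) by simp
  then have "\<not> {..<n} \<subseteq> dep ` S" using card_mono[of "dep ` S" "{..<n}"] fS by auto
  then obtain i where "i < n" "i \<notin> dep ` S" by blast
  then show thesis using dep by (intro that[of i]) auto
qed

text \<open>The function is the monomial \<open>t v^S\<close>; the direction idle for the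
  coordinates in \<open>S\<close> makes the alternating sum cancel in pairs.\<close>

lemma polyd_monom:
  assumes "S \<subseteq> {..<K}" "card S \<le> d"
  shows "polyd d K (\<lambda>V. if S \<subseteq> V then t else 0)"
  unfolding polyd_def
proof (intro allI impI)
  fix M assume "smor (Suc d) K M"
  then obtain i where i: "i < Suc d"
    "\<And>j V. j \<in> S \<Longrightarrow> V \<subseteq> {..<Suc d} \<Longrightarrow> j \<in> M (insert i V) \<longleftrightarrow> j \<in> M V"
    using smor_indep[of "Suc d" K M S] assms by auto
  show "alt (Suc d) (\<lambda>V. if S \<subseteq> M V then t else 0) = 0"
  proof (rule alt_indep[OF i(1)])
    fix V assume "V \<subseteq> {..<Suc d} - {i}"
    then have "S \<subseteq> M (insert i V) \<longleftrightarrow> S \<subseteq> M V" using i(2)[of _ V] by blast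
    then show "(if S \<subseteq> M (insert i V) then t else 0) = (if S \<subseteq> M V then t else 0)" by simp
  qed
qed

text \<open>With at most \<open>d\<close> coordinates in total, a direction is idle for all of them,
  so any function whatsoever qualifies.\<close>

lemma polyd_low:
  assumes "K \<le> d" shows "polyd d K p"
  unfolding polyd_def
proof (intro allI impI)
  fix M assume M: "smor (Suc d) K M"
  then obtain i where i: "i < Suc d"
    "\<And>j V. j < K \<Longrightarrow> V \<subseteq> {..<Suc d} \<Longrightarrow> j \<in> M (insert i V) \<longleftrightarrow> j \<in> M V"
    using smor_indep[of "Suc d" K M "{..<K}"] assms by auto
  show "alt (Suc d) (\<lambda>V. p (M V)) = 0"
  proof (rule alt_indep[OF i(1)])
    fix V assume V: "V \<subseteq> {..<Suc d} - {i}"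
    have sub: "M V \<subseteq> {..<K}" "M (insert i V) \<subseteq> {..<K}"
      using M V i(1) unfolding smor_def by blast+
    have "M (insert i V) = M V"
    proof (rule set_eqI)
      fix j show "j \<in> M (insert i V) \<longleftrightarrow> j \<in> M V"
        using i(2)[of j V] V sub by (cases "j < K") auto
    qed
    then show "p (M (insert i V)) = p (M V)" by simp
  qed
qed

text \<open>The alternating sum over a face is the difference of those over two opposite facets, so
  vanishing for \<open>d + 1\<close> directions passes to more directions.\<close>

lemma polyd_face:
  fixes p :: "nat set \<Rightarrow> int"
  assumes p: "polyd d K p" and "T \<subseteq> {..<K}" "R \<subseteq> {..<K}" "card T \<ge> Suc d"
  shows "(\<Sum>U\<in>Pow T. (-1) ^ card U * p (U \<union> R)) = 0"
  using assms(2-)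
proof (induction "card T - Suc d" arbitrary: T R)
  case 0
  then have cT: "card T = Suc d" by simp
  have fT: "finite T" using 0(2) finite_subset by blast
  obtain b where b: "bij_betw b {..<Suc d} T"
    using ex_bij_betw_nat_finite[OF fT] cT by (auto simp: atLeast0LessThan)
  have "smor (Suc d) K (\<lambda>V. b ` V \<union> R)"
    using b 0 by (intro smor_image) (auto simp: bij_betw_def)
  then have "0 = alt (Suc d) (\<lambda>V. p (b ` V \<union> R))" using p by (simp add: polyd_def)
  also have "\<dots> = (\<Sum>V\<in>Pow {..<Suc d}. (-1) ^ card (b ` V) * p (b ` V \<union> R))"
    unfolding alt_def
  proof (rule sum.cong)
    fix V assume "V \<in> Pow {..<Suc d}"
    then have "card (b ` V) = card V"
      using b by (intro card_image) (auto simp: bij_betw_def intro: inj_on_subset)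
    then show "sg V (p (b ` V \<union> R)) = (-1) ^ card (b ` V) * p (b ` V \<union> R)" by (simp add: sg_def)
  qed simp
  also have "\<dots> = (\<Sum>U\<in>Pow T. (-1) ^ card U * p (U \<union> R))"
    by (rule sum.reindex_bij_betw[OF bij_betw_Pow[OF b]])
  finally show ?case by simp
next
  case (Suc r)
  have fT: "finite T" using Suc(3) finite_subset by blast
  have "T \<noteq> {}" using Suc(2) by auto
  then obtain i where i: "i \<in> T" by blast
  let ?T = "T - {i}"
  have c: "card ?T = card T - 1" using fT i by simp
  have r: "r = card ?T - Suc d" "card ?T \<ge> Suc d" using Suc(2) c by auto
  have T: "Pow T = Pow ?T \<union> insert i ` Pow ?T"
    using i by (subst Pow_insert[symmetric]) (simp add: insert_absorb)
  have "(\<Sum>U\<in>Pow T. (-1) ^ card U * p (U \<union> R))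
      = (\<Sum>U\<in>Pow ?T. (-1) ^ card U * p (U \<union> R)) + (\<Sum>U\<in>insert i ` Pow ?T. (-1) ^ card U * p (U \<union> R))"
    unfolding T using fT by (intro sum.union_disjoint) auto
  also have "(\<Sum>U\<in>insert i ` Pow ?T. (-1) ^ card U * p (U \<union> R))
      = (\<Sum>U\<in>Pow ?T. (-1) ^ card (insert i U) * p (insert i U \<union> R))"
    by (subst sum.reindex) (auto simp: inj_on_def)
  also have "\<dots> = (\<Sum>U\<in>Pow ?T. - ((-1) ^ card U * p (U \<union> insert i R)))"
  proof (rule sum.cong)
    fix U assume "U \<in> Pow ?T"
    then have "finite U" "i \<notin> U" using fT finite_subset[of U T] by auto
    then show "(-1) ^ card (insert i U) * p (insert i U \<union> R) = - ((-1) ^ card U * p (U \<union> insert i R))"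
      by simp
  qed simp
  also have "\<dots> = - (\<Sum>U\<in>Pow ?T. (-1) ^ card U * p (U \<union> insert i R))" by (rule sum_negf)
  also have "(\<Sum>U\<in>Pow ?T. (-1) ^ card U * p (U \<union> insert i R)) = 0"
    using Suc i by (intro Suc(1) r) auto
  also have "(\<Sum>U\<in>Pow ?T. (-1) ^ card U * p (U \<union> R)) = 0"
    using Suc by (intro Suc(1) r) auto
  finally show ?case by simp
qed

text \<open>Moebius inversion over subsets: up to sign, the coefficient of \<open>v^T\<close> is the
  alternating sum over the face below \<open>T\<close>, which vanishes when \<open>T\<close> has
  more than \<open>d\<close> elements.\<close>

lemma polyd_expand:
  fixes p :: "nat set \<Rightarrow> int"
  assumes p: "polyd d K p"
  obtains a where "\<And>V. V \<subseteq> {..<K} \<Longrightarrow>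
    p V = (\<Sum>T | T \<subseteq> {..<K} \<and> card T \<le> d. if T \<subseteq> V then a T else 0)"
proof -
  define g where "g S = (\<Sum>T\<in>Pow S. (-1) ^ card T * p T)" for S
  have mob: "p V = (\<Sum>T\<in>Pow V. (-1) ^ card T * g T)" if "finite V" for V
    by (rule inclusion_exclusion_symmetric[OF _ that]) (simp add: g_def)
  have zero: "g T = 0" if "T \<subseteq> {..<K}" "\<not> card T \<le> d" for T
    using polyd_face[OF p that(1), of "{}"] that(2) by (simp add: g_def)
  show thesis
  proof (rule that[of "\<lambda>T. (-1) ^ card T * g T"])
    fix V assume V: "V \<subseteq> {..<K}"
    have fV: "finite V" using V finite_subset by blast
    have "(\<Sum>T | T \<subseteq> {..<K} \<and> card T \<le> d. if T \<subseteq> V then (-1) ^ card T * g T else 0)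
        = (\<Sum>T\<in>Pow {..<K}. if T \<subseteq> V then (-1) ^ card T * g T else 0)"
      by (rule sum.mono_neutral_left) (use zero in auto)
    also have "\<dots> = (\<Sum>T\<in>Pow V. (-1) ^ card T * g T)"
      by (rule sum.mono_neutral_cong_right) (use V in auto)
    finally show "p V = (\<Sum>T | T \<subseteq> {..<K} \<and> card T \<le> d. if T \<subseteq> V then (-1) ^ card T * g T else 0)"
      using mob[OF fV] by simp
  qed
qed

section \<open>Cocycles on free nilspaces are coboundaries\<close>

text \<open>Cubes of the product of the \<open>\<D>\<close>-structures of degree \<open>d j\<close> on \<open>\<int>\<close>, \<open>j \<in> J\<close>.\<close>
definition fcub :: "'j set \<Rightarrow> ('j \<Rightarrow> nat) \<Rightarrow> nat \<Rightarrow> (nat set \<Rightarrow> 'j \<Rightarrow> int) \<Rightarrow> bool" where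
  "fcub J d K c \<longleftrightarrow> (\<forall>j\<in>J. polyd (d j) K (\<lambda>V. c V j)) \<and> (\<forall>j. j \<notin> J \<longrightarrow> (\<forall>V\<subseteq>{..<K}. c V j = 0))"

lemma fcub_smor:
  assumes "fcub J d m c" "smor n m M" shows "fcub J d n (\<lambda>V. c (M V))"
  using assms polyd_smor[OF _ assms(2)] by (auto simp: fcub_def smor_def)

lemma fcub_cong:
  assumes "fcub J d K c" "\<And>V. V \<subseteq> {..<K} \<Longrightarrow> c V = c' V"
  shows "fcub J d K c'"
  unfolding fcub_def
proof (intro conjI ballI allI impI)
  fix j assume "j \<in> J"
  then have "polyd (d j) K (\<lambda>V. c V j)" using assms(1) by (simp add: fcub_def)
  then show "polyd (d j) K (\<lambda>V. c' V j)" by (rule polyd_cong) (simp add: assms(2))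
next
  fix j V assume "j \<notin> J" "V \<subseteq> {..<K}"
  then show "c' V j = 0" using assms(1) by (simp add: fcub_def flip: assms(2))
qed

lemma fcub_insert:
  assumes "fcub J d K c" shows "fcub (insert j J) d K c"
proof -
  have "polyd (d i) K (\<lambda>V. c V i)" if "i \<notin> J" for i
    by (rule polyd_cong[OF polyd_zero]) (use assms that in \<open>simp add: fcub_def\<close>)
  then show ?thesis using assms by (auto simp: fcub_def)
qed

lemma fcub_zero_coord:
  assumes "fcub (insert j J) d K c" "j \<notin> J" shows "fcub J d K (\<lambda>V. (c V)(j := 0))"
proof -
  have "polyd (d i) K (\<lambda>V. ((c V)(j := 0)) i)" if "i \<in> J" for i
  proof -
    have "i \<noteq> j" using that assms(2) by blast
    then show ?thesis using assms(1) that by (simp add: fcub_def)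
  qed
  then show ?thesis using assms by (auto simp: fcub_def)
qed

text \<open>The elementary modification of a cube in a free nilspace: the monomial
  \<open>t v^S\<close> enters one coordinate.\<close>

definition addm :: "'j \<Rightarrow> nat set \<Rightarrow> int \<Rightarrow> (nat set \<Rightarrow> 'j \<Rightarrow> int) \<Rightarrow> nat set \<Rightarrow> 'j \<Rightarrow> int" where
  "addm j S t c V = (c V)(j := c V j + (if S \<subseteq> V then t else 0))"

lemma fcub_addm:
  assumes "fcub J d K c" "j \<in> J" "S \<subseteq> {..<K}" "card S \<le> d j"
  shows "fcub J d K (addm j S t c)"
proof -
  have "polyd (d i) K (\<lambda>V. addm j S t c V i)" if "i \<in> J" for i
  proof (cases "i = j")
    case True
    then show ?thesis using assms polyd_add[OF _ polyd_monom[OF assms(3,4)], of "\<lambda>V. c V j"]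
      by (simp add: addm_def fcub_def)
  next
    case False
    then show ?thesis using assms(1) that by (simp add: addm_def fcub_def)
  qed
  then show ?thesis using assms(1,2) by (auto simp: fcub_def addm_def)
qed

section \<open>Subgroups and discrete integration\<close>

definition subgp :: "'b::ab_group_add set \<Rightarrow> bool" where
  "subgp H \<longleftrightarrow> 0 \<in> H \<and> (\<forall>x\<in>H. \<forall>y\<in>H. x - y \<in> H)"

lemma subgp_0: "subgp H \<Longrightarrow> 0 \<in> H"
  and subgp_diff: "subgp H \<Longrightarrow> x \<in> H \<Longrightarrow> y \<in> H \<Longrightarrow> x - y \<in> H"
  by (simp_all add: subgp_def)

lemma subgp_minus: "subgp H \<Longrightarrow> x \<in> H \<Longrightarrow> - x \<in> H"
  using subgp_diff[of H 0 x] subgp_0[of H] by simp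

lemma subgp_add: "subgp H \<Longrightarrow> x \<in> H \<Longrightarrow> y \<in> H \<Longrightarrow> x + y \<in> H"
  using subgp_diff[of H x "- y"] subgp_minus[of H y] by simp

lemma subgp_sum: "subgp H \<Longrightarrow> (\<And>i. i \<in> I \<Longrightarrow> f i \<in> H) \<Longrightarrow> sum f I \<in> H"
  by (induction I rule: infinite_finite_induct) (auto simp: subgp_0 subgp_add)

lemma subgp_alt: "subgp H \<Longrightarrow> (\<And>V. V \<subseteq> {..<K} \<Longrightarrow> f V \<in> H) \<Longrightarrow> alt K f \<in> H"
  unfolding alt_def by (rule subgp_sum) (auto simp: sg_def subgp_minus)

text \<open>The discrete antiderivative of \<open>u\<close> that vanishes at 0; the second sum
  extends it to negative arguments.\<close>

definition isum :: "(int \<Rightarrow> 'b::ab_group_add) \<Rightarrow> int \<Rightarrow> 'b" where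
  "isum u z = (\<Sum>n\<in>{0..<z}. u n) - (\<Sum>n\<in>{z..<0}. u n)"

lemma isum_0 [simp]: "isum u 0 = 0"
  by (simp add: isum_def)

lemma isum_succ: "isum u (z + 1) = isum u z + u z"
proof (cases "z \<ge> 0")
  case True
  then have "{0..<z + 1} = insert z {0..<z}" by auto
  then show ?thesis using True by (simp add: isum_def)
next
  case False
  then have "{z..<0} = insert z {z + 1..<0}" by auto
  then show ?thesis using False by (simp add: isum_def)
qed

lemma subgp_isum: "subgp H \<Longrightarrow> (\<And>n. u n \<in> H) \<Longrightarrow> isum u z \<in> H"
  unfolding isum_def by (intro subgp_diff subgp_sum)

text \<open>Only the face with the last \<open>e\<close> coordinates equal to 1 contributes, and
  these \<open>e\<close> ones account for the sign.\<close>

lemma alt_top: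
  assumes "e \<le> K"
  shows "alt K (\<lambda>V. if {K - e..<K} \<subseteq> V then G (V \<inter> {..<K - e}) else 0)
    = (if even e then alt (K - e) G else - alt (K - e) G)"
proof -
  let ?S = "{K - e..<K}" and ?L = "Pow {..<K - e}"
  have im: "(\<lambda>W. W \<union> ?S) ` ?L = {V. V \<subseteq> {..<K} \<and> ?S \<subseteq> V}"
  proof
    show "{V. V \<subseteq> {..<K} \<and> ?S \<subseteq> V} \<subseteq> (\<lambda>W. W \<union> ?S) ` ?L"
    proof
      fix V assume "V \<in> {V. V \<subseteq> {..<K} \<and> ?S \<subseteq> V}"
      then have "V = (V \<inter> {..<K - e}) \<union> ?S" by auto
      then show "V \<in> (\<lambda>W. W \<union> ?S) ` ?L" by blast
    qed
  qed auto
  have "alt K (\<lambda>V. if ?S \<subseteq> V then G (V \<inter> {..<K - e}) else 0)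
      = (\<Sum>V | V \<subseteq> {..<K} \<and> ?S \<subseteq> V. sg V (G (V \<inter> {..<K - e})))"
    unfolding alt_def by (rule sum.mono_neutral_cong_right) auto
  also have "\<dots> = (\<Sum>W\<in>?L. sg (W \<union> ?S) (G ((W \<union> ?S) \<inter> {..<K - e})))"
  proof -
    have "inj_on (\<lambda>W. W \<union> ?S) ?L"
      by (rule inj_on_inverseI[where g = "\<lambda>V. V \<inter> {..<K - e}"]) auto
    then show ?thesis unfolding im[symmetric] by (subst sum.reindex) auto
  qed
  also have "\<dots> = (\<Sum>W\<in>?L. if even e then sg W (G W) else - sg W (G W))"
  proof (rule sum.cong)
    fix W assume W: "W \<in> ?L"
    then have "finite W" "W \<inter> ?S = {}" using finite_subset[of W "{..<K - e}"] by auto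
    then have "card (W \<union> ?S) = card W + e" using assms by (simp add: card_Un_disjoint)
    moreover have "(W \<union> ?S) \<inter> {..<K - e} = W" using W by auto
    ultimately show "sg (W \<union> ?S) (G ((W \<union> ?S) \<inter> {..<K - e})) = (if even e then sg W (G W) else - sg W (G W))"
      by (auto simp: sg_def)
  qed simp
  finally show ?thesis by (simp add: alt_def sum_negf)
qed

lemma bij_extend:
  fixes A B T :: "'c set"
  assumes "finite T" "A \<subseteq> T" "B \<subseteq> T" "card A = card B"
  obtains \<sigma> where "bij_betw \<sigma> T T" "\<sigma> ` A = B"
proof -
  have fin: "finite A" "finite B" using assms finite_subset by blast+
  have "card (T - A) = card (T - B)" using assms fin by (simp add: card_Diff_subset)
  then obtain f g where fg: "bij_betw f A B" "bij_betw g (T - A) (T - B)"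
    using finite_same_card_bij[OF fin assms(4)] finite_same_card_bij[of "T - A" "T - B"] assms(1) by auto
  let ?s = "\<lambda>x. if x \<in> A then f x else g x"
  have "bij_betw ?s A B" using fg(1) by (subst bij_betw_cong[of A ?s f]) auto
  moreover have "bij_betw ?s (T - A) (T - B)" using fg(2) by (subst bij_betw_cong[of "T - A" ?s g]) auto
  ultimately have "bij_betw ?s (A \<union> (T - A)) (B \<union> (T - B))" by (rule bij_betw_combine) auto
  moreover have "A \<union> (T - A) = T" "B \<union> (T - B) = T" using assms by auto
  ultimately have "bij_betw ?s T T" by simp
  then show thesis using bij_betw_imp_surj_on[OF \<open>bij_betw ?s A B\<close>] by (rule that)
qed

lemma smor_bij: "bij_betw \<sigma> {..<K} {..<K} \<Longrightarrow> smor K K (\<lambda>V. \<sigma> ` V)"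
  using smor_image[of \<sigma> K K "{}"] by (simp add: bij_betw_def)

text \<open>Congruence modulo \<open>H0\<close> replaces the quotient group, so that all values stay
  in the ambient group.\<close>

locale coefficients =
  fixes H1 H0 :: "'b::ab_group_add set"
  assumes H1: "subgp H1" and H0: "subgp H0"
begin

definition cg :: "'b \<Rightarrow> 'b \<Rightarrow> bool" where
  "cg x y \<longleftrightarrow> x - y \<in> H0"

lemma cg_refl: "cg x x"
  using H0 by (simp add: cg_def subgp_0)

lemma cg_sym: "cg x y \<Longrightarrow> cg y x"
  using subgp_minus[OF H0, of "x - y"] by (simp add: cg_def)

lemma cg_trans: "cg x y \<Longrightarrow> cg y z \<Longrightarrow> cg x z"
  using subgp_add[OF H0, of "x - y" "y - z"] by (simp add: cg_def)

lemma cg_add: "cg x y \<Longrightarrow> cg x' y' \<Longrightarrow> cg (x + x') (y + y')"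
  using subgp_add[OF H0, of "x - y" "x' - y'"] by (simp add: cg_def algebra_simps)

lemma cg_diff: "cg x y \<Longrightarrow> cg x' y' \<Longrightarrow> cg (x - x') (y - y')"
  using subgp_diff[OF H0, of "x - y" "x' - y'"] by (simp add: cg_def algebra_simps)

lemma cg_minus: "cg x y \<Longrightarrow> cg (- x) (- y)"
  using cg_diff[OF cg_refl[of 0]] by simp

lemmas cg_trans' [trans] = cg_trans

text \<open>Besides additivity under gluing, it records the behaviour under symmetries of the cube,
  which lets one monomial stand for all. The second clause is needed because cubes are functions on
  all sets, of which only the vertices count.\<close>

definition cocycle :: "'j set \<Rightarrow> ('j \<Rightarrow> nat) \<Rightarrow> nat \<Rightarrow> ((nat set \<Rightarrow> 'j \<Rightarrow> int) \<Rightarrow> 'b) \<Rightarrow> bool" where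
  "cocycle J d K \<rho> \<longleftrightarrow>
     (\<forall>c. fcub J d K c \<longrightarrow> \<rho> c \<in> H1) \<and>
     (\<forall>c c'. fcub J d K c \<longrightarrow> (\<forall>V\<subseteq>{..<K}. c V = c' V) \<longrightarrow> cg (\<rho> c') (\<rho> c)) \<and>
     (\<forall>c \<sigma>. fcub J d K c \<longrightarrow> bij_betw \<sigma> {..<K} {..<K} \<longrightarrow> cg (\<rho> (\<lambda>V. c (\<sigma> ` V))) (\<rho> c)) \<and>
     (\<forall>c i. fcub J d K c \<longrightarrow> i < K \<longrightarrow> cg (\<rho> (\<lambda>V. c (flip {i} V))) (- \<rho> c)) \<and>
     (\<forall>c c' i. fcub J d K c \<longrightarrow> fcub J d K c' \<longrightarrow> i < K \<longrightarrow>
        (\<forall>V\<subseteq>{..<K}. c (insert i V) = c' (V - {i})) \<longrightarrow>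
        fcub J d K (\<lambda>V. if i \<in> V then c' V else c V) \<longrightarrow>
        cg (\<rho> (\<lambda>V. if i \<in> V then c' V else c V)) (\<rho> c + \<rho> c'))"

lemma cocycleI:
  assumes "\<And>c. fcub J d K c \<Longrightarrow> \<rho> c \<in> H1"
    "\<And>c c'. fcub J d K c \<Longrightarrow> (\<And>V. V \<subseteq> {..<K} \<Longrightarrow> c V = c' V) \<Longrightarrow> cg (\<rho> c') (\<rho> c)"
    "\<And>c \<sigma>. fcub J d K c \<Longrightarrow> bij_betw \<sigma> {..<K} {..<K} \<Longrightarrow> cg (\<rho> (\<lambda>V. c (\<sigma> ` V))) (\<rho> c)"
    "\<And>c i. fcub J d K c \<Longrightarrow> i < K \<Longrightarrow> cg (\<rho> (\<lambda>V. c (flip {i} V))) (- \<rho> c)"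
    "\<And>c c' i. fcub J d K c \<Longrightarrow> fcub J d K c' \<Longrightarrow> i < K \<Longrightarrow>
        (\<And>V. V \<subseteq> {..<K} \<Longrightarrow> c (insert i V) = c' (V - {i})) \<Longrightarrow>
        fcub J d K (\<lambda>V. if i \<in> V then c' V else c V) \<Longrightarrow>
        cg (\<rho> (\<lambda>V. if i \<in> V then c' V else c V)) (\<rho> c + \<rho> c')"
  shows "cocycle J d K \<rho>"
  unfolding cocycle_def by (intro conjI allI impI; rule assms; blast)

lemma cocycle_mem: "cocycle J d K \<rho> \<Longrightarrow> fcub J d K c \<Longrightarrow> \<rho> c \<in> H1"
  by (simp add: cocycle_def)

lemma cocycle_cong:
  "cocycle J d K \<rho> \<Longrightarrow> fcub J d K c \<Longrightarrow> (\<And>V. V \<subseteq> {..<K} \<Longrightarrow> c V = c' V) \<Longrightarrow> cg (\<rho> c') (\<rho> c)"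
  by (simp add: cocycle_def)

lemma cocycle_perm:
  "cocycle J d K \<rho> \<Longrightarrow> fcub J d K c \<Longrightarrow> bij_betw \<sigma> {..<K} {..<K} \<Longrightarrow> cg (\<rho> (\<lambda>V. c (\<sigma> ` V))) (\<rho> c)"
  by (simp add: cocycle_def)

lemma cocycle_flip:
  "cocycle J d K \<rho> \<Longrightarrow> fcub J d K c \<Longrightarrow> i < K \<Longrightarrow> cg (\<rho> (\<lambda>V. c (flip {i} V))) (- \<rho> c)"
  by (simp add: cocycle_def)

lemma cocycle_concat:
  assumes "cocycle J d K \<rho>" "fcub J d K c" "fcub J d K c'" "i < K"
    "\<And>V. V \<subseteq> {..<K} \<Longrightarrow> c (insert i V) = c' (V - {i})"
    "fcub J d K (\<lambda>V. if i \<in> V then c' V else c V)"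
  shows "cg (\<rho> (\<lambda>V. if i \<in> V then c' V else c V)) (\<rho> c + \<rho> c')"
  using assms unfolding cocycle_def by blast

text \<open>Only the alternating sums have to lie in \<open>H1\<close>, not the values of
  \<open>f\<close>; otherwise such a coboundary would always have a primitive in \<open>H1\<close>
  for trivial reasons.\<close>

lemma cocycle_coboundary:
  fixes f :: "('j \<Rightarrow> int) \<Rightarrow> 'b"
  assumes "\<And>c. fcub J d K c \<Longrightarrow> alt K (\<lambda>V. f (c V)) \<in> H1"
  shows "cocycle J d K (\<lambda>c. alt K (\<lambda>V. f (c V)))"
proof (rule cocycleI)
  fix c :: "nat set \<Rightarrow> 'j \<Rightarrow> int"
  show "fcub J d K c \<Longrightarrow> alt K (\<lambda>V. f (c V)) \<in> H1" by (rule assms)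
  show "cg (alt K (\<lambda>V. f (c' V))) (alt K (\<lambda>V. f (c V)))" if "\<And>V. V \<subseteq> {..<K} \<Longrightarrow> c V = c' V" for c'
    using alt_cong[of K "\<lambda>V. f (c' V)" "\<lambda>V. f (c V)"] that by (simp add: cg_refl)
  show "cg (alt K (\<lambda>V. f (c (\<sigma> ` V)))) (alt K (\<lambda>V. f (c V)))" if "bij_betw \<sigma> {..<K} {..<K}" for \<sigma>
    using alt_bij[OF that, of "\<lambda>V. f (c V)"] by (simp add: cg_refl)
  show "cg (alt K (\<lambda>V. f (c (flip {i} V)))) (- alt K (\<lambda>V. f (c V)))" if "i < K" for i
    using alt_flip[OF that, of "\<lambda>V. f (c V)"] by (simp add: cg_refl)
  fix c' :: "nat set \<Rightarrow> 'j \<Rightarrow> int" and i assume i: "i < K"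
    and glue: "\<And>V. V \<subseteq> {..<K} \<Longrightarrow> c (insert i V) = c' (V - {i})"
  have "alt K (\<lambda>V. if i \<in> V then f (c' V) else f (c V)) = alt K (\<lambda>V. f (c V)) + alt K (\<lambda>V. f (c' V))"
  proof (rule alt_concat[OF i])
    fix V assume "V \<subseteq> {..<K} - {i}"
    then have "V \<subseteq> {..<K}" "V - {i} = V" by auto
    then show "f (c (insert i V)) = f (c' V)" using glue by simp
  qed
  then show "cg (alt K (\<lambda>V. f (if i \<in> V then c' V else c V))) (alt K (\<lambda>V. f (c V)) + alt K (\<lambda>V. f (c' V)))"
    by (simp add: cg_refl if_distrib[of f])
qed

lemma cocycle_restrict:
  assumes r: "cocycle (insert j J) d K \<rho>"
  shows "cocycle J d K \<rho>"
proof (rule cocycleI)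
  fix c c' i
  assume c: "fcub J d K c"
  note ci = fcub_insert[OF c, of j]
  show "\<rho> c \<in> H1" by (rule cocycle_mem[OF r ci])
  show "cg (\<rho> c') (\<rho> c)" if "\<And>V. V \<subseteq> {..<K} \<Longrightarrow> c V = c' V"
    by (rule cocycle_cong[OF r ci that])
  show "cg (\<rho> (\<lambda>V. c (\<tau> ` V))) (\<rho> c)" if "bij_betw \<tau> {..<K} {..<K}" for \<tau>
    by (rule cocycle_perm[OF r ci that])
  show "cg (\<rho> (\<lambda>V. c (flip {i} V))) (- \<rho> c)" if "i < K"
    by (rule cocycle_flip[OF r ci that])
  assume h: "fcub J d K c'" "i < K" "\<And>V. V \<subseteq> {..<K} \<Longrightarrow> c (insert i V) = c' (V - {i})"
    "fcub J d K (\<lambda>V. if i \<in> V then c' V else c V)"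
  show "cg (\<rho> (\<lambda>V. if i \<in> V then c' V else c V)) (\<rho> c + \<rho> c')"
    by (rule cocycle_concat[OF r ci fcub_insert[OF h(1)] h(2,3) fcub_insert[OF h(4)]])
qed

lemma cocycle_diff:
  assumes r: "cocycle J d K \<rho>" and s: "cocycle J d K \<sigma>"
  shows "cocycle J d K (\<lambda>c. \<rho> c - \<sigma> c)"
proof (rule cocycleI)
  fix c c' i
  assume c: "fcub J d K c"
  show "\<rho> c - \<sigma> c \<in> H1" using r s c by (intro subgp_diff[OF H1] cocycle_mem)
  show "cg (\<rho> c' - \<sigma> c') (\<rho> c - \<sigma> c)" if "\<And>V. V \<subseteq> {..<K} \<Longrightarrow> c V = c' V"
    by (intro cg_diff cocycle_cong[OF r c that] cocycle_cong[OF s c that])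
  show "cg (\<rho> (\<lambda>V. c (\<tau> ` V)) - \<sigma> (\<lambda>V. c (\<tau> ` V))) (\<rho> c - \<sigma> c)" if "bij_betw \<tau> {..<K} {..<K}" for \<tau>
    by (intro cg_diff cocycle_perm[OF r c that] cocycle_perm[OF s c that])
  show "cg (\<rho> (\<lambda>V. c (flip {i} V)) - \<sigma> (\<lambda>V. c (flip {i} V))) (- (\<rho> c - \<sigma> c))" if "i < K"
    using cg_diff[OF cocycle_flip[OF r c that] cocycle_flip[OF s c that]] by simp
  assume h: "fcub J d K c'" "i < K" "\<And>V. V \<subseteq> {..<K} \<Longrightarrow> c (insert i V) = c' (V - {i})"
    "fcub J d K (\<lambda>V. if i \<in> V then c' V else c V)"
  show "cg (\<rho> (\<lambda>V. if i \<in> V then c' V else c V) - \<sigma> (\<lambda>V. if i \<in> V then c' V else c V))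
      (\<rho> c - \<sigma> c + (\<rho> c' - \<sigma> c'))"
    using cg_diff[OF cocycle_concat[OF r c h] cocycle_concat[OF s c h]] by (simp add: algebra_simps)
qed

text \<open>A cube constant in direction \<open>i\<close> is its own concatenation with itself, so
  its value is congruent to its double.\<close>

lemma cocycle_degenerate:
  assumes r: "cocycle J d K \<rho>" and c: "fcub J d K c" and i: "i < K" "\<And>V. c (insert i V) = c (V - {i})"
  shows "cg (\<rho> c) 0"
proof -
  have "cg (\<rho> (\<lambda>V. if i \<in> V then c V else c V)) (\<rho> c + \<rho> c)"
    by (rule cocycle_concat[OF r c c i(1)]) (use c i(2) in simp_all)
  then have "cg (\<rho> c - \<rho> c) (\<rho> c + \<rho> c - \<rho> c)" by (intro cg_diff cg_refl) simp
  then show ?thesis by (simp add: cg_sym)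
qed

text \<open>The effect of adding \<open>t v^S\<close> depends on \<open>c\<close> only through the
  face where \<open>S\<close> is 1. The directions of \<open>S\<close> are split off by
  concatenation; from the second on, the piece split off is degenerate and contributes
  nothing.\<close>

lemma cocycle_addm:
  assumes r: "cocycle J d K \<rho>" and c: "fcub J d K c"
    and S: "S \<subseteq> {..<K}" "S \<noteq> {}" "card S \<le> d j" and j: "j \<in> J"
  shows "cg (\<rho> (addm j S t c)) (\<rho> c + \<rho> (addm j S t (\<lambda>V. c (V \<union> S))))"
proof -
  let ?e = "\<lambda>R. addm j S t (\<lambda>V. c (V \<union> R))"
  have cu: "fcub J d K (\<lambda>V. c (V \<union> R))" if "R \<subseteq> S" for R
    by (rule fcub_smor[OF c smor_Un]) (use that S in auto)
  have step: "cg (\<rho> (?e R)) (\<rho> (\<lambda>V. c (V \<union> R)) + \<rho> (?e (insert s R)))" if "R \<subseteq> S" "s \<in> S" for R s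
  proof -
    have eq: "(\<lambda>V. if s \<in> V then ?e (insert s R) V else c (V \<union> R)) = ?e R"
    proof
      fix V
      have "V \<union> insert s R = V \<union> R" if "s \<in> V" using that by auto
      then show "(if s \<in> V then ?e (insert s R) V else c (V \<union> R)) = ?e R V"
        using that(2) by (auto simp: addm_def)
    qed
    have "cg (\<rho> (\<lambda>V. if s \<in> V then ?e (insert s R) V else c (V \<union> R)))
        (\<rho> (\<lambda>V. c (V \<union> R)) + \<rho> (?e (insert s R)))"
    proof (rule cocycle_concat[OF r])
      show "fcub J d K (\<lambda>V. c (V \<union> R))" using that by (intro cu)
      show "fcub J d K (?e (insert s R))" using that S j by (intro fcub_addm cu) auto
      show "s < K" using that S by auto
      show "fcub J d K (\<lambda>V. if s \<in> V then ?e (insert s R) V else c (V \<union> R))"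
        unfolding eq using that S j by (intro fcub_addm cu) auto
      fix V
      have "insert s V \<union> R = (V - {s}) \<union> insert s R" by auto
      then show "c (insert s V \<union> R) = ?e (insert s R) (V - {s})" using that by (auto simp: addm_def)
    qed
    then show ?thesis unfolding eq .
  qed
  have "R \<subseteq> S \<longrightarrow> cg (\<rho> (addm j S t c)) (\<rho> c + \<rho> (?e R))" if "finite R" "R \<noteq> {}" for R
    using that
  proof (induction R rule: finite_ne_induct)
    case (singleton s)
    then show ?case using step[of "{}" s] by simp
  next
    case (insert s R)
    show ?case
    proof
      assume sub: "insert s R \<subseteq> S"
      obtain i where i: "i \<in> R" using insert by blast
      have "insert i V \<union> R = (V - {i}) \<union> R" for V using i by auto
      then have "cg (\<rho> (\<lambda>V. c (V \<union> R))) 0"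
        using cu[of R] sub i S by (intro cocycle_degenerate[OF r, where i = i]) auto
      note z = cg_add[OF this cg_refl[of "\<rho> (?e (insert s R))"]]
      have "cg (\<rho> (?e R)) (0 + \<rho> (?e (insert s R)))"
        by (rule cg_trans[OF step z]) (use sub in auto)
      from cg_add[OF cg_refl[of "\<rho> c"] this]
      have *: "cg (\<rho> c + \<rho> (?e R)) (\<rho> c + \<rho> (?e (insert s R)))" by simp
      have "cg (\<rho> (addm j S t c)) (\<rho> c + \<rho> (?e R))" using insert sub by simp
      then show "cg (\<rho> (addm j S t c)) (\<rho> c + \<rho> (?e (insert s R)))" using * by (rule cg_trans)
    qed
  qed
  from this[OF finite_subset[OF S(1) finite_lessThan] S(2)] show ?thesis by simp
qed

lemma addm_addm: "addm j S s (addm j S t c) = addm j S (s + t) c"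
  by (auto simp: addm_def fun_eq_iff)

lemma addm_0: "addm j S 0 c = c"
  by (auto simp: addm_def fun_eq_iff)

text \<open>Invariance under the monomial of one face of codimension \<open>e\<close> spreads to all monomials of
  degree at most \<open>e\<close>: permute the directions, and split \<open>v\<^sup>S = v\<^sup>S v\<^sub>i + v\<^sup>S (1 - v\<^sub>i)\<close>.\<close>
lemma cocycle_invariant:
  assumes r: "cocycle J d K \<rho>" and j: "j \<in> J" and e: "e \<le> d j" "e \<le> K"
    and S0: "S0 \<subseteq> {..<K}" "card S0 = e"
    and inv: "\<And>c. fcub J d K c \<Longrightarrow> cg (\<rho> (addm j S0 1 c)) (\<rho> c)"
    and S: "S \<subseteq> {..<K}" "card S \<le> e" and c: "fcub J d K c"
  shows "cg (\<rho> (addm j S t c)) (\<rho> c)"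
  using S c
proof (induction "e - card S" arbitrary: S c t)
  case 0
  then have cS: "card S = e" by simp
  have one: "cg (\<rho> (addm j S 1 c)) (\<rho> c)" if c: "fcub J d K c" for c
  proof -
    obtain \<sigma> where \<sigma>: "bij_betw \<sigma> {..<K} {..<K}" "\<sigma> ` S0 = S"
      using bij_extend[of "{..<K}" S0 S] S0 0(2) cS by auto
    have fa: "fcub J d K (addm j S 1 c)" using c j 0(2) cS e by (intro fcub_addm) auto
    have cs: "fcub J d K (\<lambda>V. c (\<sigma> ` V))" by (rule fcub_smor[OF c smor_bij[OF \<sigma>(1)]])
    have "addm j S0 1 (\<lambda>V. c (\<sigma> ` V)) V = addm j S 1 c (\<sigma> ` V)" if "V \<subseteq> {..<K}" for V
    proof -
      have "\<sigma> x \<in> \<sigma> ` V \<longleftrightarrow> x \<in> V" if "x \<in> S0" for x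
        using \<sigma>(1) \<open>V \<subseteq> {..<K}\<close> S0(1) that inj_on_image_mem_iff[of \<sigma> "{..<K}" x V]
        by (auto simp: bij_betw_def)
      then have "S \<subseteq> \<sigma> ` V \<longleftrightarrow> S0 \<subseteq> V" unfolding \<sigma>(2)[symmetric] by blast
      then show ?thesis by (simp add: addm_def)
    qed
    then have "cg (\<rho> (\<lambda>V. addm j S 1 c (\<sigma> ` V))) (\<rho> (addm j S0 1 (\<lambda>V. c (\<sigma> ` V))))"
      using cs j e S0 by (intro cocycle_cong[OF r] fcub_addm) auto
    also have "cg \<dots> (\<rho> (\<lambda>V. c (\<sigma> ` V)))" by (rule inv[OF cs])
    also have "cg \<dots> (\<rho> c)" by (rule cocycle_perm[OF r c \<sigma>(1)])
    finally have "cg (\<rho> (\<lambda>V. addm j S 1 c (\<sigma> ` V))) (\<rho> c)" .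
    with cg_sym[OF cocycle_perm[OF r fa \<sigma>(1)]] show ?thesis by (rule cg_trans)
  qed
  have fa: "fcub J d K (addm j S t c)" for t using 0 cS j e by (intro fcub_addm) auto
  show ?case
  proof (induction t rule: int_induct[where k = 0])
    case base
    then show ?case by (simp add: addm_0 cg_refl)
  next
    case (step1 i)
    have "cg (\<rho> (addm j S (i + 1) c)) (\<rho> (addm j S i c))"
      using one[OF fa[of i]] by (simp add: addm_addm add.commute)
    then show ?case using step1(2) by (rule cg_trans)
  next
    case (step2 i)
    have "cg (\<rho> (addm j S i c)) (\<rho> (addm j S (i - 1) c))"
      using one[OF fa[of "i - 1"]] by (simp add: addm_addm)
    from cg_sym[OF this] step2(2) show ?case by (rule cg_trans)
  qed
next
  case (Suc n)
  have fS: "finite S" using Suc(3) finite_subset by blast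
  have "\<not> {..<K} \<subseteq> S"
  proof
    assume "{..<K} \<subseteq> S"
    then have "K \<le> card S" using card_mono[OF fS, of "{..<K}"] by simp
    then show False using Suc(2) e by simp
  qed
  then obtain i where i: "i < K" "i \<notin> S" by blast
  let ?S = "insert i S"
  have S': "n = e - card ?S" "?S \<subseteq> {..<K}" "card ?S \<le> e" using Suc fS i by auto
  have Fi: "fcub J d K (\<lambda>V. c (flip {i} V))" if "fcub J d K c" for c
    by (rule fcub_smor[OF that smor_flip]) (use i in simp)
  have Fa: "fcub J d K (addm j ?S t c)" if "fcub J d K c" for c
    using that j S' e by (intro fcub_addm) auto
  \<comment> \<open>\<open>?c1\<close> adds \<open>t v^S v_i\<close>. Reflecting in
    \<open>i\<close>, adding the same monomial and reflecting back adds
    \<open>t v^S (1 - v_i)\<close>; the two signs from the reflections cancel.\<close>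
  let ?c1 = "addm j ?S t c"
  let ?c2 = "\<lambda>V. ?c1 (flip {i} V)"
  let ?c3 = "addm j ?S t ?c2"
  have f1: "fcub J d K ?c1" using Suc by (intro Fa)
  have f2: "fcub J d K ?c2" using f1 by (rule Fi)
  have "cg (\<rho> (\<lambda>V. ?c3 (flip {i} V))) (- \<rho> ?c3)"
    by (rule cocycle_flip[OF r Fa[OF f2] i(1)])
  also have "cg (- \<rho> ?c3) (- \<rho> ?c2)" by (intro cg_minus Suc(1)[OF S'] f2)
  also have "cg (- \<rho> ?c2) (- (- \<rho> ?c1))" by (intro cg_minus cocycle_flip[OF r f1 i(1)])
  also have "- (- \<rho> ?c1) = \<rho> ?c1" by simp
  also have "cg (\<rho> ?c1) (\<rho> c)" using Suc by (intro Suc(1)[OF S'])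
  also have "(\<lambda>V. ?c3 (flip {i} V)) = addm j S t c"
  proof
    fix V
    have "?S \<subseteq> flip {i} V \<longleftrightarrow> i \<notin> V \<and> S \<subseteq> V" using i by (auto simp: flip_def)
    then show "?c3 (flip {i} V) = addm j S t c V" by (auto simp: addm_def)
  qed
  finally show ?case .
qed

text \<open>Coordinate \<open>j\<close> is a sum of monomials of degree at most \<open>d j\<close>,
  and these can be taken away one after another.\<close>

lemma cocycle_zero_coord:
  assumes r: "cocycle J d K \<rho>" and j: "j \<in> J"
    and inv: "\<And>S t c. S \<subseteq> {..<K} \<Longrightarrow> card S \<le> d j \<Longrightarrow> fcub J d K c \<Longrightarrow> cg (\<rho> (addm j S t c)) (\<rho> c)"
    and c: "fcub J d K c"
  shows "cg (\<rho> c) (\<rho> (\<lambda>V. (c V)(j := 0)))"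
proof -
  have "polyd (d j) K (\<lambda>V. c V j)" using c j by (simp add: fcub_def)
  then obtain a where a: "\<And>V. V \<subseteq> {..<K} \<Longrightarrow>
      c V j = (\<Sum>T | T \<subseteq> {..<K} \<and> card T \<le> d j. if T \<subseteq> V then a T else 0)"
    by (rule polyd_expand) blast
  let ?p = "\<lambda>\<U> V. (c V)(j := \<Sum>T\<in>\<U>. if T \<subseteq> V then a T else 0)"
  let ?A = "{T. T \<subseteq> {..<K} \<and> card T \<le> d j}"
  have fA: "finite ?A" by (rule finite_subset[of _ "Pow {..<K}"]) auto
  have zero: "fcub J d K (\<lambda>V. (c V)(j := 0))"
  proof -
    have "polyd (d i) K (\<lambda>V. ((c V)(j := 0)) i)" if "i \<in> J" for i
      using c that polyd_zero[of "d j" K] by (cases "i = j") (simp_all add: fcub_def)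
    then show ?thesis using c j by (auto simp: fcub_def)
  qed
  have "fcub J d K (?p \<U>) \<and> cg (\<rho> (?p \<U>)) (\<rho> (\<lambda>V. (c V)(j := 0)))" if "finite \<U>" "\<U> \<subseteq> ?A" for \<U>
    using that
  proof (induction \<U>)
    case empty
    show ?case unfolding sum.empty using zero cg_refl by blast
  next
    case (insert T \<U>)
    have IH: "fcub J d K (?p \<U>)" "cg (\<rho> (?p \<U>)) (\<rho> (\<lambda>V. (c V)(j := 0)))"
      using insert.IH insert.prems by blast+
    have eq: "?p (insert T \<U>) = addm j T (a T) (?p \<U>)"
      using insert(1,2) by (auto simp: addm_def fun_eq_iff)
    have T: "T \<subseteq> {..<K}" "card T \<le> d j" using insert by auto
    show ?case unfolding eq using fcub_addm[OF IH(1) j T] inv[OF T IH(1)] IH(2) cg_trans by blast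
  qed
  from this[OF fA order_refl] have p: "fcub J d K (?p ?A)" "cg (\<rho> (?p ?A)) (\<rho> (\<lambda>V. (c V)(j := 0)))"
    by blast+
  have "cg (\<rho> c) (\<rho> (?p ?A))" by (rule cocycle_cong[OF r p(1)]) (simp flip: a)
  then show ?thesis using p(2) by (rule cg_trans)
qed

text \<open>The cube is made constant in the last \<open>e\<close> directions before their monomial
  is added to it. Symmetries and gluings in the first \<open>K - e\<close> directions leave that
  monomial alone, so every clause is inherited.\<close>

lemma cocycle_hat:
  assumes r: "cocycle J d K \<rho>" and j: "j \<in> J" and e: "e \<le> d j" "e \<le> K"
  shows "cocycle J d (K - e) (\<lambda>c. \<rho> (addm j {K - e..<K} t (\<lambda>V. c (V \<inter> {..<K - e}))))"
proof (rule cocycleI)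
  let ?S = "{K - e..<K}"
  let ?L = "{..<K - e}"
  let ?h = "\<lambda>c. addm j ?S t (\<lambda>V. c (V \<inter> ?L))"
  have min: "min K (K - e) = K - e" by simp
  have pr: "smor K (K - e) (\<lambda>V. V \<inter> ?L)" using smor_proj[of K "K - e"] by (simp add: min)
  have S: "?S \<subseteq> {..<K}" "card ?S \<le> d j" using e by auto
  have h: "fcub J d K (?h c)" if "fcub J d (K - e) c" for c
    by (rule fcub_addm[OF fcub_smor[OF that pr] j S])
  fix c assume c: "fcub J d (K - e) c"
  show "\<rho> (?h c) \<in> H1" by (rule cocycle_mem[OF r h[OF c]])
  show "cg (\<rho> (?h c')) (\<rho> (?h c))" if "\<And>V. V \<subseteq> ?L \<Longrightarrow> c V = c' V" for c'
    by (rule cocycle_cong[OF r h[OF c]]) (simp add: addm_def that)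
  show "cg (\<rho> (?h (\<lambda>V. c (\<sigma> ` V)))) (\<rho> (?h c))" if \<sigma>: "bij_betw \<sigma> ?L ?L" for \<sigma>
  proof -
    \<comment> \<open>Extended by the identity on the last \<open>e\<close> directions, so that
      \<open>?S\<close> is fixed.\<close>
    let ?t = "\<lambda>x. if x \<in> ?L then \<sigma> x else x"
    have "bij_betw ?t ?L ?L" using \<sigma> by (subst bij_betw_cong[of ?L ?t \<sigma>]) auto
    moreover have "bij_betw ?t ?S ?S" by (subst bij_betw_cong[of ?S ?t id]) auto
    ultimately have "bij_betw ?t (?L \<union> ?S) (?L \<union> ?S)" by (rule bij_betw_combine) auto
    moreover have "?L \<union> ?S = {..<K}" by auto
    ultimately have t: "bij_betw ?t {..<K} {..<K}" by simp
    have "cg (\<rho> (?h (\<lambda>V. c (\<sigma> ` V)))) (\<rho> (\<lambda>V. ?h c (?t ` V)))"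
    proof (rule cocycle_cong[OF r fcub_smor[OF h[OF c] smor_bij[OF t]]])
      fix V assume V: "V \<subseteq> {..<K}"
      have mem: "?t x \<in> ?L \<longleftrightarrow> x \<in> ?L" for x using \<sigma> by (auto simp: bij_betw_def)
      have 1: "?t ` V \<inter> ?L = \<sigma> ` (V \<inter> ?L)"
      proof (intro set_eqI iffI)
        fix x assume "x \<in> ?t ` V \<inter> ?L"
        then obtain y where y: "y \<in> V" "x = ?t y" "?t y \<in> ?L" by blast
        then have "y \<in> ?L" using mem by blast
        then show "x \<in> \<sigma> ` (V \<inter> ?L)" using y by auto
      next
        fix x assume "x \<in> \<sigma> ` (V \<inter> ?L)"
        then obtain y where y: "y \<in> V" "y \<in> ?L" "x = \<sigma> y" by blast
        then have "x = ?t y" "?t y \<in> ?L" using mem[of y] by simp_all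
        then show "x \<in> ?t ` V \<inter> ?L" using y(1) by blast
      qed
      have 2: "?S \<subseteq> ?t ` V \<longleftrightarrow> ?S \<subseteq> V"
      proof
        assume L: "?S \<subseteq> ?t ` V"
        show "?S \<subseteq> V"
        proof
          fix x assume x: "x \<in> ?S"
          then obtain y where y: "y \<in> V" "x = ?t y" using L by blast
          then have "y \<notin> ?L" using mem[of y] x by auto
          then show "x \<in> V" using y by simp
        qed
      next
        assume L: "?S \<subseteq> V"
        show "?S \<subseteq> ?t ` V"
        proof
          fix x assume x: "x \<in> ?S"
          then have "x = ?t x" by simp
          then show "x \<in> ?t ` V" using L x by blast
        qed
      qed
      show "?h c (?t ` V) = ?h (\<lambda>V. c (\<sigma> ` V)) V" by (simp only: addm_def 1 2)
    qed
    also have "cg \<dots> (\<rho> (?h c))" by (rule cocycle_perm[OF r h[OF c] t])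
    finally show ?thesis .
  qed
  show "cg (\<rho> (?h (\<lambda>V. c (flip {i} V)))) (- \<rho> (?h c))" if i: "i < K - e" for i
  proof -
    have "?h (\<lambda>V. c (flip {i} V)) = (\<lambda>V. ?h c (flip {i} V))"
    proof
      fix V
      have "flip {i} V \<inter> ?L = flip {i} (V \<inter> ?L)" "?S \<subseteq> flip {i} V \<longleftrightarrow> ?S \<subseteq> V"
        using i by (auto simp: flip_def)
      then show "?h (\<lambda>V. c (flip {i} V)) V = ?h c (flip {i} V)" by (simp add: addm_def)
    qed
    then show ?thesis using cocycle_flip[OF r h[OF c], of i] i by simp
  qed
  fix c' i assume c': "fcub J d (K - e) c'" and i: "i < K - e"
    and glue: "\<And>V. V \<subseteq> ?L \<Longrightarrow> c (insert i V) = c' (V - {i})"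
    and cc: "fcub J d (K - e) (\<lambda>V. if i \<in> V then c' V else c V)"
  have eq: "?h (\<lambda>V. if i \<in> V then c' V else c V) = (\<lambda>V. if i \<in> V then ?h c' V else ?h c V)"
    using i by (auto simp: addm_def fun_eq_iff)
  show "cg (\<rho> (?h (\<lambda>V. if i \<in> V then c' V else c V))) (\<rho> (?h c) + \<rho> (?h c'))"
    unfolding eq
  proof (rule cocycle_concat[OF r h[OF c] h[OF c']])
    show "i < K" using i by simp
    show "fcub J d K (\<lambda>V. if i \<in> V then ?h c' V else ?h c V)" using h[OF cc] unfolding eq .
    fix V
    have "insert i V \<inter> ?L = insert i (V \<inter> ?L)" "(V - {i}) \<inter> ?L = V \<inter> ?L - {i}"
      "?S \<subseteq> insert i V \<longleftrightarrow> ?S \<subseteq> V" "?S \<subseteq> V - {i} \<longleftrightarrow> ?S \<subseteq> V" using i by auto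
    then show "?h c (insert i V) = ?h c' (V - {i})" using glue[of "V \<inter> ?L"] by (simp add: addm_def)
  qed
qed

text \<open>The outer induction is on the dimension, the inner one on the coordinates. The primitive
  is \<open>f1 + f2\<close>: \<open>f1\<close> makes the cocycle vanish where coordinate
  \<open>j\<close> is 0, and \<open>f2\<close> makes it insensitive to that coordinate, so that
  nothing remains.\<close>

theorem cocycle_is_coboundary:
  fixes J :: "'j set"
  assumes "finite J" "\<forall>j\<in>J. 1 \<le> d j" "cocycle J d K \<rho>"
  shows "\<exists>f. (\<forall>x. f x \<in> H1) \<and> (\<forall>c. fcub J d K c \<longrightarrow> cg (\<rho> c) (alt K (\<lambda>V. f (c V))))"
  using assms
proof (induction K arbitrary: J \<rho> rule: less_induct)
  case (less K)
  show ?case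
  proof (cases "K = 0")
    case True
    \<comment> \<open>A 0-cube is a point and its alternating sum is the value there, so the cocycle
      is its own primitive.\<close>
    define f where "f x = (if fcub J d K (\<lambda>V. x) then \<rho> (\<lambda>V. x) else 0)" for x
    have "cg (\<rho> c) (alt K (\<lambda>V. f (c V)))" if c: "fcub J d K c" for c
    proof -
      have c0: "fcub J d K (\<lambda>V. c {})" by (rule fcub_cong[OF c]) (simp add: True)
      have "cg (\<rho> c) (\<rho> (\<lambda>V. c {}))"
        by (rule cocycle_cong[OF less(4) c0]) (simp add: True)
      then show ?thesis using c0 by (simp add: True alt_def sg_def f_def)
    qed
    moreover have "f x \<in> H1" for x
      using cocycle_mem[OF less(4)] H1 by (simp add: f_def subgp_0)
    ultimately show ?thesis by blast
  next
    case K: False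
    from less(2-4) show ?thesis
    proof (induction J arbitrary: \<rho>)
      case empty
      have z: "c V = (\<lambda>j. 0)" if "fcub {} d K c" "V \<subseteq> {..<K}" for c :: "nat set \<Rightarrow> 'j \<Rightarrow> int" and V
        using that by (auto simp: fcub_def)
      have "cg (\<rho> c) 0" if c: "fcub {} d K c" for c
      proof -
        have c0: "fcub {} d K (\<lambda>V j. 0 :: int)" by (simp add: fcub_def)
        have "cg (\<rho> c) (\<rho> (\<lambda>V j. 0))" by (rule cocycle_cong[OF empty(2) c0]) (simp add: z[OF c])
        also have "cg \<dots> 0" by (rule cocycle_degenerate[OF empty(2) c0, of 0]) (use K in auto)
        finally show ?thesis .
      qed
      then show ?case using H1 by (intro exI[of _ "\<lambda>x. 0"]) (simp add: subgp_0)
    next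
      case (insert j J)
      let ?J = "insert j J"
      have d: "\<forall>j\<in>J. 1 \<le> d j" "1 \<le> d j" using insert by auto
      have "cocycle J d K \<rho>"
        by (rule cocycle_restrict[OF insert(5)])
      from insert(3)[OF d(1) this] obtain f0 where f0: "\<And>x. f0 x \<in> H1"
        "\<And>c. fcub J d K c \<Longrightarrow> cg (\<rho> c) (alt K (\<lambda>V. f0 (c V)))" by blast
      \<comment> \<open>Ignores coordinate \<open>j\<close>, which extends the primitive known for
        \<open>J\<close> without changing it where that coordinate is 0.\<close>
      define f1 where "f1 x = f0 (x(j := 0))" for x
      define \<rho>1 where "\<rho>1 c = \<rho> c - alt K (\<lambda>V. f1 (c V))" for c
      have r1: "cocycle ?J d K \<rho>1" unfolding \<rho>1_def
        by (intro cocycle_diff insert(5) cocycle_coboundary subgp_alt[OF H1]) (simp add: f1_def f0(1))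
      have z1: "cg (\<rho>1 c) 0" if c: "fcub J d K c" for c
      proof -
        have "c V j = 0" if "V \<subseteq> {..<K}" for V using c that insert(2) by (simp add: fcub_def)
        then have "f1 (c V) = f0 (c V)" if "V \<subseteq> {..<K}" for V using that by (simp add: f1_def fun_upd_idem)
        then have "\<rho>1 c = \<rho> c - alt K (\<lambda>V. f0 (c V))" unfolding \<rho>1_def by (simp cong: alt_cong)
        then show ?thesis using f0(2)[OF c] by (simp add: cg_def)
      qed
      \<comment> \<open>Monomials on a \<open>K\<close>-cube have degree at most \<open>K\<close>,
        whatever \<open>d j\<close> is; \<open>e \<ge> 1\<close> makes the dimension
        \<open>K - e\<close> smaller.\<close>
      define e where "e = min (d j) K"
      have e: "1 \<le> e" "e \<le> d j" "e \<le> K" using d(2) K by (auto simp: e_def)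
      let ?S = "{K - e..<K}" and ?L = "{..<K - e}"
      let ?h = "\<lambda>c. addm j ?S 1 (\<lambda>V. c (V \<inter> ?L))"
      have S: "?S \<subseteq> {..<K}" "card ?S = e" "?S \<noteq> {}" using e by auto
      have "cocycle ?J d (K - e) (\<lambda>c. \<rho>1 (?h c))" by (rule cocycle_hat[OF r1 _ e(2,3)]) simp
      moreover have "K - e < K" using e by simp
      ultimately obtain g where g: "\<And>x. g x \<in> H1"
        "\<And>c. fcub ?J d (K - e) c \<Longrightarrow> cg (\<rho>1 (?h c)) (alt (K - e) (\<lambda>V. g (c V)))"
        using less(1)[of "K - e" ?J "\<lambda>c. \<rho>1 (?h c)"] insert by blast
      \<comment> \<open>Cancels the sign that \<open>alt_top\<close> produces.\<close>
      define g' where "g' x = (if even e then g x else - g x)" for x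
      \<comment> \<open>Its difference in coordinate \<open>j\<close> is \<open>g'\<close>, and it
        vanishes where that coordinate is 0, so the normalisation reached with \<open>f1\<close>
        survives.\<close>
      define f2 where "f2 x = isum (\<lambda>n. g' (x(j := n))) (x j)" for x
      have f2H: "f2 x \<in> H1" for x unfolding f2_def g'_def
        using g(1) by (intro subgp_isum[OF H1]) (auto intro: subgp_minus[OF H1])
      have f2_step: "f2 (x(j := x j + 1)) = f2 x + g' x" for x
        by (simp add: f2_def isum_succ)
      define \<rho>2 where "\<rho>2 c = \<rho>1 c - alt K (\<lambda>V. f2 (c V))" for c
      have r2: "cocycle ?J d K \<rho>2" unfolding \<rho>2_def
        by (intro cocycle_diff r1 cocycle_coboundary subgp_alt[OF H1] f2H)
      have z2: "cg (\<rho>2 c) 0" if c: "fcub J d K c" for c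
      proof -
        have "c V j = 0" if "V \<subseteq> {..<K}" for V using c that insert(2) by (simp add: fcub_def)
        then have "f2 (c V) = 0" if "V \<subseteq> {..<K}" for V using that by (simp add: f2_def)
        then have "alt K (\<lambda>V. f2 (c V)) = alt K (\<lambda>V. 0)" by (intro alt_cong) simp
        then show ?thesis using z1[OF c] by (simp add: \<rho>2_def)
      qed
      have h2: "cg (\<rho>2 (?h c)) 0" if c: "fcub ?J d (K - e) c" for c
      proof -
        have "f2 (?h c V) = f2 (c (V \<inter> ?L)) + (if ?S \<subseteq> V then g' (c (V \<inter> ?L)) else 0)" for V
          using f2_step by (simp add: addm_def)
        then have "alt K (\<lambda>V. f2 (?h c V)) = alt K (\<lambda>V. f2 (c (V \<inter> ?L)))
            + alt K (\<lambda>V. if ?S \<subseteq> V then g' (c (V \<inter> ?L)) else 0)" by (simp add: alt_add)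
        also have "alt K (\<lambda>V. f2 (c (V \<inter> ?L))) = 0"
        proof (rule alt_indep[of "K - 1"])
          fix V assume "V \<subseteq> {..<K} - {K - 1}"
          have "insert (K - 1) V \<inter> ?L = V \<inter> ?L" using e by auto
          then show "f2 (c (insert (K - 1) V \<inter> ?L)) = f2 (c (V \<inter> ?L))" by simp
        qed (use K in simp)
        also have "alt K (\<lambda>V. if ?S \<subseteq> V then g' (c (V \<inter> ?L)) else 0) = alt (K - e) (\<lambda>V. g (c V))"
          using alt_top[OF e(3), of "\<lambda>V. g' (c V)"] by (auto simp: g'_def alt_minus)
        finally have "\<rho>2 (?h c) = \<rho>1 (?h c) - alt (K - e) (\<lambda>V. g (c V))" by (simp add: \<rho>2_def)
        then show ?thesis using g(2)[OF c] by (simp add: cg_def)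
      qed
      \<comment> \<open>By \<open>cocycle_addm\<close> the change is the value on the cube frozen at
        1 along \<open>?S\<close> with the monomial added. That cube is of the kind treated in
        \<open>h2\<close>.\<close>
      have inv: "cg (\<rho>2 (addm j ?S 1 c)) (\<rho>2 c)" if c: "fcub ?J d K c" for c
      proof -
        let ?c = "\<lambda>V. c (V \<union> ?S)"
        have "smor (K - e) K (\<lambda>V. id ` V \<union> ?S)" by (rule smor_image) auto
        from fcub_smor[OF c this] have c1: "fcub ?J d (K - e) ?c" by simp
        have eq: "(V \<inter> ?L) \<union> ?S = V \<union> ?S" if "V \<subseteq> {..<K}" for V using that by auto
        have "cg (\<rho>2 (?h ?c)) (\<rho>2 (addm j ?S 1 ?c))"
          by (rule cocycle_cong[OF r2]) (use S e in \<open>auto simp: addm_def eq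
              intro!: fcub_addm fcub_smor[OF c smor_Un]\<close>)
        then have "cg (\<rho>2 (addm j ?S 1 ?c)) 0" using h2[OF c1] cg_sym cg_trans by blast
        from cg_add[OF cg_refl[of "\<rho>2 c"] this]
        show ?thesis using cocycle_addm[OF r2 c S(1,3), of j 1] S(2) e cg_trans by auto
      qed
      have "cg (\<rho> c) (alt K (\<lambda>V. f1 (c V) + f2 (c V)))" if c: "fcub ?J d K c" for c
      proof -
        have "cg (\<rho>2 c) (\<rho>2 (\<lambda>V. (c V)(j := 0)))"
        proof (rule cocycle_zero_coord[OF r2 _ _ c])
          fix S t c assume SS: "S \<subseteq> {..<K}" "card S \<le> d j" and c: "fcub ?J d K c"
          have "card S \<le> K" using card_mono[OF _ SS(1)] by simp
          then have "card S \<le> e" using SS(2) by (simp add: e_def)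
          then show "cg (\<rho>2 (addm j S t c)) (\<rho>2 c)"
            using cocycle_invariant[OF r2 _ e(2,3) S(1,2) inv SS(1) _ c] by simp
        qed simp
        also have "cg \<dots> 0" by (rule z2[OF fcub_zero_coord[OF c insert(2)]])
        finally have "\<rho>2 c - 0 \<in> H0" by (simp only: cg_def)
        then show ?thesis by (simp add: cg_def \<rho>2_def \<rho>1_def alt_add algebra_simps)
      qed
      moreover have "f1 x + f2 x \<in> H1" for x
        using f0(1) f2H by (intro subgp_add[OF H1]) (simp add: f1_def)
      ultimately show ?case by (intro exI[of _ "\<lambda>x. f1 x + f2 x"]) blast
    qed
  qed
qed

end

section \<open>Free nilspaces and linear cubes\<close>

lemma is_cubespaceI:
  assumes sub: "\<And>n. cubes X n \<subseteq> cmaps (carr X) n"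
    and smor: "\<And>n m M c. smor n m M \<Longrightarrow> cub X m c \<Longrightarrow> cub X n (\<lambda>V. c (M V))"
  shows "is_cubespace X"
  unfolding is_cubespace_def
proof (intro conjI allI impI)
  fix n m \<psi> f assume p: "cube_morphism n m \<psi>" and f: "f \<in> cubes X m"
  have "f \<in> extensional (vert m)" using f sub by (auto simp: cmaps_def)
  then have "cub X m (\<lambda>V. f (vlist m V))" using f by (simp add: cub_vlist)
  from smor[OF cube_morphism_imp_smor[OF p] this]
  have "restrict (\<lambda>v. f (vlist m (vset (\<psi> (vlist n (vset v)))))) (vert n) \<in> cubes X n"
    by (simp add: cub_def)
  moreover have "restrict (\<lambda>v. f (vlist m (vset (\<psi> (vlist n (vset v)))))) (vert n) = restrict (f \<circ> \<psi>) (vert n)"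
    using p by (auto simp: fun_eq_iff cube_morphism_def vert_def vlist_vset)
  ultimately show "restrict (f \<circ> \<psi>) (vert n) \<in> cubes X n" by simp
qed (rule sub)

lemma cmaps_restrict: "restrict (\<lambda>v. c (vset v)) (vert n) \<in> cmaps S n \<longleftrightarrow> (\<forall>V\<subseteq>{..<n}. c V \<in> S)"
proof
  assume L: "restrict (\<lambda>v. c (vset v)) (vert n) \<in> cmaps S n"
  show "\<forall>V\<subseteq>{..<n}. c V \<in> S"
  proof (intro allI impI)
    fix V assume V: "V \<subseteq> {..<n}"
    have "restrict (\<lambda>v. c (vset v)) (vert n) (vlist n V) \<in> S" using L unfolding cmaps_def Pi_def by auto
    then show "c V \<in> S" using V by (simp add: vset_vlist Int_absorb2)
  qed
next
  assume "\<forall>V\<subseteq>{..<n}. c V \<in> S"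
  then show "restrict (\<lambda>v. c (vset v)) (vert n) \<in> cmaps S n"
    using vset_subset by (auto simp: cmaps_def)
qed

lemma sum_vert_alt:
  "(\<Sum>v\<in>vert K. if even (length (filter id v)) then g v else - g v) = alt K (\<lambda>V. g (vlist K V))"
proof -
  have "(\<Sum>v\<in>vert K. if even (length (filter id v)) then g v else - g v)
      = (\<Sum>v\<in>vert K. sg (vset v) (g (vlist K (vset v))))"
  proof (rule sum.cong)
    fix v assume "v \<in> vert K"
    then have "vlist K (vset v) = v" by (simp add: vert_def vlist_vset)
    moreover have "card (vset v) = length (filter id v)" by (simp add: vset_def length_filter_conv_card)
    ultimately show "(if even (length (filter id v)) then g v else - g v) = sg (vset v) (g (vlist K (vset v)))"
      by (simp add: sg_def)
  qed simp
  also have "\<dots> = alt K (\<lambda>V. g (vlist K V))"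
    unfolding alt_def by (rule sum.reindex_bij_betw[OF bij_vset])
  finally show ?thesis .
qed

lemma cub_Dk: "cub (Dk d G) n f \<longleftrightarrow> (\<forall>V\<subseteq>{..<n}. f V \<in> G) \<and> polyd d n f"
proof -
  let ?r = "restrict (\<lambda>v. f (vset v)) (vert n)"
  have "(\<forall>\<psi>. cube_morphism (d + 1) n \<psi> \<longrightarrow>
      (\<Sum>v\<in>vert (d + 1). if even (length (filter id v)) then ?r (\<psi> v) else - ?r (\<psi> v)) = 0) \<longleftrightarrow> polyd d n f"
    (is "?L \<longleftrightarrow> _")
  proof
    assume L: ?L
    show "polyd d n f" unfolding polyd_def
    proof (intro allI impI)
      fix M assume M: "smor (Suc d) n M"
      have "0 = alt (Suc d) (\<lambda>V. ?r (vlist n (M (vset (vlist (Suc d) V)))))"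
        using L smor_imp_cube_morphism[OF M]
          sum_vert_alt[where K = "Suc d" and g = "\<lambda>v. ?r (vlist n (M (vset v)))"] by simp
      also have "\<dots> = alt (Suc d) (\<lambda>V. f (M V))"
      proof (rule alt_cong)
        fix V assume "V \<subseteq> {..<Suc d}"
        moreover from this have "M V \<subseteq> {..<n}" using M by (simp add: smor_def)
        ultimately show "?r (vlist n (M (vset (vlist (Suc d) V)))) = f (M V)"
          by (simp add: vset_vlist Int_absorb2)
      qed
      finally show "alt (Suc d) (\<lambda>V. f (M V)) = 0" by simp
    qed
  next
    assume R: "polyd d n f"
    show ?L
    proof (intro allI impI)
      fix \<psi> assume p: "cube_morphism (d + 1) n \<psi>"
      have "\<psi> (vlist (Suc d) V) \<in> vert n" for V
        using p vlist_vert[of "Suc d" V] by (auto simp: cube_morphism_def vert_def)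
      then have "alt (Suc d) (\<lambda>V. ?r (\<psi> (vlist (Suc d) V))) = 0"
        using R cube_morphism_imp_smor[OF p] by (simp add: polyd_def)
      then show "(\<Sum>v\<in>vert (d + 1). if even (length (filter id v)) then ?r (\<psi> v) else - ?r (\<psi> v)) = 0"
        using sum_vert_alt[where K = "Suc d" and g = "\<lambda>v. ?r (\<psi> v)"] by simp
    qed
  qed
  then show ?thesis using cmaps_restrict[of f n G] by (simp add: cub_def Dk_def)
qed

lemma carr_free: "carr (free_nilspace k a) = PiE {1..k} (\<lambda>i. Zvec (a i))"
  by (simp add: free_nilspace_def prod_cs_def Dk_def)

lemma cub_free:
  "cub (free_nilspace k a) n c \<longleftrightarrow> (\<forall>V\<subseteq>{..<n}. c V \<in> carr (free_nilspace k a)) \<and>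
     (\<forall>i\<in>{1..k}. polyd i n (\<lambda>V. c V i))"
proof -
  let ?r = "restrict (\<lambda>v. c (vset v)) (vert n)"
  have "restrict (\<lambda>v. ?r v i) (vert n) = restrict (\<lambda>v. c (vset v) i) (vert n)" for i
    by (intro restrict_ext) simp
  then have "cub (free_nilspace k a) n c \<longleftrightarrow> ?r \<in> cmaps (carr (free_nilspace k a)) n \<and>
     (\<forall>i\<in>{1..k}. cub (Dk i (Zvec (a i))) n (\<lambda>V. c V i))"
    by (simp add: cub_def free_nilspace_def prod_cs_def)
  also have "\<dots> \<longleftrightarrow> (\<forall>V\<subseteq>{..<n}. c V \<in> carr (free_nilspace k a)) \<and>
     (\<forall>i\<in>{1..k}. polyd i n (\<lambda>V. c V i))"
    by (auto simp: cmaps_restrict cub_Dk carr_free)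
  finally show ?thesis .
qed

lemma cubespace_free: "is_cubespace (free_nilspace k a)"
proof (rule is_cubespaceI)
  show "cubes (free_nilspace k a) n \<subseteq> cmaps (carr (free_nilspace k a)) n" for n
    by (auto simp: free_nilspace_def prod_cs_def)
  show "cub (free_nilspace k a) n (\<lambda>V. c (M V))"
    if M: "smor n m M" and c: "cub (free_nilspace k a) m c" for n m M c
    unfolding cub_free
  proof (intro conjI allI impI ballI)
    fix V assume "V \<subseteq> {..<n}"
    then have "M V \<subseteq> {..<m}" using M by (simp add: smor_def)
    then show "c (M V) \<in> carr (free_nilspace k a)" using c by (simp add: cub_free)
  next
    fix i assume "i \<in> {1..k}"
    then have "polyd i m (\<lambda>V. c V i)" using c by (simp add: cub_free)
    then show "polyd i n (\<lambda>V. c (M V) i)" by (rule polyd_smor[OF _ M])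
  qed
qed

lemma polyd_const: "polyd d n (\<lambda>V. x)"
  using polyd_monom[of "{}" n d x] by simp

lemma polyd_sum: "(\<And>i. i \<in> I \<Longrightarrow> polyd d n (p i)) \<Longrightarrow> polyd d n (\<lambda>V. \<Sum>i\<in>I. p i V)"
  by (induction I rule: infinite_finite_induct) (auto simp: polyd_zero intro: polyd_add)

lemma sum_apply: "(\<Sum>i\<in>I. f i) j = (\<Sum>i\<in>I. f i j)"
  by (induction I rule: infinite_finite_induct) simp_all

lemma sg_apply: "sg V x j = sg V (x j)"
  by (simp add: sg_def)

lemma alt_apply: "alt K f j = alt K (\<lambda>V. f V j)"
  by (simp add: alt_def sum_apply sg_apply)

lemma polyd_apply: "polyd d n p \<longleftrightarrow> (\<forall>j. polyd d n (\<lambda>V. p V j))"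
  unfolding polyd_def by (auto simp: fun_eq_iff alt_apply)

text \<open>Affine means of degree at most 1 in each coordinate. Hence the coboundary theorem
  applies to \<open>\<int>^n\<close> with all degrees equal to 1.\<close>

lemma cub_Zlin: "cub (Zlin n) K c \<longleftrightarrow> fcub {..<n} (\<lambda>_. 1) K c"
proof
  assume "cub (Zlin n) K c"
  then obtain b g where cm: "\<And>V. V \<subseteq> {..<K} \<Longrightarrow> c V \<in> Zvec n"
    and e: "\<And>v. v \<in> vert K \<Longrightarrow> c (vset v) = b + (\<Sum>i\<in>{i. i < K \<and> v ! i}. g i)"
    unfolding cub_def lin_cs_def by (auto simp: cmaps_restrict)
  have cV: "c V = b + (\<Sum>i\<in>{..<K}. if {i} \<subseteq> V then g i else 0)" if V: "V \<subseteq> {..<K}" for V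
  proof -
    have "{i. i < K \<and> vlist K V ! i} = V" using V by (auto simp: vlist_def)
    then have "c V = b + sum g V" using e[of "vlist K V"] V by (simp add: vset_vlist Int_absorb2)
    also have "sum g V = (\<Sum>i\<in>{..<K}. if {i} \<subseteq> V then g i else 0)"
      by (rule sum.mono_neutral_cong_left) (use V in auto)
    finally show ?thesis .
  qed
  have "polyd 1 K (\<lambda>V. c V j)" for j
  proof -
    have "polyd 1 K (\<lambda>V. b + (\<Sum>i\<in>{..<K}. if {i} \<subseteq> V then g i else 0))"
      by (intro polyd_add polyd_const polyd_sum polyd_monom) auto
    then have "polyd 1 K c" by (rule polyd_cong) (simp only: cV)
    then show ?thesis unfolding polyd_apply[of 1 K c] by blast
  qed
  then show "fcub {..<n} (\<lambda>_. 1) K c" using cm by (auto simp: fcub_def Zvec_def)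
next
  assume c: "fcub {..<n} (\<lambda>_. 1) K c"
  have "\<exists>a. \<forall>V\<subseteq>{..<K}. c V j = a {} + (\<Sum>i\<in>V. a {i})" if "j < n" for j
  proof -
    have "polyd 1 K (\<lambda>V. c V j)" using c that by (simp add: fcub_def)
    then obtain a where a: "\<And>V. V \<subseteq> {..<K} \<Longrightarrow>
        c V j = (\<Sum>T | T \<subseteq> {..<K} \<and> card T \<le> 1. if T \<subseteq> V then a T else 0)"
      by (rule polyd_expand) blast
    have T: "{T. T \<subseteq> {..<K} \<and> card T \<le> 1} = insert {} ((\<lambda>i. {i}) ` {..<K})"
    proof (intro set_eqI iffI)
      fix T assume T: "T \<in> {T. T \<subseteq> {..<K} \<and> card T \<le> 1}"
      then have "finite T" using finite_subset[of T "{..<K}"] by auto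
      moreover have "card T = 0 \<or> card T = 1" using T by auto
      ultimately show "T \<in> insert {} ((\<lambda>i. {i}) ` {..<K})" using T by (auto simp: card_1_singleton_iff)
    qed auto
    have "c V j = a {} + (\<Sum>i\<in>V. a {i})" if V: "V \<subseteq> {..<K}" for V
    proof -
      have "c V j = a {} + (\<Sum>T\<in>(\<lambda>i. {i}) ` {..<K}. if T \<subseteq> V then a T else 0)"
        unfolding a[OF V] T by (subst sum.insert) auto
      also have "(\<Sum>T\<in>(\<lambda>i. {i}) ` {..<K}. if T \<subseteq> V then a T else 0)
          = (\<Sum>i\<in>{..<K}. if i \<in> V then a {i} else 0)"
        by (subst sum.reindex) auto
      also have "\<dots> = (\<Sum>i\<in>V. a {i})"
        by (rule sum.mono_neutral_cong_right) (use V in auto)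
      finally show ?thesis .
    qed
    then show ?thesis by blast
  qed
  then obtain a where a: "\<And>j V. j < n \<Longrightarrow> V \<subseteq> {..<K} \<Longrightarrow> c V j = a j {} + (\<Sum>i\<in>V. a j {i})"
    by metis
  let ?b = "\<lambda>j. if j < n then a j {} else 0"
  let ?g = "\<lambda>i j. if j < n then a j {i} else 0"
  have cV: "c V = ?b + sum ?g V" if "V \<subseteq> {..<K}" for V
  proof
    fix j show "c V j = (?b + sum ?g V) j"
      using a[of j V] c that by (cases "j < n") (auto simp: sum_apply fcub_def)
  qed
  have cm: "restrict (\<lambda>v. c (vset v)) (vert K) \<in> cmaps (Zvec n) K"
    using c by (simp add: cmaps_restrict fcub_def Zvec_def)
  have "?b \<in> Zvec n" "\<forall>i<K. ?g i \<in> Zvec n" by (auto simp: Zvec_def)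
  moreover have "\<forall>v\<in>vert K. restrict (\<lambda>v. c (vset v)) (vert K) v = ?b + sum ?g {i. i < K \<and> v ! i}"
  proof
    fix v assume v: "v \<in> vert K"
    then have "{i. i < K \<and> v ! i} = vset v" by (auto simp: vset_def vert_def)
    then show "restrict (\<lambda>v. c (vset v)) (vert K) v = ?b + sum ?g {i. i < K \<and> v ! i}"
      using v cV[OF vset_subset[OF v]] by simp
  qed
  ultimately have "\<exists>b\<in>Zvec n. \<exists>g. (\<forall>i<K. g i \<in> Zvec n) \<and>
      (\<forall>v\<in>vert K. restrict (\<lambda>v. c (vset v)) (vert K) v = b + sum g {i. i < K \<and> v ! i})"
    by (intro bexI[of _ ?b] exI[of _ ?g] conjI)
  then show "cub (Zlin n) K c" using cm unfolding cub_def lin_cs_def by simp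
qed

lemma cubespace_Zlin: "is_cubespace (Zlin n)"
proof (rule is_cubespaceI)
  show "cubes (Zlin n) l \<subseteq> cmaps (carr (Zlin n)) l" for l by (auto simp: lin_cs_def)
  show "cub (Zlin n) l (\<lambda>V. c (M V))" if "smor l m M" "cub (Zlin n) m c" for l m M c
    using that fcub_smor by (simp add: cub_Zlin)
qed

text \<open>Flattens the product to one integer coordinate for each pair, whose first component is
  the degree.\<close>

definition free_index :: "nat \<Rightarrow> (nat \<Rightarrow> nat) \<Rightarrow> (nat \<times> nat) set" where
  "free_index k a = (SIGMA i:{1..k}. {..<a i})"

text \<open>Points of the product are \<open>undefined\<close> outside \<open>{1..k}\<close>, while
  \<open>fcub\<close> wants 0 there; \<open>enc\<close> and \<open>dec\<close> exchange the two
  conventions.\<close>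

definition enc :: "nat \<Rightarrow> (nat \<Rightarrow> nat \<Rightarrow> int) \<Rightarrow> nat \<times> nat \<Rightarrow> int" where
  "enc k x p = (if fst p \<in> {1..k} then x (fst p) (snd p) else 0)"

definition dec :: "nat \<Rightarrow> (nat \<times> nat \<Rightarrow> int) \<Rightarrow> nat \<Rightarrow> nat \<Rightarrow> int" where
  "dec k y = (\<lambda>i\<in>{1..k}. \<lambda>j. y (i, j))"

lemma dec_enc: "x \<in> carr (free_nilspace k a) \<Longrightarrow> dec k (enc k x) = x"
  by (auto simp: carr_free dec_def enc_def fun_eq_iff PiE_def extensional_def)

lemma fcub_enc:
  assumes "cub (free_nilspace k a) n c"
  shows "fcub (free_index k a) fst n (\<lambda>V. enc k (c V))"
proof -
  have p: "\<And>i. i \<in> {1..k} \<Longrightarrow> polyd i n (\<lambda>V. c V i)"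
    and m: "\<And>V. V \<subseteq> {..<n} \<Longrightarrow> c V \<in> PiE {1..k} (\<lambda>i. Zvec (a i))"
    using assms by (auto simp: cub_free carr_free)
  have "polyd i n (\<lambda>V. c V i j)" if "i \<in> {1..k}" for i j
    using p[OF that] unfolding polyd_apply[of i n "\<lambda>V. c V i"] by blast
  moreover have "c V i j = 0" if "i \<in> {1..k}" "\<not> j < a i" "V \<subseteq> {..<n}" for V i j
    using PiE_mem[OF m[OF that(3)] that(1)] that(2) by (simp add: Zvec_def)
  ultimately show ?thesis by (auto simp: fcub_def free_index_def enc_def)
qed

lemma cub_dec:
  assumes "fcub (free_index k a) fst n c"
  shows "cub (free_nilspace k a) n (\<lambda>V. dec k (c V))"
  unfolding cub_free
proof (intro conjI allI ballI impI)
  fix V assume "V \<subseteq> {..<n}"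
  then show "dec k (c V) \<in> carr (free_nilspace k a)"
    using assms by (auto simp: carr_free dec_def Zvec_def fcub_def free_index_def)
next
  fix i assume i: "i \<in> {1..k}"
  have "polyd i n (\<lambda>V. c V (i, j))" for j
  proof (cases "j < a i")
    case True
    then have "(i, j) \<in> free_index k a" using i by (simp add: free_index_def)
    then show ?thesis using assms by (auto simp: fcub_def)
  next
    case False
    then have "(i, j) \<notin> free_index k a" by (simp add: free_index_def)
    then show ?thesis using assms
      by (intro polyd_cong[OF polyd_zero[of i n]]) (simp add: fcub_def)
  qed
  then have "polyd i n (\<lambda>V j. c V (i, j))" unfolding polyd_apply[of i n "\<lambda>V j. c V (i, j)"] by blast
  then show "polyd i n (\<lambda>V. dec k (c V) i)" using i by (simp add: dec_def)
qed

section \<open>Lifting through the quotient\<close>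

lemma subgp_Zvec: "subgp (Zvec m)"
  by (auto simp: subgp_def Zvec_def)

context kaction
begin

lemma subgp_stab: "subgp stab"
  unfolding subgp_def using stab_0 stab_add stab_minus by (metis add_uminus_conv_diff)

lemma subgp_Zstab: "subgp (Zvec m \<inter> stab)"
  using subgp_Zvec[of m] subgp_stab by (simp add: subgp_def)

lemma coefficients_stab: "coefficients (Zvec m) (Zvec m \<inter> stab)"
  by (simp add: coefficients_def subgp_Zvec subgp_Zstab)

text \<open>A lift of a map \<open>h'\<close> into the quotient is corrected cube by cube; the total
  correction of a \<open>(k+1)\<close>-cube is a cocycle, and a primitive of it corrects pointwise.\<close>
lemma lift_exists:
  assumes h': "cs_morphism (free_nilspace l a) quot h'"
  obtains f where "\<And>x. f x \<in> Zvec m"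
    "\<And>c. cub (free_nilspace l a) (Suc k) c \<Longrightarrow> cub N (Suc k) (\<lambda>V. act (f (c V)) (h' (c V)))"
proof -
  interpret C: coefficients "Zvec m" "Zvec m \<inter> stab" by (rule coefficients_stab)
  let ?K = "Suc k"
  let ?J = "free_index l a"
  \<comment> \<open>\<open>t\<close> corrects the image of \<open>c\<close> to a cube of
    \<open>N\<close>. It has to lie in \<open>Zvec m\<close> also at sets that are no vertices,
    where 0 is the default.\<close>
  define P where "P c t \<longleftrightarrow> (\<forall>V. t V \<in> Zvec m) \<and> cub N ?K (\<lambda>V. act (t V) (h' (dec l (c V))))" for c t
  define \<rho> where "\<rho> c = alt ?K (SOME t. P c t)" for c
  have exP: "\<exists>t. P c t" if c: "fcub ?J fst ?K c" for c
  proof -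
    have "cub quot ?K (\<lambda>V. h' (dec l (c V)))" by (rule cs_morphism_cub[OF h' cub_dec[OF c]])
    from cub_quot[THEN iffD1, OF this]
    obtain b where b: "cub N ?K b" "\<And>V. V \<subseteq> {..<?K} \<Longrightarrow> h' (dec l (c V)) = rep (b V)" by auto
    have "\<exists>t. t \<in> Zvec m \<and> (V \<subseteq> {..<?K} \<longrightarrow> act t (h' (dec l (c V))) = b V)" for V
    proof (cases "V \<subseteq> {..<?K}")
      case True
      have "rel (h' (dec l (c V))) (b V)"
        unfolding b(2)[OF True] by (rule rel_sym[OF rel_rep[OF carr_cub[OF b(1) True]]])
      then show ?thesis using act_trans by blast
    next
      case False
      then show ?thesis using subgp_0[OF subgp_Zvec] by blast
    qed
    then obtain t where t: "\<And>V. t V \<in> Zvec m" "\<And>V. V \<subseteq> {..<?K} \<Longrightarrow> act (t V) (h' (dec l (c V))) = b V"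
      by metis
    have "P c t" unfolding P_def using t(1) by (intro conjI allI cub_cong[OF b(1)]) (simp_all add: t(2))
    then show ?thesis by blast
  qed
  \<comment> \<open>Two corrections of the same cube differ by a shift between cubes, so
    \<open>act_cub_iff\<close> makes the obstruction independent of the choice modulo
    \<open>stab\<close>.\<close>
  have char: "C.cg (\<rho> c) (alt ?K t)" if "P c t" for c t
  proof -
    define s where "s = (SOME t. P c t)"
    have s: "P c s" unfolding s_def by (rule someI[of "P c", OF that])
    have "cub N ?K (\<lambda>V. act (s V - t V) (act (t V) (h' (dec l (c V)))))"
      using s by (simp add: act_act P_def)
    then have "alt ?K (\<lambda>V. s V - t V) \<in> stab" using act_cub_iff that by (simp add: P_def)
    moreover have "alt ?K (\<lambda>V. s V - t V) \<in> Zvec m"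
      using s that by (intro subgp_alt subgp_diff subgp_Zvec) (simp_all add: P_def)
    ultimately show ?thesis by (simp add: C.cg_def \<rho>_def s_def alt_diff)
  qed
  have r: "C.cocycle ?J fst ?K \<rho>"
  proof (rule C.cocycleI)
    fix c assume c: "fcub ?J fst ?K c"
    obtain t where t: "P c t" using exP[OF c] by blast
    show "\<rho> c \<in> Zvec m" unfolding \<rho>_def using someI[of "P c", OF t]
      by (intro subgp_alt subgp_Zvec) (simp add: P_def)
    show "C.cg (\<rho> c') (\<rho> c)" if "\<And>V. V \<subseteq> {..<?K} \<Longrightarrow> c V = c' V" for c'
    proof -
      have "P c' t" using t unfolding P_def by (auto elim!: cub_cong simp: that)
      then show ?thesis using char[OF t] char C.cg_trans C.cg_sym by blast
    qed
    show "C.cg (\<rho> (\<lambda>V. c (\<sigma> ` V))) (\<rho> c)" if \<sigma>: "bij_betw \<sigma> {..<?K} {..<?K}" for \<sigma>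
    proof -
      have "P (\<lambda>V. c (\<sigma> ` V)) (\<lambda>V. t (\<sigma> ` V))"
        using t smor[OF smor_bij[OF \<sigma>]] by (auto simp: P_def)
      from char[OF this] have "C.cg (\<rho> (\<lambda>V. c (\<sigma> ` V))) (alt ?K t)" by (simp add: alt_bij[OF \<sigma>])
      then show ?thesis using C.cg_sym[OF char[OF t]] by (rule C.cg_trans)
    qed
    show "C.cg (\<rho> (\<lambda>V. c (flip {i} V))) (- \<rho> c)" if i: "i < ?K" for i
    proof -
      have "P (\<lambda>V. c (flip {i} V)) (\<lambda>V. t (flip {i} V))"
        using t smor[OF smor_flip[of "{i}" ?K]] i by (auto simp: P_def)
      from char[OF this] have "C.cg (\<rho> (\<lambda>V. c (flip {i} V))) (- alt ?K t)" by (simp add: alt_flip[OF i])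
      then show ?thesis using C.cg_minus[OF C.cg_sym[OF char[OF t]]] by (rule C.cg_trans)
    qed
    fix c' i assume c': "fcub ?J fst ?K c'" and i: "i < ?K"
      and glue: "\<And>V. V \<subseteq> {..<?K} \<Longrightarrow> c (insert i V) = c' (V - {i})"
    obtain t' where t': "P c' t'" using exP[OF c'] by blast
    \<comment> \<open>\<open>t\<close> and \<open>t'\<close> need not match on the common face.
      Their difference there, extended constantly in direction \<open>i\<close>, has alternating sum
      0 and may be added to \<open>t'\<close>, after which the corrections can be glued.\<close>
    define e where "e V = t (insert i V) - t' (V - {i})" for V
    let ?t = "\<lambda>V. e V + t' V"
    have "alt ?K e = 0" by (rule alt_indep[OF i]) (auto simp: e_def)
    then have "cub N ?K (\<lambda>V. act (e V) (act (t' V) (h' (dec l (c' V)))))"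
      using act_cub_iff[of "\<lambda>V. act (t' V) (h' (dec l (c' V)))" e] t' stab_0 by (simp add: P_def)
    moreover have "?t V \<in> Zvec m" for V
      unfolding e_def using t t' by (intro subgp_add subgp_diff subgp_Zvec) (simp_all add: P_def)
    ultimately have t'': "P c' ?t" by (simp add: P_def act_act)
    let ?u = "\<lambda>V. if i \<in> V then ?t V else t V"
    have tt: "?t (V - {i}) = t (insert i V)" for V by (simp add: e_def)
    have "cub N ?K (\<lambda>V. if i \<in> V then act (?t V) (h' (dec l (c' V))) else act (t V) (h' (dec l (c V))))"
    proof (rule cub_concat[OF _ _ i])
      show "cub N ?K (\<lambda>V. act (t V) (h' (dec l (c V))))"
        "cub N ?K (\<lambda>V. act (?t V) (h' (dec l (c' V))))" using t t'' by (simp_all only: P_def)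
      show "act (t (insert i V)) (h' (dec l (c (insert i V)))) = act (?t (V - {i})) (h' (dec l (c' (V - {i}))))"
        if "V \<subseteq> {..<?K}" for V unfolding tt glue[OF that] ..
    qed
    then have "cub N ?K (\<lambda>V. act (?u V) (h' (dec l (if i \<in> V then c' V else c V))))"
      by (rule cub_cong) simp
    moreover have "?u V \<in> Zvec m" for V using t t'' by (simp add: P_def)
    ultimately have "P (\<lambda>V. if i \<in> V then c' V else c V) ?u" by (simp only: P_def simp_thms)
    from char[OF this] have "C.cg (\<rho> (\<lambda>V. if i \<in> V then c' V else c V)) (alt ?K ?u)" .
    also have "alt ?K ?u = alt ?K t + alt ?K ?t"
    proof (rule alt_concat[OF i])
      fix V assume "V \<subseteq> {..<?K} - {i}"
      then have "V - {i} = V" by auto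
      then show "t (insert i V) = ?t V" using tt[of V] by simp
    qed
    also have "C.cg \<dots> (\<rho> c + \<rho> c')" by (intro C.cg_add C.cg_sym[OF char] t t'')
    finally show "C.cg (\<rho> (\<lambda>V. if i \<in> V then c' V else c V)) (\<rho> c + \<rho> c')" .
  qed
  have J: "finite ?J" "\<forall>j\<in>?J. 1 \<le> fst j" by (auto simp: free_index_def)
  obtain f0 where f0: "\<And>x. f0 x \<in> Zvec m"
    "\<And>c. fcub ?J fst ?K c \<Longrightarrow> C.cg (\<rho> c) (alt ?K (\<lambda>V. f0 (c V)))"
    using C.cocycle_is_coboundary[OF J r] by blast
  show thesis
  proof (rule that[of "\<lambda>x. f0 (enc l x)"])
    show "f0 (enc l x) \<in> Zvec m" for x by (rule f0(1))
    fix c assume c: "cub (free_nilspace l a) ?K c"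
    let ?e = "\<lambda>V. enc l (c V)"
    note e = fcub_enc[OF c]
    obtain t where t: "P ?e t" using exP[OF e] by blast
    have "C.cg (alt ?K (\<lambda>V. f0 (?e V))) (\<rho> ?e)" by (rule C.cg_sym[OF f0(2)[OF e]])
    also have "C.cg \<dots> (alt ?K t)" by (rule char[OF t])
    finally have "alt ?K (\<lambda>V. f0 (?e V) - t V) \<in> stab" by (simp add: C.cg_def alt_diff)
    then have "cub N ?K (\<lambda>V. act (f0 (?e V) - t V) (act (t V) (h' (dec l (?e V)))))"
      using act_cub_iff[of "\<lambda>V. act (t V) (h' (dec l (?e V)))"] t by (simp add: P_def)
    then show "cub N ?K (\<lambda>V. act (f0 (?e V)) (h' (c V)))"
    proof (rule cub_cong)
      fix V assume "V \<subseteq> {..<?K}"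
      then have "dec l (?e V) = c V" using c by (intro dec_enc[of _ l a]) (simp add: cub_free)
      then show "act (f0 (?e V) - t V) (act (t V) (h' (dec l (?e V)))) = act (f0 (?e V)) (h' (c V))"
        by (simp add: act_act)
    qed
  qed
qed

text \<open>\<open>w\<close> is polynomial modulo \<open>stab\<close>, so its alternating sums form a cocycle with values in
  \<open>stab\<close>; subtracting a primitive makes \<open>w\<close> polynomial without changing its action.\<close>
lemma polynomial_lift:
  fixes w :: "(nat \<Rightarrow> int) \<Rightarrow> nat \<Rightarrow> int"
  assumes w: "\<And>x. w x \<in> Zvec m"
    and cubes: "\<And>c. cub (Zlin n) (Suc k) c \<Longrightarrow> alt (Suc k) (\<lambda>V. w (c V)) \<in> stab"
  obtains z where "\<And>x. z x \<in> Zvec m" "\<And>x. act (z x) = act (w x)"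
    "\<And>l c. cub (Zlin n) l c \<Longrightarrow> polyd k l (\<lambda>V. z (c V))"
proof -
  \<comment> \<open>With trivial \<open>H0\<close> the congruences become equalities, so the
    corrected map is genuinely polynomial; with values in \<open>stab\<close> the correction does
    not affect the action.\<close>
  interpret D: coefficients "Zvec m \<inter> stab" "{0}"
    by (simp add: coefficients_def subgp_Zstab) (simp add: subgp_def)
  have "D.cocycle {..<n} (\<lambda>_. 1) (Suc k) (\<lambda>c. alt (Suc k) (\<lambda>V. w (c V)))"
  proof (rule D.cocycle_coboundary)
    fix c assume "fcub {..<n} (\<lambda>_. 1) (Suc k) c"
    then show "alt (Suc k) (\<lambda>V. w (c V)) \<in> Zvec m \<inter> stab"
      using cubes[of c] subgp_alt[OF subgp_Zvec w] by (simp add: cub_Zlin)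
  qed
  from D.cocycle_is_coboundary[OF _ _ this] obtain g where g: "\<And>x. g x \<in> Zvec m \<inter> stab"
    "\<And>c. fcub {..<n} (\<lambda>_. 1) (Suc k) c \<Longrightarrow>
       alt (Suc k) (\<lambda>V. w (c V)) = alt (Suc k) (\<lambda>V. g (c V))"
    by (auto simp: D.cg_def)
  show thesis
  proof (rule that[of "\<lambda>x. w x - g x"])
    show "w x - g x \<in> Zvec m" for x using w g(1) by (intro subgp_diff subgp_Zvec) auto
    show "act (w x - g x) = act (w x)" for x
    proof -
      have "act (w x - g x + g x) = act (w x - g x) \<circ> act (g x)" by (rule act_add)
      then show ?thesis using g(1)[of x] by (simp add: stab_def)
    qed
    fix l c assume c: "cub (Zlin n) l c"
    show "polyd k l (\<lambda>V. w (c V) - g (c V))" unfolding polyd_def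
    proof (intro allI impI)
      fix M assume "smor (Suc k) l M"
      then have "fcub {..<n} (\<lambda>_. 1) (Suc k) (\<lambda>V. c (M V))"
        using c by (simp add: cub_Zlin fcub_smor)
      from g(2)[OF this] show "alt (Suc k) (\<lambda>V. w (c (M V)) - g (c (M V))) = 0" by (simp add: alt_diff)
    qed
  qed
qed

end

section \<open>The free cover\<close>

text \<open>A 0-step nilspace is a point: any two points form an edge, and uniqueness in dimension 1
  identifies its ends. The empty product covers it.\<close>

lemma free_cover_0:
  fixes N :: "'a cubespace"
  assumes N: "is_kstep_nilspace 0 N"
  shows "\<exists>(a::nat \<Rightarrow> nat) (h::(nat \<Rightarrow> nat \<Rightarrow> int) \<Rightarrow> 'a).
           factor_map 0 (free_nilspace 0 a) N h \<and>
           (\<forall>n (\<phi>::(nat \<Rightarrow> int) \<Rightarrow> 'a). cs_morphism (Zlin n) N \<phi> \<longrightarrow>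
              (\<exists>\<phi>'. cs_morphism (Zlin n) (free_nilspace 0 a) \<phi>' \<and>
                     (\<forall>x\<in>carr (Zlin n). h (\<phi>' x) = \<phi> x)))"
proof -
  interpret nilspace N using N by unfold_locales (simp add: is_kstep_nilspace_def)
  obtain e where e: "e \<in> carr N" using nilspace unfolding is_nilspace_def by auto
  have single: "y = e" if "y \<in> carr N" for y
  proof -
    have "(\<lambda>V::nat set. if 0 \<in> V then y else e) {..<0 + 1} = (\<lambda>V. e) {..<0 + 1}"
    proof (rule kstep_unique[OF N])
      show "cub N (0 + 1) (\<lambda>V. if 0 \<in> V then y else e)" using cub_edge[OF e that, of 0 1] by simp
      show "cub N (0 + 1) (\<lambda>V. e)" by (rule cub_const[OF e])
      fix V :: "nat set" assume "V \<subset> {..<0 + 1}"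
      then have "0 \<notin> V" by auto
      then show "(if 0 \<in> V then y else e) = e" by simp
    qed
    then show ?thesis by simp
  qed
  let ?F = "free_nilspace 0 (\<lambda>_. 0)"
  have "cs_morphism ?F N (\<lambda>_. e)"
    using e by (intro cs_morphismI cubespace_free cub_const) auto
  then have "factor_map 0 ?F N (\<lambda>_. e)" by (simp add: factor_map_def)
  moreover have "\<exists>\<phi>'. cs_morphism (Zlin n) ?F \<phi>' \<and> (\<forall>x\<in>carr (Zlin n). e = \<phi> x)"
    if "cs_morphism (Zlin n) N \<phi>" for n and \<phi> :: "(nat \<Rightarrow> int) \<Rightarrow> 'a"
  proof (intro exI conjI ballI)
    \<comment> \<open>The only element of the empty product is the function that is
      \<open>undefined\<close> everywhere.\<close>
    show "cs_morphism (Zlin n) ?F (\<lambda>_ _. undefined)"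
      by (rule cs_morphismI[OF cubespace_Zlin]) (auto simp: cub_free carr_free)
    fix x assume "x \<in> carr (Zlin n)"
    then have "\<phi> x \<in> carr N" using that unfolding cs_morphism_def by blast
    then show "e = \<phi> x" using single by simp
  qed
  ultimately show ?thesis by (intro exI[of _ "\<lambda>_. 0"] exI[of _ "\<lambda>_. e"]) auto
qed

context kaction
begin

text \<open>The new factor \<open>\<int>^m\<close> in degree \<open>k\<close> moves points within
  their fibres: a \<open>(k+1)\<close>-cube of it has vanishing alternating sum, which is what
  \<open>act_cub_iff\<close> asks for.\<close>

lemma free_cover_step:
  fixes a :: "nat \<Rightarrow> nat" and h' :: "(nat \<Rightarrow> nat \<Rightarrow> int) \<Rightarrow> 'a"
  assumes kl: "k = Suc l" and fac: "factor_map l (free_nilspace l a) quot h'"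
    and lift: "\<And>n \<phi>. cs_morphism (Zlin n) quot \<phi> \<Longrightarrow>
       \<exists>\<phi>'. cs_morphism (Zlin n) (free_nilspace l a) \<phi>' \<and> (\<forall>x\<in>carr (Zlin n). h' (\<phi>' x) = \<phi> x)"
  shows "\<exists>(a::nat \<Rightarrow> nat) (h::(nat \<Rightarrow> nat \<Rightarrow> int) \<Rightarrow> 'a).
           factor_map k (free_nilspace k a) N h \<and>
           (\<forall>n (\<phi>::(nat \<Rightarrow> int) \<Rightarrow> 'a). cs_morphism (Zlin n) N \<phi> \<longrightarrow>
              (\<exists>\<phi>'. cs_morphism (Zlin n) (free_nilspace k a) \<phi>' \<and>
                     (\<forall>x\<in>carr (Zlin n). h (\<phi>' x) = \<phi> x)))"
proof -
  let ?F' = "free_nilspace l a"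
  let ?a = "a(k := m)"
  let ?F = "free_nilspace k ?a"
  have h': "cs_morphism ?F' quot h'" using fac by (simp add: factor_map_def)
  have h'_carr: "h' x \<in> carr quot" if "x \<in> carr ?F'" for x
    using h' that unfolding cs_morphism_def by blast
  obtain f where f: "\<And>x. f x \<in> Zvec m"
    "\<And>c. cub ?F' (Suc k) c \<Longrightarrow> cub N (Suc k) (\<lambda>V. act (f (c V)) (h' (c V)))"
    using lift_exists[OF h'] by blast
  define pr :: "(nat \<Rightarrow> nat \<Rightarrow> int) \<Rightarrow> nat \<Rightarrow> nat \<Rightarrow> int" where "pr x = restrict x {1..l}" for x
  \<comment> \<open>\<open>f\<close> corrects \<open>h'\<close>, which hits representatives and need
    not send cubes to cubes of \<open>N\<close>; the last coordinate then acts freely on top of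
    it.\<close>
  define h where "h x = act (x k + f (pr x)) (h' (pr x))" for x
  have kk: "{1..k} = insert k {1..l}" "k \<notin> {1..l}" using kl by auto
  have pr_carr: "pr x \<in> carr ?F'" if "x \<in> carr ?F" for x
    using that kk by (auto simp: carr_free pr_def PiE_def Pi_def)
  have pr_upd: "y(k := t) \<in> carr ?F \<and> pr (y(k := t)) = y" if "y \<in> carr ?F'" "t \<in> Zvec m" for y t
    using that kk by (auto simp: carr_free pr_def PiE_def Pi_def extensional_def fun_eq_iff)
  have pr_cub: "cub ?F' n (\<lambda>V. pr (c V))" if "cub ?F n c" for n c
    using that pr_carr kk by (auto simp: cub_free pr_def)
  have h_carr: "h x \<in> carr N" if "x \<in> carr ?F" for x
    unfolding h_def using quot_carr[OF h'_carr[OF pr_carr[OF that]]] by (intro Tr_carr[OF act_Tr]) simp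
  have rep_h: "rep (h x) = h' (pr x)" if "x \<in> carr ?F" for x
  proof -
    have q: "h' (pr x) \<in> carr N" "rep (h' (pr x)) = h' (pr x)"
      using quot_carr[OF h'_carr[OF pr_carr[OF that]]] by auto
    have "rel (h' (pr x)) (h x)" unfolding h_def by (rule Tr_rel[OF act_Tr q(1)])
    then show ?thesis using rep_eq q(2) by simp
  qed
  have h: "cs_morphism ?F N h"
  proof (rule morphism_of_top_cubes[OF cubespace_free])
    show "h ` carr ?F \<subseteq> carr N" using h_carr by blast
    fix c assume c: "cub ?F (Suc k) c"
    have "polyd k (Suc k) (\<lambda>V. c V k)" using c kk by (simp add: cub_free)
    then have "alt (Suc k) (\<lambda>V. c (V \<inter> {..<Suc k}) k) = 0"
      unfolding polyd_def using smor_Int[of "Suc k" "{..<Suc k}"] by blast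
    moreover have "alt (Suc k) (\<lambda>V. c (V \<inter> {..<Suc k}) k) = alt (Suc k) (\<lambda>V. c V k)"
      by (rule alt_cong) (simp add: Int_absorb2)
    ultimately have "alt (Suc k) (\<lambda>V. c V k) = 0" by (simp only:)
    then have "alt (Suc k) (\<lambda>V. c V k) \<in> stab" by (simp only: stab_0)
    then have "cub N (Suc k) (\<lambda>V. act (c V k) (act (f (pr (c V))) (h' (pr (c V)))))"
      using act_cub_iff[OF f(2)[OF pr_cub[OF c]]] by simp
    then show "cub N (Suc k) (\<lambda>V. h (c V))" by (simp add: h_def act_act)
  qed
  have "h ` {y \<in> carr ?F. sim ?F i x y} = {z \<in> carr N. sim N i (h x) z}"
    if i: "i \<in> {1..k}" and x: "x \<in> carr ?F" for i x
  proof
    show "h ` {y \<in> carr ?F. sim ?F i x y} \<subseteq> {z \<in> carr N. sim N i (h x) z}"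
    proof clarify
      fix y assume y: "y \<in> carr ?F" "sim ?F i x y"
      from cs_morphism_cub[OF h y(2)[unfolded sim_cub]]
      have "sim N i (h x) (h y)" unfolding sim_cub by (rule cub_cong) auto
      then show "h y \<in> carr N \<and> sim N i (h x) (h y)" using h_carr[OF y(1)] by simp
    qed
  next
    show "{z \<in> carr N. sim N i (h x) z} \<subseteq> h ` {y \<in> carr ?F. sim ?F i x y}"
    proof clarify
      fix z assume z: "z \<in> carr N" "sim N i (h x) z"
      show "z \<in> h ` {y \<in> carr ?F. sim ?F i x y}"
      proof (cases "i = k")
        case True
        have "cub N (Suc k) (\<lambda>V. if V = {} then h x else z)" using z(2) True by (simp add: sim_cub)
        \<comment> \<open>This cube and the constant one differ at most at the bottom, so in degree
          \<open>k\<close> the class is a single point.\<close>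
        from uniq[OF this cub_const[OF z(1)], of "{}"] have "h x = z" by auto
        moreover have "sim ?F i x x" using x by (simp add: sim_cub cub_free polyd_const)
        ultimately show ?thesis using x by blast
      next
        case False
        then have i': "i \<in> {1..l}" using i kl by auto
        from cs_morphism_cub[OF rep_morphism z(2)[unfolded sim_cub]]
        have "sim quot i (h' (pr x)) (rep z)" unfolding sim_cub
          by (rule cub_cong) (simp add: rep_h[OF x])
        moreover have "rep z \<in> carr quot" using z(1) by (simp add: carr_quot)
        moreover have "h' ` {y \<in> carr ?F'. sim ?F' i (pr x) y} = {z \<in> carr quot. sim quot i (h' (pr x)) z}"
          using fac i' pr_carr[OF x] unfolding factor_map_def by blast
        ultimately have "rep z \<in> h' ` {y \<in> carr ?F'. sim ?F' i (pr x) y}" by simp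
        then obtain y where y: "y \<in> carr ?F'" "sim ?F' i (pr x) y" "h' y = rep z" by auto
        have "rel (h' y) z" unfolding y(3) by (rule rel_sym[OF rel_rep[OF z(1)]])
        then obtain t where t: "t \<in> Zvec m" "act t (h' y) = z" using act_trans by blast
        \<comment> \<open>Subtracting \<open>f y\<close> undoes the correction inside
          \<open>h\<close>, so that exactly \<open>act t\<close> reaches \<open>z\<close>.\<close>
        let ?y = "y(k := t - f y)"
        have "t - f y \<in> Zvec m" using t(1) f(1) by (intro subgp_diff subgp_Zvec)
        then have Y: "?y \<in> carr ?F" "pr ?y = y" using pr_upd[OF y(1)] by auto
        have "h ?y = z" unfolding h_def Y(2) using t(2) by simp
        moreover have "sim ?F i x ?y"
          unfolding sim_cub cub_free
        proof (intro conjI allI impI ballI)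
          fix V :: "nat set"
          show "(if V = {} then x else ?y) \<in> carr ?F" using x Y by simp
        next
          fix j assume j: "j \<in> {1..k}"
          show "polyd j (i + 1) (\<lambda>V. (if V = {} then x else ?y) j)"
          proof (cases "j = k")
            case True
            \<comment> \<open>The cube has dimension \<open>i + 1 \<le> k\<close>, so its last
              coordinate is unconstrained.\<close>
            then show ?thesis using i' kl by (intro polyd_low) simp
          next
            case False
            then have j': "j \<in> {1..l}" using j kk by auto
            have "polyd j (i + 1) (\<lambda>V. (if V = {} then pr x else y) j)"
              using y(2) j' by (simp add: sim_cub cub_free)
            then show ?thesis by (rule polyd_cong) (use False j' in \<open>simp add: pr_def\<close>)
          qed
        qed
        ultimately show ?thesis using Y(1) by blast
      qed
    qed
  qed
  then have factor: "factor_map k ?F N h" using h by (simp add: factor_map_def)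
  have "\<exists>\<phi>'. cs_morphism (Zlin n) ?F \<phi>' \<and> (\<forall>x\<in>carr (Zlin n). h (\<phi>' x) = \<phi> x)"
    if \<phi>: "cs_morphism (Zlin n) N \<phi>" for n and \<phi> :: "(nat \<Rightarrow> int) \<Rightarrow> 'a"
  proof -
    have \<phi>_carr: "\<phi> x \<in> carr N" if "x \<in> carr (Zlin n)" for x
      using \<phi> that unfolding cs_morphism_def by blast
    have "cs_morphism (Zlin n) quot (\<lambda>x. rep (\<phi> x))"
    proof (rule cs_morphismI[OF cubespace_Zlin])
      show "(\<lambda>x. rep (\<phi> x)) ` carr (Zlin n) \<subseteq> carr quot" using \<phi>_carr by (auto simp: carr_quot)
      show "cub quot l (\<lambda>V. rep (\<phi> (c V)))" if "cub (Zlin n) l c" for l c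
        by (rule cub_rep[OF cs_morphism_cub[OF \<phi> that]])
    qed
    from lift[OF this] obtain \<psi> where \<psi>: "cs_morphism (Zlin n) ?F' \<psi>"
      "\<And>x. x \<in> carr (Zlin n) \<Longrightarrow> h' (\<psi> x) = rep (\<phi> x)" by blast
    have \<psi>_carr: "\<psi> x \<in> carr ?F'" if "x \<in> carr (Zlin n)" for x
      using \<psi>(1) that unfolding cs_morphism_def by blast
    have "\<exists>u. u \<in> Zvec m \<and> (x \<in> carr (Zlin n) \<longrightarrow> act u (h' (\<psi> x)) = \<phi> x)" for x
    proof (cases "x \<in> carr (Zlin n)")
      case True
      have "rel (h' (\<psi> x)) (\<phi> x)"
        unfolding \<psi>(2)[OF True] by (rule rel_sym[OF rel_rep[OF \<phi>_carr[OF True]]])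
      then show ?thesis using act_trans by blast
    next
      case False
      then show ?thesis using subgp_0[OF subgp_Zvec] by blast
    qed
    then obtain u where u: "\<And>x. u x \<in> Zvec m"
      "\<And>x. x \<in> carr (Zlin n) \<Longrightarrow> act (u x) (h' (\<psi> x)) = \<phi> x" by metis
    \<comment> \<open>\<open>u\<close> carries \<open>h' (\<psi> x)\<close> to
      \<open>\<phi> x\<close>; what remains for the last coordinate is \<open>u\<close> minus the
      correction already contained in \<open>h\<close>.\<close>
    define w where "w x = u x - f (\<psi> x)" for x
    have w: "w x \<in> Zvec m" for x unfolding w_def using u(1) f(1) by (intro subgp_diff subgp_Zvec)
    have wc: "alt (Suc k) (\<lambda>V. w (c V)) \<in> stab" if c: "cub (Zlin n) (Suc k) c" for c
    proof -
      have base: "cub N (Suc k) (\<lambda>V. act (f (\<psi> (c V))) (h' (\<psi> (c V))))"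
        by (rule f(2)[OF cs_morphism_cub[OF \<psi>(1) c]])
      have "cub N (Suc k) (\<lambda>V. \<phi> (c V))" by (rule cs_morphism_cub[OF \<phi> c])
      then have "cub N (Suc k) (\<lambda>V. act (w (c V)) (act (f (\<psi> (c V))) (h' (\<psi> (c V)))))"
      proof (rule cub_cong)
        fix V assume "V \<subseteq> {..<Suc k}"
        then have "c V \<in> carr (Zlin n)" by (rule cub_carr[OF cubespace_Zlin c])
        from u(2)[OF this] show "\<phi> (c V) = act (w (c V)) (act (f (\<psi> (c V))) (h' (\<psi> (c V))))"
          by (simp add: w_def act_act)
      qed
      then show ?thesis using act_cub_iff[OF base] by simp
    qed
    obtain z where z: "\<And>x. z x \<in> Zvec m" "\<And>x. act (z x) = act (w x)"
      "\<And>l c. cub (Zlin n) l c \<Longrightarrow> polyd k l (\<lambda>V. z (c V))"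
      using polynomial_lift[of w n, OF w wc] by blast
    define \<phi>' where "\<phi>' x = (\<psi> x)(k := z x)" for x
    have pr': "\<phi>' x \<in> carr ?F \<and> pr (\<phi>' x) = \<psi> x" if "x \<in> carr (Zlin n)" for x
      unfolding \<phi>'_def by (rule pr_upd[OF \<psi>_carr[OF that] z(1)])
    have "cs_morphism (Zlin n) ?F \<phi>'"
    proof (rule cs_morphismI[OF cubespace_Zlin])
      show "\<phi>' ` carr (Zlin n) \<subseteq> carr ?F" using pr' by blast
      fix r c assume c: "cub (Zlin n) r c"
      show "cub ?F r (\<lambda>V. \<phi>' (c V))"
        unfolding cub_free
      proof (intro conjI allI impI ballI)
        fix V assume "V \<subseteq> {..<r}"
        then show "\<phi>' (c V) \<in> carr ?F" using pr' cub_carr[OF cubespace_Zlin c] by blast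
      next
        fix j assume j: "j \<in> {1..k}"
        show "polyd j r (\<lambda>V. \<phi>' (c V) j)"
        proof (cases "j = k")
          case True
          then show ?thesis using z(3)[OF c] by (simp add: \<phi>'_def)
        next
          case False
          then have "polyd j r (\<lambda>V. \<psi> (c V) j)"
            using cs_morphism_cub[OF \<psi>(1) c] j kk by (auto simp: cub_free)
          then show ?thesis using False by (simp add: \<phi>'_def)
        qed
      qed
    qed
    moreover have "h (\<phi>' x) = \<phi> x" if "x \<in> carr (Zlin n)" for x
    proof -
      have "h (\<phi>' x) = act (z x) (act (f (\<psi> x)) (h' (\<psi> x)))"
        using pr'[OF that] by (simp add: h_def act_act \<phi>'_def)
      also have "\<dots> = act (w x + f (\<psi> x)) (h' (\<psi> x))" by (simp only: z(2) act_act)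
      also have "\<dots> = \<phi> x" using u(2)[OF that] by (simp add: w_def)
      finally show ?thesis .
    qed
    ultimately show ?thesis by blast
  qed
  then show ?thesis using factor by blast
qed

end

theorem mainTheorem6:
  fixes N :: "'a cubespace" and k :: nat
  assumes "is_kstep_nilspace k N" and "finite (carr N)"
  shows "\<exists>(a::nat \<Rightarrow> nat) (h::(nat \<Rightarrow> nat \<Rightarrow> int) \<Rightarrow> 'a).
           factor_map k (free_nilspace k a) N h \<and>
           (\<forall>n (\<phi>::(nat \<Rightarrow> int) \<Rightarrow> 'a). cs_morphism (Zlin n) N \<phi> \<longrightarrow>
              (\<exists>\<phi>'. cs_morphism (Zlin n) (free_nilspace k a) \<phi>' \<and>
                     (\<forall>x\<in>carr (Zlin n). h (\<phi>' x) = \<phi> x)))"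
  using assms
proof (induction k arbitrary: N)
  case 0
  then show ?case by (intro free_cover_0)
next
  case (Suc l)
  interpret kstep N "Suc l"
    using Suc(2) by unfold_locales (auto simp: is_kstep_nilspace_def)
  obtain act m where "\<And>t::nat \<Rightarrow> int. act t \<in> Tr" "\<And>s t. act (s + t) = act s \<circ> act t"
    "\<And>x y. rel x y \<Longrightarrow> \<exists>t\<in>Zvec m. act t x = y"
    by (rule action_exists[OF Suc(3)]) (rule that)
  then interpret kaction N "Suc l" act m by unfold_locales
  have "is_kstep_nilspace l quot" using kstep_quot by simp
  from Suc(1)[OF this finite_quot[OF Suc(3)]] obtain a and h' :: "(nat \<Rightarrow> nat \<Rightarrow> int) \<Rightarrow> 'a"
    where fac: "factor_map l (free_nilspace l a) quot h'"
    and lift: "\<forall>n \<phi>. cs_morphism (Zlin n) quot \<phi> \<longrightarrow>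
       (\<exists>\<phi>'. cs_morphism (Zlin n) (free_nilspace l a) \<phi>' \<and> (\<forall>x\<in>carr (Zlin n). h' (\<phi>' x) = \<phi> x))"
    by (elim exE conjE)
  show ?case by (rule free_cover_step[OF refl fac lift[rule_format]])
qed

end
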